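(* Let $n\ge 21$ and let $U$ be a unicyclic graph of order $n$ with girth $3$. Then $\lambda_2(U)\ge 1-\frac{\sqrt6}{3}$ if and only if one of the following holds (all $l_i$ denote nonnegative integers): (i) $U\cong C_3(K_{1,1},K_{1,1},T(l_0,l_1,l_2))$, where $l_0+2l_1+3l_2+5=n\ge 21$. (ii) $U\cong C_3(K_{1,1},K_{1,2},T(l_0,l_1,l_2))$, where $l_0+2l_1+3l_2+6=n\ge 21$. (iii) $U\cong C_3(K_{1,1},K_{1,3},T(l_0,l_1,0))$, where $21\le l_0+2l_1+7=n\le 28$, $0\le l_1\le 3$, and one of the following holds: (1) $l_1=3$ and $8\le l_0\le 9$; (2) $l_1=2$ and $10\le l_0\le 13$; (3) $l_1=1$ and $12\le l_0\le 17$; (4) $l_1=0$ and $14\le l_0\le 21$. (iv) $U\cong C_3(K_{1,2},K_{1,2},T(l_0,l_1,0))$, where $21\le l_0+2l_1+7=n\le 37$, $0\le l_1\le 7$, and one of the following holds: (1) $l_1=7$ and $0\le l_0\le 2$; (2) $l_1=6$ and $2\le l_0\le 6$; (3) $l_1=5$ and $4\le l_0\le 10$; (4) $l_1=4$ and $6\le l_0\le 14$; (5) $l_1=3$ and $8\le l_0\le 18$; (6) $l_1=2$ and $10\le l_0\le 22$; (7) $l_1=1$ and $12\le l_0\le 26$; (8) $l_1=0$ and $14\le l_0\le 30$. (v) $U\cong C_3(K_{1,2},K_{1,3},T(11,1,0))$. (vi) $U\cong S_3(3,4,k)$ for some integer $k$ with $14\le k\le 16$. (vii) $U\cong S_3(4,4,13)$.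 (viii) $U\cong S_3(7,7,7)$. (ix) $U\cong C_3(K_{1,1},T(l_0,l_1,l_2),K_1)$, where $l_0+2l_1+3l_2+4=n\ge 21$. (x) $U\cong C_3(K_{1,2},T(l_0,l_1,l_2),K_1)$, where $l_0+2l_1+3l_2+5=n\ge 21$. (xi) $U\cong C_3(K_{1,3},T(l_0,l_1,0),K_1)$, where $21\le l_0+2l_1+6=n\le 39$, $0\le l_1\le 8$, and one of the following holds: (1) $l_1=8$ and $0\le l_0\le 1$; (2) $l_1=7$ and $1\le l_0\le 5$; (3) $l_1=6$ and $3\le l_0\le 9$; (4) $l_1=5$ and $5\le l_0\le 13$; (5) $l_1=4$ and $7\le l_0\le 17$; (6) $l_1=3$ and $9\le l_0\le 21$; (7) $l_1=2$ and $11\le l_0\le 25$; (8) $l_1=1$ and $13\le l_0\le 29$; (9) $l_1=0$ and $15\le l_0\le 33$. (xii) $U\cong C_3(T(l_0,l_1,l_2),K_1,K_1)$, where $l_0+2l_1+3l_2+3=n\ge 21$. Furthermore, $\lambda_2(U)=1-\frac{\sqrt6}{3}$ if and only if $U$ is isomorphic to one of the following graphs: $C_3(K_{1,1},K_{1,1},T(l_0,l_1,l_2))$ with $l_2\ge 2$; $C_3(K_{1,1},K_{1,2},T(l_0,l_1,l_2))$ with $l_2\ge 1$; $C_3(K_{1,1},T(l_0,l_1,l_2),K_1)$ with $l_2\ge 2$; $C_3(K_{1,2},T(l_0,l_1,l_2),K_1)$ with $l_2\ge 2$; $C_3(T(l_0,l_1,l_2),K_1,K_1)$ with $l_2\ge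 2$.
   Context: All graphs are finite, simple, undirected and connected. A unicyclic graph is a connected graph with exactly one cycle; its girth is the length of that cycle. For a graph $G$ with adjacency matrix $A(G)$ and diagonal degree matrix $D(G)$, put $L(G)=D(G)-A(G)$; the normalized Laplacian is $\mathcal L(G)=D(G)^{-1/2}L(G)D(G)^{-1/2}$. Its eigenvalues, counted with multiplicity, are ordered $0=\lambda_1(G)\le\lambda_2(G)\le\cdots\le\lambda_n(G)$. Given rooted trees $T_1,\dots,T_g$, the graph $C_g(T_1,\dots,T_g)$ is obtained from the cycle $C_g=v_1v_2\cdots v_gv_1$ by identifying $v_i$ with the root of $T_i$ for each $i=1,\dots,g$. Here $K_1$ is the one-vertex rooted tree and $K_{1,m}$ ($m\ge1$) is the star with $m$ leaves rooted at its center (for $m=1$, an edge rooted at one of its ends), so that attaching $K_{1,m}$ at $v_i$ means attaching $m$ pendent vertices to $v_i$. For positive integers $n_1,\dots,n_g$, $S_g(n_1,\dots,n_g)$ denotes $C_g(T_1,\dots,T_g)$ with each $T_i$ the star of order $n_i$ rooted at its center ($T_i=K_{1,n_i-1}$, or $K_1$ if $n_i=1$). For nonnegative integers $l_0,l_1,l_2$, $T(l_0,l_1,l_2)$ denotes the rooted tree whose root has exactly $l_0+l_1+l_2$ children, of which exactly $l_i$ have exactly $i$ children ($i=0,1,2$), and all grandchildren of the root are leaves; it has $1+l_0+2l_1+3l_2$ vertices. *)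

theory Defs
  imports
    Complex_Main
    "HOL-Computational_Algebra.Polynomial"
    "HOL-Library.Multiset"
    "Graph_Theory.Pair_Digraph"
    "Graph_Theory.Digraph_Component"
    "Graph_Theory.Digraph_Isomorphism"
    "Jordan_Normal_Form.Char_Poly"
begin

text \<open>
  Finite simple undirected graphs are the \<open>pair_graph\<close>s of \<open>Graph_Theory\<close>: finite, loop-free,
  symmetric digraphs whose arcs are pairs of vertices, so that an edge \<open>uv\<close> is represented by the
  two arcs \<open>(u,v)\<close> and \<open>(v,u)\<close>.
\<close>

abbreviation isomorphic :: "'a pair_pre_digraph \<Rightarrow> 'b pair_pre_digraph \<Rightarrow> bool" (infix \<open>\<simeq>\<close> 50) where
  "G \<simeq> H \<equiv> digraph_iso (with_proj G) (with_proj H)"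

section \<open>Unicyclic graphs\<close>

text \<open>
  A cycle of an undirected graph is identified with its set of edges, so neither its starting point
  nor its orientation matters. In a symmetric digraph \<open>u, v, u\<close> is a directed cycle;
  the length bound excludes it.
\<close>

definition undirected_cycles :: "'a pair_pre_digraph \<Rightarrow> 'a set set set" where
  "undirected_cycles G =
     {(\<lambda>(u, v). {u, v}) ` set p | p. pre_digraph.cycle (with_proj G) p \<and> 3 \<le> length p}"

definition unicyclic :: "'a pair_pre_digraph \<Rightarrow> bool" where
  "unicyclic G \<longleftrightarrow> pair_graph G \<and> connected (with_proj G) \<and> (\<exists>!C. C \<in> undirected_cycles G)"

text \<open>The length of the unique cycle; only meaningful for unicyclic graphs.\<close>

definition unicyclic_girth :: "'a pair_pre_digraph \<Rightarrow> nat" where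
  "unicyclic_girth G = card (THE C. C \<in> undirected_cycles G)"

section \<open>The normalized Laplacian and its eigenvalues\<close>

text \<open>
  The matrices are indexed by positions in an enumeration \<open>vs\<close> of the vertices. In a symmetric
  digraph the degree of a vertex is its out-degree.
\<close>

definition adjacency_mat :: "'a pair_pre_digraph \<Rightarrow> 'a list \<Rightarrow> real mat" where
  "adjacency_mat G vs =
     mat (length vs) (length vs) (\<lambda>(i, j). if (vs ! i, vs ! j) \<in> parcs G then 1 else 0)"

definition degree_mat :: "'a pair_pre_digraph \<Rightarrow> 'a list \<Rightarrow> real mat" where
  "degree_mat G vs = mat_diag (length vs) (\<lambda>i. real (out_degree (with_proj G) (vs ! i)))"

definition laplacian_mat :: "'a pair_pre_digraph \<Rightarrow> 'a list \<Rightarrow> real mat" where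
  "laplacian_mat G vs = degree_mat G vs - adjacency_mat G vs"

definition degree_mat_inv_sqrt :: "'a pair_pre_digraph \<Rightarrow> 'a list \<Rightarrow> real mat" where
  "degree_mat_inv_sqrt G vs =
     mat_diag (length vs) (\<lambda>i. 1 / sqrt (real (out_degree (with_proj G) (vs ! i))))"

definition normalized_laplacian_mat :: "'a pair_pre_digraph \<Rightarrow> 'a list \<Rightarrow> real mat" where
  "normalized_laplacian_mat G vs =
     degree_mat_inv_sqrt G vs * laplacian_mat G vs * degree_mat_inv_sqrt G vs"

text \<open>
  The spectrum does not depend on the enumeration: another one conjugates the matrix
  by a permutation matrix.
\<close>

definition vertex_enum :: "'a pair_pre_digraph \<Rightarrow> 'a list" where
  "vertex_enum G = (SOME vs. distinct vs \<and> set vs = pverts G)"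

text \<open>
  All eigenvalues in nondecreasing order, repeated according to their multiplicity as roots of the
  characteristic polynomial. The matrix is real symmetric, so all complex roots are real, and
  algebraic and geometric multiplicities agree.
\<close>

definition nl_eigenvalues :: "'a pair_pre_digraph \<Rightarrow> real list" where
  "nl_eigenvalues G =
     sorted_list_of_multiset (proots (char_poly (normalized_laplacian_mat G (vertex_enum G))))"

text \<open>The \<open>k\<close>-th smallest eigenvalue, counting from \<open>k = 1\<close>.\<close>

definition nl_eigenvalue :: "nat \<Rightarrow> 'a pair_pre_digraph \<Rightarrow> real" where
  "nl_eigenvalue k G = nl_eigenvalues G ! (k - 1)"

section \<open>Cycles with attached rooted trees\<close>

text \<open>
  A finite rooted tree is given by the list of the subtrees at the children of its root. Its vertices
  are addressed by the sequence of child indices leading to them, the root being \<open>[]\<close>.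
\<close>

datatype rooted_tree = RNode "rooted_tree list"

fun is_vertex :: "rooted_tree \<Rightarrow> nat list \<Rightarrow> bool" where
  "is_vertex t [] = True"
| "is_vertex (RNode ts) (c # p) = (c < length ts \<and> is_vertex (ts ! c) p)"

abbreviation K1 :: rooted_tree where
  "K1 \<equiv> RNode []"

text \<open>The star \<open>K\<^sub>1\<^sub>,\<^sub>m\<close> rooted at its centre; it is \<open>K1\<close> for \<open>m = 0\<close>.\<close>

definition star :: "nat \<Rightarrow> rooted_tree" where
  "star m = RNode (replicate m K1)"

text \<open>
  \<open>T(l\<^sub>0, l\<^sub>1, l\<^sub>2)\<close>: exactly \<open>l\<^sub>i\<close> children of the root have exactly \<open>i\<close> children, which are leaves.
\<close>

definition tree_T :: "nat \<Rightarrow> nat \<Rightarrow> nat \<Rightarrow> rooted_tree" where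
  "tree_T l0 l1 l2 = RNode (replicate l0 (star 0) @ replicate l1 (star 1) @ replicate l2 (star 2))"

text \<open>
  \<open>cycle_with_trees [T\<^sub>1, \<dots>, T\<^sub>g]\<close> is the graph \<open>C\<^sub>g(T\<^sub>1, \<dots>, T\<^sub>g)\<close>, for \<open>g \<ge> 3\<close>. The vertex \<open>(i, p)\<close>
  is the vertex \<open>p\<close> of the tree at position \<open>i\<close>, counting from \<open>0\<close>; the vertices \<open>(i, [])\<close>, being
  the roots, form the cycle.
\<close>

definition cycle_with_trees :: "rooted_tree list \<Rightarrow> (nat \<times> nat list) pair_pre_digraph" where
  "cycle_with_trees ts =
     (let V = {(i, p). i < length ts \<and> is_vertex (ts ! i) p} in
      \<lparr> pverts = V,
        parcs = {((i, p), (j, q)) | i p j q. (i, p) \<in> V \<and> (j, q) \<in> V \<and>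
          (i = j \<and> ((\<exists>c. q = p @ [c]) \<or> (\<exists>c. p = q @ [c])) \<or>
           p = [] \<and> q = [] \<and> (j = Suc i mod length ts \<or> i = Suc j mod length ts))} \<rparr>)"

text \<open>\<open>S\<^sub>g(n\<^sub>1, \<dots>, n\<^sub>g)\<close> for positive \<open>n\<^sub>i\<close>, the orders of the attached stars.\<close>

definition cycle_with_stars :: "nat list \<Rightarrow> (nat \<times> nat list) pair_pre_digraph" where
  "cycle_with_stars ns = cycle_with_trees (map (\<lambda>k. star (k - 1)) ns)"

end

theory Submission
  imports Defs "Jordan_Normal_Form.Schur_Decomposition"
begin

text \<open>
  Put \<open>\<mu> = \<surd>6/3\<close> and \<open>Q(f) = \<mu> \<Sum>\<^sub>v deg(v) f(v)\<^sup>2 - \<Sum>\<^sub>(\<^sub>u\<^sub>,\<^sub>v\<^sub>) f(u) f(v)\<close>, the second sum over all arcs.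
  The substitution \<open>z = D\<^sup>1\<^sup>/\<^sup>2 f\<close> turns \<open>Q\<close> into the quadratic form of the normalized Laplacian
  minus \<open>1 - \<mu>\<close>. By the spectral theorem, \<open>\<lambda>\<^sub>2 < 1 - \<mu>\<close> means that \<open>Q\<close> is negative definite on some plane,
  and \<open>\<lambda>\<^sub>2 \<le> 1 - \<mu>\<close> that \<open>Q\<close> is nonpositive on some plane. Both parts of the theorem are
  therefore statements about the inertia of \<open>Q\<close>.
  
  A unicyclic graph of girth 3 is a triangle with trees attached: every vertex off the triangle has a
  parent closer to it, and \<open>Q\<close> is a sum of one binary form per edge. Consider the branch hanging
  from a bridge and give the two sides of the bridge separate test functions. If the branch has at
  least four vertices, or is a path of three vertices hanging by its end, then for \<open>n \<ge> 21\<close> these two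
  functions span a plane on which \<open>Q\<close> is negative
  (\<open>large_branches_negative_plane\<close>, \<open>pendant_path_negative_plane\<close>).
  So if \<open>\<lambda>\<^sub>2 \<ge> 1 - \<mu>\<close>, every branch at the triangle is a star with 0, 1 or 2 leaves attached by its
  centre, and the graph is \<open>C\<^sub>3(T, T, T)\<close> with three trees \<open>T(l\<^sub>0, l\<^sub>1, l\<^sub>2)\<close>.
  
  The value of \<open>\<mu>\<close> is special because \<open>\<mu>\<^sup>2 = 2/3\<close>: once its \<open>k\<close> leaves are eliminated, the centre of a
  branch has diagonal entry \<open>\<mu>(1 - k/2)\<close>, which is positive for \<open>k = 0, 1\<close> and zero for \<open>k = 2\<close>.
  Eliminating all branches with \<open>k < 2\<close> leaves a triangle root with the diagonal entry \<open>\<mu>(4 - s)/2\<close>,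
  where \<open>s = l\<^sub>0 + 4 l\<^sub>1\<close>, plus \<open>\<mu> l\<^sub>2\<close>; the centres of the \<open>l\<^sub>2\<close> branches with \<open>k = 2\<close> stay, with diagonal
  entry zero. There are two cases.
  
  \<^item> Some root has \<open>l\<^sub>2 \<ge> 1\<close>. This root and a zero centre at it form a hyperbolic pair, which uses up the
    one admissible negative direction, so the binary form at the other two roots has to be
    positive semidefinite. Their trees must then be stars with \<open>(4 - s\<^sub>1)(4 - s\<^sub>2) \<ge> 6\<close>
    (\<open>long_root_planes\<close>). These are the infinite families, and there the form is singular on top of the
    negative direction exactly if a second zero centre is present or \<open>(4 - s\<^sub>1)(4 - s\<^sub>2) = 6\<close>
    (\<open>small_pair_planes\<close>).
  
  \<^item> All \<open>l\<^sub>2\<close> vanish. As \<open>n \<ge> 21\<close>, the largest \<open>s\<close> exceeds 4, so that the entry of its root is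
    negative. The Schur complement of this entry has to be positive semidefinite, which is an
    integral inequality in \<open>s\<^sub>0, s\<^sub>1, s\<^sub>2\<close> because \<open>29 < 12\<surd>6 < 30\<close>; by the same irrationality it is then
    positive definite, so equality never occurs here (\<open>heavy_root_planes\<close>). The inequality and \<open>n \<ge> 21\<close> leave the
    infinite families and the sporadic parameters (\<open>heavy_legs_cases\<close>).
\<close>

section \<open>Orthogonal diagonalization of real symmetric matrices\<close>

text \<open>
  Over the complex numbers the characteristic polynomial has a root \<open>c\<close>, with an eigenvector \<open>w\<close>. By
  symmetry \<open>w\<^sup>* A w = c |w|\<^sup>2\<close> equals its own conjugate, so \<open>c\<close> is real, hence an eigenvalue of the
  real matrix.
\<close>

lemma real_symmetric_eigenvector:
  fixes A :: "real mat"
  assumes A: "A \<in> carrier_mat n n" and sym: "A\<^sup>T = A" and n: "n > 0"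
  obtains e v where "v \<in> carrier_vec n" "v \<noteq> 0\<^sub>v n" "A *\<^sub>v v = e \<cdot>\<^sub>v v"
proof -
  define cA where "cA = map_mat complex_of_real A"
  have cA: "cA \<in> carrier_mat n n" using A by (simp add: cA_def)
  have "degree (char_poly cA) = n" using degree_monic_char_poly[OF cA] by simp
  then have "\<not> constant (poly (char_poly cA))" using n by (simp add: constant_degree)
  then obtain c where c: "poly (char_poly cA) c = 0"
    using fundamental_theorem_of_algebra by blast
  then have "eigenvalue cA c" using eigenvalue_root_char_poly[OF cA] by simp
  then obtain w where w: "w \<in> carrier_vec n" "w \<noteq> 0\<^sub>v n" "cA *\<^sub>v w = c \<cdot>\<^sub>v w"
    using cA unfolding eigenvalue_def eigenvector_def by auto
  have row: "(\<Sum>j<n. of_real (A $$ (i,j)) * w $ j) = c * w $ i" if "i < n" for i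
  proof -
    have "(cA *\<^sub>v w) $ i = (\<Sum>j<n. of_real (A $$ (i,j)) * w $ j)"
      using that cA A w(1) by (simp add: scalar_prod_def cA_def atLeast0LessThan)
    then show ?thesis using w that by simp
  qed
  define s where "s = (\<Sum>i<n. \<Sum>j<n. cnj (w $ i) * (of_real (A $$ (i,j)) * w $ j))"
  have symm: "A $$ (i,j) = A $$ (j,i)" if "i < n" "j < n" for i j
    using sym A that by (metis carrier_matD index_transpose_mat(1))
  have "s = (\<Sum>i<n. cnj (w $ i) * (c * w $ i))"
    unfolding s_def using row by (simp add: sum_distrib_left[symmetric])
  then have s1: "s = c * (\<Sum>i<n. of_real ((cmod (w $ i))\<^sup>2))"
    by (simp add: sum_distrib_left complex_norm_square mult_ac flip: of_real_power)
  have "cnj s = (\<Sum>i<n. \<Sum>j<n. cnj (w $ j) * (of_real (A $$ (j,i)) * w $ i))"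
    unfolding s_def by (auto simp: symm mult_ac intro!: sum.cong)
  also have "\<dots> = s" unfolding s_def by (rule sum.swap)
  finally have s2: "cnj s = s" .
  obtain k where k: "k < n" "w $ k \<noteq> 0" using w by (metis eq_vecI carrier_vecD index_zero_vec)
  have "(\<Sum>i<n. (cmod (w $ i))\<^sup>2) > 0"
    by (rule sum_pos2[of _ k]) (use k in auto)
  moreover define r where "r = (\<Sum>i<n. (cmod (w $ i))\<^sup>2)"
  ultimately have r: "complex_of_real r \<noteq> 0" by (metis of_real_eq_0_iff less_irrefl)
  have "s = c * of_real r" using s1 by (simp add: r_def)
  then have "cnj c * of_real r = c * of_real r" using s2 by simp
  then have "cnj c = c" using r by simp
  then obtain e where e: "c = of_real e" by (metis Reals_cases Reals_cnj_iff)
  have "char_poly cA = map_poly of_real (char_poly A)"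
    unfolding cA_def by (rule of_real_hom.char_poly_hom[OF A])
  then have "poly (char_poly A) e = 0" using c e by simp
  then have "eigenvalue A e" using eigenvalue_root_char_poly[OF A] by simp
  then show thesis using that A unfolding eigenvalue_def eigenvector_def by auto
qed

text \<open>
  The Gram-Schmidt process keeps its first vector and yields orthogonal vectors; dividing each by its
  norm makes the matrix orthogonal.
\<close>

lemma orthonormal_completion:
  fixes v :: "real vec"
  assumes v: "v \<in> carrier_vec n" "v \<noteq> 0\<^sub>v n"
  obtains W c where "W \<in> carrier_mat n n" "W\<^sup>T * W = 1\<^sub>m n" "col W 0 = c \<cdot>\<^sub>v v" 
proof -
  interpret cof_vec_space n "TYPE(real)" .
  define b where "b = basis_completion v"
  from basis_completion[OF v, folded b_def]
  have b: "distinct b" "\<not> lin_dep (set b)" "set b \<subseteq> carrier_vec n" "hd b = v" "length b = n"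
    by auto
  have n: "n > 0" using v by (cases n) auto
  from b n obtain vs where bv: "b = v # vs" by (cases b) auto
  define ws where "ws = gram_schmidt n b"
  from gram_schmidt_result[OF b(3,1,2) refl, folded ws_def]
  have ws: "set ws \<subseteq> carrier_vec n" "corthogonal ws" "length ws = n"
    by (auto simp: b)
  have hd: "hd ws = v" using gram_schmidt_hd[OF v(1), of vs, folded bv] ws_def by simp
  define r where "r j = (\<Sum>k<n. (ws ! j $ k)\<^sup>2)" for j
  have wsc: "ws ! j \<in> carrier_vec n" if "j < n" for j using ws that by auto
  have orth: "((\<Sum>k<n. ws ! i $ k * ws ! j $ k) = 0) = (i \<noteq> j)" if "i < n" "j < n" for i j
    using corthogonalD[OF ws(2), of i j] that ws(3) wsc[OF that(2)]
    by (simp add: scalar_prod_def atLeast0LessThan)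
  have r: "r j > 0" if "j < n" for j
  proof -
    have "r j \<ge> 0" unfolding r_def by (simp add: sum_nonneg)
    moreover have "r j \<noteq> 0" using orth[OF that that] by (simp add: r_def power2_eq_square)
    ultimately show ?thesis by simp
  qed
  define W where "W = mat n n (\<lambda>(k, j). ws ! j $ k / sqrt (r j))"
  have "(W\<^sup>T * W) $$ (i,j) = 1\<^sub>m n $$ (i,j)" if "i < n" "j < n" for i j
  proof -
    have "(W\<^sup>T * W) $$ (i,j) = (\<Sum>k<n. ws ! i $ k / sqrt (r i) * (ws ! j $ k / sqrt (r j)))"
      using that by (simp add: W_def scalar_prod_def atLeast0LessThan)
    also have "\<dots> = (\<Sum>k<n. ws ! i $ k * ws ! j $ k) / (sqrt (r i) * sqrt (r j))"
      by (simp add: sum_divide_distrib)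
    also have "\<dots> = (if i = j then 1 else 0)"
      using orth[OF that] r[OF that(1)] by (auto simp: r_def power2_eq_square[symmetric])
    finally show ?thesis using that by simp
  qed
  then have "W\<^sup>T * W = 1\<^sub>m n" by (intro eq_matI) (auto simp: W_def)
  moreover have "col W 0 = (1 / sqrt (r 0)) \<cdot>\<^sub>v v"
  proof -
    have "ws \<noteq> []" using ws(3) n by auto
    then have "ws ! 0 = v" using hd by (simp add: hd_conv_nth)
    then show ?thesis using n v(1) by (intro eq_vecI) (auto simp: W_def)
  qed
  moreover have "W \<in> carrier_mat n n" by (simp add: W_def)
  ultimately show thesis using that by blast
qed

text \<open>
  Deflation: in an orthonormal basis that starts with an eigenvector, the matrix is block diagonal
  with blocks of sizes \<open>1\<close> and \<open>n\<close>, and the second block is again symmetric.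
\<close>

lemma real_symmetric_diagonalization:
  fixes A :: "real mat"
  assumes "A \<in> carrier_mat n n" "A\<^sup>T = A"
  shows "\<exists>P d. P \<in> carrier_mat n n \<and> P\<^sup>T * P = 1\<^sub>m n \<and> P\<^sup>T * A * P = mat_diag n d"
  using assms
proof (induction n arbitrary: A)
  case 0
  then have "(1\<^sub>m 0)\<^sup>T * A * 1\<^sub>m 0 = mat_diag 0 (\<lambda>_. 0)" by (intro eq_matI) (auto simp: mat_diag_def)
  then show ?case by (intro exI[of _ "1\<^sub>m 0"] exI[of _ "\<lambda>_. 0"]) auto
next
  case (Suc n)
  let ?N = "Suc n"
  note A = Suc.prems(1) and sym = Suc.prems(2)
  obtain e v where v: "v \<in> carrier_vec ?N" "v \<noteq> 0\<^sub>v ?N" "A *\<^sub>v v = e \<cdot>\<^sub>v v"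
    using real_symmetric_eigenvector[OF A sym] by (metis zero_less_Suc)
  obtain W c where W: "W \<in> carrier_mat ?N ?N" "W\<^sup>T * W = 1\<^sub>m ?N" "col W 0 = c \<cdot>\<^sub>v v"
    using orthonormal_completion[OF v(1,2)] by blast
  define A' where "A' = W\<^sup>T * A * W"
  have A': "A' \<in> carrier_mat ?N ?N" using A W by (simp add: A'_def)
  have "A'\<^sup>T = (W\<^sup>T * (A * W))\<^sup>T" unfolding A'_def using A W by (simp add: assoc_mult_mat[of _ ?N ?N _ ?N _ ?N])
  also have "\<dots> = (A * W)\<^sup>T * W" using A W by (subst transpose_mult[of _ ?N ?N _ ?N]) auto
  also have "\<dots> = W\<^sup>T * A * W" using A W sym by (subst transpose_mult[of _ ?N ?N _ ?N]) auto
  finally have sym': "A'\<^sup>T = A'" by (simp add: A'_def)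
  define x where "x = col W 0"
  have x: "x \<in> carrier_vec ?N" using W(1) by (auto simp: x_def intro: carrier_vecI)
  have ev: "A *\<^sub>v x = e \<cdot>\<^sub>v x"
    unfolding x_def W(3) using v A mult_mat_vec[OF A v(1), of c] by (simp add: smult_smult_assoc mult_ac)
  have col0: "A' $$ (i, 0) = (if i = 0 then e else 0)" if i: "i < ?N" for i
  proof -
    have "A' $$ (i, 0) = (W\<^sup>T * (A * W)) $$ (i, 0)" unfolding A'_def using A W by (simp add: assoc_mult_mat[of _ ?N ?N _ ?N _ ?N])
    also have "\<dots> = col W i \<bullet> (A *\<^sub>v x)"
      using A W(1) i by (simp add: col_mult2[OF A W(1)] x_def mult_mat_vec_def)
    also have "\<dots> = e * (col W i \<bullet> x)" unfolding ev using W(1) i x by simp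
    also have "col W i \<bullet> x = (W\<^sup>T * W) $$ (i, 0)" using W(1) i by (simp add: x_def)
    finally show ?thesis using W(2) i by auto
  qed
  have row0: "A' $$ (0, i) = (if i = 0 then e else 0)" if i: "i < ?N" for i
    using col0[OF i] sym' A' i by (metis carrier_matD index_transpose_mat(1) zero_less_Suc)
  define A3 where "A3 = mat n n (\<lambda>(i,j). A' $$ (Suc i, Suc j))"
  have A3: "A3 \<in> carrier_mat n n" by (simp add: A3_def)
  have sym'': "A' $$ (i,j) = A' $$ (j,i)" if "i < ?N" "j < ?N" for i j
    using sym' A' that by (metis carrier_matD index_transpose_mat(1))
  have "A3\<^sup>T = A3" by (rule eq_matI) (auto simp: A3_def sym'')
  from Suc.IH[OF A3 this] obtain P d where
    P: "P \<in> carrier_mat n n" "P\<^sup>T * P = 1\<^sub>m n" "P\<^sup>T * A3 * P = mat_diag n d" by blast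
  define E where "E = mat 1 1 (\<lambda>_. e)"
  define P' where "P' = four_block_mat (1\<^sub>m 1) (0\<^sub>m 1 n) (0\<^sub>m n 1) P"
  have E: "E \<in> carrier_mat 1 1" by (simp add: E_def)
  have P': "P' \<in> carrier_mat ?N ?N" using P by (intro carrier_matI) (auto simp: P'_def)
  have A'b: "A' = four_block_mat E (0\<^sub>m 1 n) (0\<^sub>m n 1) A3"
    by (rule eq_matI) (use A' row0 col0 in \<open>auto simp: E_def A3_def\<close>)
  have P'T: "P'\<^sup>T = four_block_mat (1\<^sub>m 1) (0\<^sub>m 1 n) (0\<^sub>m n 1) P\<^sup>T"
    unfolding P'_def using P by (subst transpose_four_block_mat) auto
  have PP: "P'\<^sup>T * P' = 1\<^sub>m ?N"
    unfolding P'T unfolding P'_def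
    by (subst mult_four_block_mat[of _ 1 1 _ n _ n _ _ 1 _ n]) (use P in \<open>auto intro!: eq_matI\<close>)
  have PAP: "P'\<^sup>T * A' * P' = four_block_mat E (0\<^sub>m 1 n) (0\<^sub>m n 1) (mat_diag n d)"
    unfolding P'T A'b unfolding P'_def using P E A3
    by (subst mult_four_block_mat[of _ 1 1 _ n _ n _ _ 1 _ n], auto,
        subst mult_four_block_mat[of _ 1 1 _ n _ n _ _ 1 _ n], auto)
  also have "\<dots> = mat_diag ?N (\<lambda>i. case i of 0 \<Rightarrow> e | Suc j \<Rightarrow> d j)"
    by (rule eq_matI) (auto simp: E_def mat_diag_def split: nat.split)
  finally have D: "P'\<^sup>T * A' * P' = mat_diag ?N (\<lambda>i. case i of 0 \<Rightarrow> e | Suc j \<Rightarrow> d j)" .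
  note assoc = assoc_mult_mat[of _ ?N ?N _ ?N _ ?N]
  have WP: "(W * P')\<^sup>T = P'\<^sup>T * W\<^sup>T" using W P' by (subst transpose_mult[of _ ?N ?N _ ?N]) auto
  have "(W * P')\<^sup>T * (W * P') = P'\<^sup>T * (W\<^sup>T * W) * P'"
    unfolding WP using W(1) P' by (simp add: assoc)
  then have 1: "(W * P')\<^sup>T * (W * P') = 1\<^sub>m ?N" using W(2) P' PP by simp
  have "(W * P')\<^sup>T * A * (W * P') = P'\<^sup>T * A' * P'"
    unfolding WP A'_def using W(1) P' A by (simp add: assoc)
  then have 2: "(W * P')\<^sup>T * A * (W * P') = mat_diag ?N (\<lambda>i. case i of 0 \<Rightarrow> e | Suc j \<Rightarrow> d j)"
    using D by simp
  have 3: "W * P' \<in> carrier_mat ?N ?N" using W P' by simp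
  show ?case using 1 2 3 by blast
qed

section \<open>The second eigenvalue in terms of a quadratic form\<close>

text \<open>
  In a symmetric digraph each vertex \<open>u\<close> is the tail of \<open>deg(u)\<close> arcs, so this is the form
  \<open>\<mu> D - A\<close> evaluated at \<open>f\<close>.
\<close>

definition qform :: "real \<Rightarrow> 'a pair_pre_digraph \<Rightarrow> ('a \<Rightarrow> real) \<Rightarrow> real" where
  "qform \<mu> G f = (\<Sum>(u, v)\<in>parcs G. \<mu> * (f u)\<^sup>2 - f u * f v)"

text \<open>
  Linear independence of \<open>f\<close> and \<open>g\<close> is implied by definiteness in the first notion and has
  to be demanded in the second.
\<close>

definition negative_plane :: "real \<Rightarrow> 'a pair_pre_digraph \<Rightarrow> bool" where
  "negative_plane \<mu> G \<longleftrightarrow>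
     (\<exists>f g. \<forall>\<alpha> \<beta>. (\<alpha>, \<beta>) \<noteq> (0, 0) \<longrightarrow> qform \<mu> G (\<lambda>v. \<alpha> * f v + \<beta> * g v) < 0)"

definition nonpositive_plane :: "real \<Rightarrow> 'a pair_pre_digraph \<Rightarrow> bool" where
  "nonpositive_plane \<mu> G \<longleftrightarrow>
     (\<exists>f g. (\<forall>\<alpha> \<beta>. qform \<mu> G (\<lambda>v. \<alpha> * f v + \<beta> * g v) \<le> 0) \<and>
        (\<forall>\<alpha> \<beta>. (\<alpha>, \<beta>) \<noteq> (0, 0) \<longrightarrow> (\<exists>v\<in>pverts G. \<alpha> * f v + \<beta> * g v \<noteq> 0)))"

lemma vertex_enum:
  assumes "finite (pverts G)"
  shows "distinct (vertex_enum G)" "set (vertex_enum G) = pverts G"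
proof -
  have "\<exists>vs. distinct vs \<and> set vs = pverts G"
    using finite_distinct_list[OF assms] by blast
  from someI_ex[OF this] show "distinct (vertex_enum G)" "set (vertex_enum G) = pverts G"
    unfolding vertex_enum_def by auto
qed

text \<open>
  The coordinates \<open>Y f\<close> are those of \<open>D\<^sup>1\<^sup>/\<^sup>2 f\<close> with respect to an orthonormal basis of eigenvectors, and
  \<open>d\<close> lists the eigenvalues. The last two properties say that \<open>Y\<close> is a bijection between functions on
  the vertices and coordinate vectors. The same \<open>Y\<close> serves every \<open>\<mu>\<close>.
\<close>

lemma nl_diagonalization:
  fixes G :: "'a pair_pre_digraph"
  assumes G: "pair_graph G" and deg: "\<And>v. v \<in> pverts G \<Longrightarrow> \<exists>u. (v, u) \<in> parcs G"
  obtains d :: "nat \<Rightarrow> real" and Y :: "('a \<Rightarrow> real) \<Rightarrow> nat \<Rightarrow> real"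
  where "nl_eigenvalues G = sort (map d [0..<card (pverts G)])"
    and "\<And>\<alpha> \<beta> f g i. Y (\<lambda>v. \<alpha> * f v + \<beta> * g v) i = \<alpha> * Y f i + \<beta> * Y g i"
    and "\<And>\<mu> f. qform \<mu> G f = (\<Sum>i<card (pverts G). (d i - (1 - \<mu>)) * (Y f i)\<^sup>2)"
    and "\<And>y. \<exists>f. \<forall>i<card (pverts G). Y f i = y i"
    and "\<And>f. (\<forall>i<card (pverts G). Y f i = 0) \<Longrightarrow> \<forall>v\<in>pverts G. f v = 0"
proof -
  interpret pair_graph G by fact
  define vs where "vs = vertex_enum G"
  define n where "n = length vs"
  have vs: "distinct vs" "set vs = pverts G"
    using vertex_enum[OF pair_finite_verts] by (auto simp: vs_def)
  have n: "card (pverts G) = n" using vs distinct_card by (fastforce simp: n_def)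
  define dg where "dg i = real (out_degree (with_proj G) (vs ! i))" for i
  define a where "a i j = (if (vs ! i, vs ! j) \<in> parcs G then 1 else 0 :: real)" for i j
  have bij: "bij_betw (\<lambda>i. vs ! i) {..<n} (pverts G)"
    using bij_betw_nth[OF vs(1)] vs(2) by (simp add: n_def)
  have sum_arcs: "(\<Sum>(u, v)\<in>parcs G. h u v) = (\<Sum>i<n. \<Sum>j<n. a i j * h (vs ! i) (vs ! j))"
    for h :: "'a \<Rightarrow> 'a \<Rightarrow> real"
  proof -
    have "(\<Sum>(u, v)\<in>parcs G. h u v) = (\<Sum>(u, v)\<in>pverts G \<times> pverts G. if (u, v) \<in> parcs G then h u v else 0)"
      by (rule sum.mono_neutral_cong_left) (auto simp: pair_finite_verts dest: wellformed' split: if_splits)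
    also have "\<dots> = (\<Sum>u\<in>pverts G. \<Sum>v\<in>pverts G. if (u, v) \<in> parcs G then h u v else 0)"
      by (simp add: sum.cartesian_product)
    also have "\<dots> = (\<Sum>i<n. \<Sum>j<n. if (vs ! i, vs ! j) \<in> parcs G then h (vs ! i) (vs ! j) else 0)"
      by (simp add: sum.reindex_bij_betw[OF bij, symmetric])
    also have "\<dots> = (\<Sum>i<n. \<Sum>j<n. a i j * h (vs ! i) (vs ! j))"
      by (intro sum.cong) (auto simp: a_def)
    finally show ?thesis .
  qed
  have dg: "dg i = (\<Sum>j<n. a i j)" if "i < n" for i
  proof -
    have "out_arcs (with_proj G) (vs ! i) = Pair (vs ! i) ` {v. (vs ! i, v) \<in> parcs G}"
      by (auto simp: out_arcs_def)
    then have "dg i = card {v. (vs ! i, v) \<in> parcs G}"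
      unfolding dg_def out_degree_def by (simp add: card_image inj_on_def)
    also have "{v. (vs ! i, v) \<in> parcs G} = (\<lambda>j. vs ! j) ` {j. j < n \<and> (vs ! i, vs ! j) \<in> parcs G}"
      using bij unfolding bij_betw_def by (auto dest: wellformed')
    also have "card \<dots> = card {j. j < n \<and> (vs ! i, vs ! j) \<in> parcs G}"
      by (rule card_image) (use bij in \<open>auto simp: bij_betw_def inj_on_def\<close>)
    also have "real \<dots> = (\<Sum>j<n. a i j)"
      by (simp add: a_def sum.If_cases Int_def)
    finally show ?thesis .
  qed
  have dgpos: "dg i > 0" if "i < n" for i
  proof -
    have "vs ! i \<in> pverts G" using bij that by (auto simp: bij_betw_def)
    then obtain u where u: "(vs ! i, u) \<in> parcs G" using deg by blast
    then obtain j where j: "j < n" "u = vs ! j" using bij by (auto simp: bij_betw_def dest: wellformed')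
    show ?thesis unfolding dg[OF that]
      by (rule sum_pos2[of _ j]) (use u j in \<open>auto simp: a_def\<close>)
  qed
  define A where "A = normalized_laplacian_mat G vs"
  have A: "A \<in> carrier_mat n n"
    unfolding A_def normalized_laplacian_mat_def degree_mat_inv_sqrt_def laplacian_mat_def
      adjacency_mat_def degree_mat_def n_def
    by (intro mult_carrier_mat[of _ _ "length vs"] minus_carrier_mat) auto
  have entry: "A $$ (i, j) = ((if i = j then dg i else 0) - a i j) / (sqrt (dg i) * sqrt (dg j))"
    if "i < n" "j < n" for i j
  proof -
    define L where "L = laplacian_mat G vs"
    have L: "L \<in> carrier_mat n n"
      unfolding L_def laplacian_mat_def adjacency_mat_def degree_mat_def n_def
      by (intro minus_carrier_mat) auto
    have DL: "degree_mat_inv_sqrt G vs * L = mat n n (\<lambda>(i, j). 1 / sqrt (dg i) * L $$ (i, j))"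
      unfolding degree_mat_inv_sqrt_def n_def[symmetric]
      by (subst mat_diag_mult_left[OF L]) (simp add: dg_def)
    have "A = mat n n (\<lambda>(i, j). (1 / sqrt (dg i) * L $$ (i, j)) * (1 / sqrt (dg j)))"
      unfolding A_def normalized_laplacian_mat_def L_def[symmetric] DL
      unfolding degree_mat_inv_sqrt_def n_def[symmetric]
      by (subst mat_diag_mult_right[of _ n n]) (auto simp: dg_def)
    moreover have "L $$ (i, j) = (if i = j then dg i else 0) - a i j"
      using that by (auto simp: L_def laplacian_mat_def adjacency_mat_def degree_mat_def n_def[symmetric]
          mat_diag_def dg_def a_def)
    ultimately show ?thesis using that by simp
  qed
  have asym: "a i j = a j i" for i j
    using pair_sym_arcs unfolding a_def symmetric_def by (auto dest: symD)
  have "A\<^sup>T = A"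
    by (rule eq_matI) (use A in \<open>auto simp: entry asym mult_ac\<close>)
  from real_symmetric_diagonalization[OF A this] obtain P d where
    P: "P \<in> carrier_mat n n" "P\<^sup>T * P = 1\<^sub>m n" "P\<^sup>T * A * P = mat_diag n d" by blast
  have PPT: "P * P\<^sup>T = 1\<^sub>m n"
    using mat_mult_left_right_inverse[of "P\<^sup>T" n P] P by auto
  define D where "D = mat_diag n d"
  have D: "D \<in> carrier_mat n n" by (simp add: D_def)
  have "similar_mat D A"
    unfolding similar_mat_def
    by (intro exI[of _ "P\<^sup>T"] exI[of _ P] similar_mat_witI[of _ _ n]) (use P PPT A D D_def in auto)
  then have "char_poly A = char_poly D"
    using char_poly_similar by metis
  also have "\<dots> = (\<Prod>x\<leftarrow>diag_mat D. [:- x, 1:])"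
    by (rule char_poly_upper_triangular[OF D]) (auto simp: D_def mat_diag_def)
  also have "diag_mat D = map d [0..<n]"
    by (auto simp: diag_mat_def D_def mat_diag_def)
  finally have cp: "char_poly A = (\<Prod>p\<leftarrow>map (\<lambda>i. [:- d i, 1:]) [0..<n]. p)"
    by (simp add: comp_def)
  have "proots (char_poly A) = mset (map d [0..<n])"
    unfolding cp by (subst proots_prod_list) (auto simp: comp_def)
  then have eig: "nl_eigenvalues G = sort (map d [0..<n])"
    unfolding nl_eigenvalues_def vs_def[symmetric] A_def[symmetric]
    by (simp only: sorted_list_of_multiset_mset)
  define z where "z f = vec n (\<lambda>i. sqrt (dg i) * f (vs ! i))" for f
  define y where "y f = P\<^sup>T *\<^sub>v z f" for f
  define Y where "Y f i = (if i < n then y f $ i else 0)" for f i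
  have z: "z f \<in> carrier_vec n" for f by (simp add: z_def)
  have y: "y f \<in> carrier_vec n" for f unfolding y_def by (rule mult_mat_vec_carrier[of _ n n]) (use P z in auto)
  have zy: "z f = P *\<^sub>v y f" for f
  proof -
    have "P *\<^sub>v y f = (P * P\<^sup>T) *\<^sub>v z f" unfolding y_def using P z by simp
    then show ?thesis using PPT z by simp
  qed
  have lin: "Y (\<lambda>v. \<alpha> * f v + \<beta> * g v) i = \<alpha> * Y f i + \<beta> * Y g i" for \<alpha> \<beta> f g i
  proof -
    have "z (\<lambda>v. \<alpha> * f v + \<beta> * g v) = \<alpha> \<cdot>\<^sub>v z f + \<beta> \<cdot>\<^sub>v z g"
      by (rule eq_vecI) (auto simp: z_def algebra_simps)
    then have "y (\<lambda>v. \<alpha> * f v + \<beta> * g v) = \<alpha> \<cdot>\<^sub>v y f + \<beta> \<cdot>\<^sub>v y g"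
      unfolding y_def using P z by (simp add: mult_add_distrib_mat_vec[of _ n n] mult_mat_vec[of _ n n])
    then show ?thesis using carrier_vecD[OF y] by (simp add: Y_def)
  qed
  have quad: "qform \<mu> G f = (\<Sum>i<n. (d i - (1 - \<mu>)) * (Y f i)\<^sup>2)" for \<mu> f
  proof -
    let ?f = "\<lambda>i. f (vs ! i)"
    have PT: "P\<^sup>T \<in> carrier_mat n n" using P by simp
    have zz: "y f \<bullet> y f = z f \<bullet> z f"
      using transpose_vec_mult_scalar[OF P(1) y z, of f f] by (simp add: zy[symmetric] y_def[symmetric])
    have Az: "A *\<^sub>v z f \<in> carrier_vec n" using A z by (auto intro!: mult_mat_vec_carrier)
    have Dy: "D *\<^sub>v y f = P\<^sup>T *\<^sub>v (A *\<^sub>v z f)"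
    proof -
      have "D = P\<^sup>T * (A * P)"
        unfolding D_def P(3)[symmetric] using P(1) A PT by (simp add: assoc_mult_mat[of _ n n _ n _ n])
      then have "D *\<^sub>v y f = P\<^sup>T *\<^sub>v (A *\<^sub>v (P *\<^sub>v y f))"
        using P(1) A y PT by (simp add: assoc_mult_mat_vec[of _ n n _ n])
      then show ?thesis by (simp add: zy[symmetric])
    qed
    have "(A *\<^sub>v z f) \<bullet> z f = (D *\<^sub>v y f) \<bullet> y f"
      using transpose_vec_mult_scalar[OF P(1) y Az, of f] by (simp add: zy[symmetric] Dy)
    then have "(\<Sum>i<n. (\<Sum>j<n. A $$ (i, j) * z f $ j) * z f $ i) = (\<Sum>i<n. d i * (Y f i)\<^sup>2)"
      using A D z y carrier_vecD[OF y] carrier_vecD[OF z]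
      by (simp add: scalar_prod_def atLeast0LessThan Y_def D_def mat_diag_def power2_eq_square if_distrib
          if_distribR mult_ac cong: if_cong)
    moreover have "(\<Sum>i<n. (\<Sum>j<n. A $$ (i, j) * z f $ j) * z f $ i)
        = (\<Sum>i<n. dg i * (?f i)\<^sup>2 - (\<Sum>j<n. a i j * (?f i * ?f j)))"
    proof (rule sum.cong[OF refl])
      fix i assume "i \<in> {..<n}"
      then have i: "i < n" by simp
      have "(\<Sum>j<n. A $$ (i, j) * z f $ j) * z f $ i = (\<Sum>j<n. A $$ (i, j) * z f $ j * z f $ i)"
        by (simp add: sum_distrib_right)
      also have "\<dots> = (\<Sum>j<n. (if i = j then dg i * (?f i)\<^sup>2 else 0) - a i j * (?f i * ?f j))"
      proof (rule sum.cong[OF refl])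
        fix j assume "j \<in> {..<n}"
        then have j: "j < n" by simp
        have "A $$ (i, j) * z f $ j * z f $ i = ((if i = j then dg i else 0) - a i j) * (?f i * ?f j)"
          using i j dgpos[OF i] dgpos[OF j] by (simp add: entry z_def)
        then show "A $$ (i, j) * z f $ j * z f $ i
            = (if i = j then dg i * (?f i)\<^sup>2 else 0) - a i j * (?f i * ?f j)"
          by (simp add: algebra_simps power2_eq_square)
      qed
      also have "\<dots> = dg i * (?f i)\<^sup>2 - (\<Sum>j<n. a i j * (?f i * ?f j))"
        using i by (simp add: sum_subtractf)
      finally show "(\<Sum>j<n. A $$ (i, j) * z f $ j) * z f $ i
          = dg i * (?f i)\<^sup>2 - (\<Sum>j<n. a i j * (?f i * ?f j))" .
    qed
    moreover have "(\<Sum>i<n. (Y f i)\<^sup>2) = (\<Sum>i<n. dg i * (?f i)\<^sup>2)"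
    proof -
      have "y f \<bullet> y f = (\<Sum>i<n. (Y f i)\<^sup>2)"
        using carrier_vecD[OF y] by (simp add: scalar_prod_def atLeast0LessThan Y_def power2_eq_square)
      moreover have "z f \<bullet> z f = (\<Sum>i<n. dg i * (?f i)\<^sup>2)"
      proof -
        have "sqrt (dg i) * (?f i * (sqrt (dg i) * ?f i)) = dg i * (?f i)\<^sup>2" if "i < n" for i
          using dgpos[OF that] by (simp add: power2_eq_square)
        then show ?thesis
          by (simp add: scalar_prod_def atLeast0LessThan z_def mult_ac)
      qed
      ultimately show ?thesis using zz by simp
    qed
    moreover have "qform \<mu> G f = (\<Sum>i<n. \<mu> * (dg i * (?f i)\<^sup>2) - (\<Sum>j<n. a i j * (?f i * ?f j)))"
      unfolding qform_def sum_arcs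
      by (auto simp: dg algebra_simps sum_subtractf sum_distrib_left sum_distrib_right intro!: sum.cong)
    ultimately show ?thesis
      by (simp add: algebra_simps sum_subtractf sum.distrib flip: sum_distrib_left)
  qed
  have surj: "\<exists>f. \<forall>i<n. Y f i = y0 i" for y0
  proof -
    define w where "w = P *\<^sub>v vec n y0"
    define f where "f v = w $ the_inv_into {..<n} (\<lambda>i. vs ! i) v / sqrt (dg (the_inv_into {..<n} (\<lambda>i. vs ! i) v))" for v
    have inv: "the_inv_into {..<n} (\<lambda>i. vs ! i) (vs ! i) = i" if "i < n" for i
      using bij that by (intro the_inv_into_f_f) (auto simp: bij_betw_def)
    have w: "w \<in> carrier_vec n" unfolding w_def using P by (auto intro!: mult_mat_vec_carrier)
    have "z f = w"
    proof (rule eq_vecI)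
      fix i assume "i < dim_vec w"
      then have "i < n" using w by simp
      then show "z f $ i = w $ i" using dgpos[of i] by (simp add: z_def f_def inv)
    qed (use w in \<open>auto simp: z_def\<close>)
    then have "y f = (P\<^sup>T * P) *\<^sub>v vec n y0" unfolding y_def w_def
      by (subst assoc_mult_mat_vec[of _ n n _ n]) (use P in auto)
    then have "y f = vec n y0" using P by simp
    then show ?thesis by (intro exI[of _ f]) (auto simp: Y_def)
  qed
  have zero: "\<forall>v\<in>pverts G. f v = 0" if "\<forall>i<n. Y f i = 0" for f
  proof -
    have "y f = 0\<^sub>v n" using that carrier_vecD[OF y] by (intro eq_vecI) (auto simp: Y_def)
    then have "z f = 0\<^sub>v n" using zy[of f] P by (simp add: mult_mat_vec_def) (auto intro!: eq_vecI)
    then have "f (vs ! i) = 0" if "i < n" for i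
      using dgpos[OF that] that by (auto simp: z_def dest!: arg_cong[of _ _ "\<lambda>v. v $ i"])
    then show ?thesis using bij unfolding bij_betw_def by force
  qed
  show thesis
    by (rule that[of d Y, unfolded n]) (use eig lin quad surj zero in auto)
qed

text \<open>
  Sorting does not change how many entries satisfy \<open>P\<close>; the index 1 is the second entry, counted from 0.
\<close>

lemma two_indices_below:
  fixes P :: "real \<Rightarrow> bool"
  assumes n: "n \<ge> 2" and down: "\<And>x y. x \<le> y \<Longrightarrow> P y \<Longrightarrow> P x"
  shows "P (sort (map d [0..<n]) ! 1) \<longleftrightarrow> (\<exists>i<n. \<exists>j<n. i \<noteq> j \<and> P (d i) \<and> P (d j))"
proof -
  define xs where "xs = sort (map d [0..<n])"
  have len: "length xs = n" by (simp add: xs_def)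
  have "card {i. i < n \<and> P (xs ! i)} = length (filter P xs)"
    by (simp add: length_filter_conv_card len)
  also have "\<dots> = length (filter P (map d [0..<n]))"
    by (metis mset_filter mset_sort size_mset xs_def)
  also have "\<dots> = card {i. i < n \<and> P (d i)}"
    unfolding length_filter_conv_card by (rule arg_cong[of _ _ card]) auto
  finally have card: "card {i. i < n \<and> P (xs ! i)} = card {i. i < n \<and> P (d i)}" .
  have two: "2 \<le> card {i. i < n \<and> P (g i)} \<longleftrightarrow> (\<exists>i<n. \<exists>j<n. i \<noteq> j \<and> P (g i) \<and> P (g j))" for g
  proof
    assume "2 \<le> card {i. i < n \<and> P (g i)}"
    then obtain T where "T \<subseteq> {i. i < n \<and> P (g i)}" "card T = 2"
      by (meson obtain_subset_with_card_n)
    then show "\<exists>i<n. \<exists>j<n. i \<noteq> j \<and> P (g i) \<and> P (g j)"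
      by (auto simp: card_2_iff)
  next
    assume "\<exists>i<n. \<exists>j<n. i \<noteq> j \<and> P (g i) \<and> P (g j)"
    then obtain i j where "i < n" "j < n" "i \<noteq> j" "P (g i)" "P (g j)" by blast
    then have "card {i, j} \<le> card {i. i < n \<and> P (g i)}" by (intro card_mono) auto
    then show "2 \<le> card {i. i < n \<and> P (g i)}" using \<open>i \<noteq> j\<close> by simp
  qed
  have mono: "xs ! i \<le> xs ! j" if "i \<le> j" "j < n" for i j
    using that len by (simp add: sorted_nth_mono xs_def)
  have "P (xs ! 1) \<longleftrightarrow> (\<exists>i<n. \<exists>j<n. i \<noteq> j \<and> P (xs ! i) \<and> P (xs ! j))"
  proof
    assume "P (xs ! 1)"
    then show "\<exists>i<n. \<exists>j<n. i \<noteq> j \<and> P (xs ! i) \<and> P (xs ! j)"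
    proof -
      have "P (xs ! 0)" using \<open>P (xs ! 1)\<close> n down[OF mono[of 0 1]] by simp
      then have "0 < n \<and> 1 < n \<and> 0 \<noteq> (1 :: nat) \<and> P (xs ! 0) \<and> P (xs ! 1)"
        using \<open>P (xs ! 1)\<close> n by simp
      then show ?thesis by blast
    qed
  next
    assume "\<exists>i<n. \<exists>j<n. i \<noteq> j \<and> P (xs ! i) \<and> P (xs ! j)"
    then obtain k where "k < n" "k \<ge> 1" "P (xs ! k)" by (metis less_one not_le)
    then show "P (xs ! 1)" using down mono by blast
  qed
  then show ?thesis using card two[of d] two[of "(!) xs"] by (simp add: xs_def)
qed

text \<open>
  The Courant-Fischer principle for the second eigenvalue. Two eigenvectors with small eigenvalues span the
  plane. Conversely, if at most one eigenvalue is small, some nonzero combination of two given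
  functions has vanishing coordinate there, and the remaining eigenvalues bound the form on it from below.
\<close>

lemma
  fixes G :: "'a pair_pre_digraph"
  assumes G: "pair_graph G" and deg: "\<And>v. v \<in> pverts G \<Longrightarrow> \<exists>u. (v, u) \<in> parcs G"
    and card: "card (pverts G) \<ge> 2"
  shows second_eigenvalue_less_iff: "nl_eigenvalue 2 G < 1 - \<mu> \<longleftrightarrow> negative_plane \<mu> G"
    and second_eigenvalue_le_iff: "nl_eigenvalue 2 G \<le> 1 - \<mu> \<longleftrightarrow> nonpositive_plane \<mu> G"
proof -
  define n where "n = card (pverts G)"
  obtain d Y where eig: "nl_eigenvalues G = sort (map d [0..<n])"
    and lin: "\<And>\<alpha> \<beta> f g i. Y (\<lambda>v. \<alpha> * f v + \<beta> * g v) i = \<alpha> * Y f i + \<beta> * Y g i"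
    and quad: "\<And>\<mu> f. qform \<mu> G f = (\<Sum>i<n. (d i - (1 - \<mu>)) * (Y f i)\<^sup>2)"
    and surj: "\<And>y. \<exists>f. \<forall>i<n. Y f i = y i"
    and zero: "\<And>f. (\<forall>i<n. Y f i = 0) \<Longrightarrow> \<forall>v\<in>pverts G. f v = 0"
    by (rule nl_diagonalization[OF G deg, folded n_def]) blast+
  have n: "n \<ge> 2" using card by (simp add: n_def)
  have ev: "nl_eigenvalue 2 G = sort (map d [0..<n]) ! 1"
    by (simp add: nl_eigenvalue_def eig)
  have wf: "u \<in> pverts G" "v \<in> pverts G" if "(u, v) \<in> parcs G" for u v
  proof -
    interpret pair_graph G by fact
    show "u \<in> pverts G" "v \<in> pverts G" using wellformed'[OF that] by auto
  qed
  have coords: "\<exists>f g. (\<forall>k<n. Y f k = (if k = i then 1 else 0)) \<and> (\<forall>k<n. Y g k = (if k = j then 1 else 0))" for i j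
    using surj[of "\<lambda>k. if k = i then 1 else 0"] surj[of "\<lambda>k. if k = j then 1 else 0"] by blast
  have plane: "qform \<mu> G (\<lambda>v. \<alpha> * f v + \<beta> * g v) = (d i - (1 - \<mu>)) * \<alpha>\<^sup>2 + (d j - (1 - \<mu>)) * \<beta>\<^sup>2"
    if "i < n" "j < n" "i \<noteq> j" "\<forall>k<n. Y f k = (if k = i then 1 else 0)"
      "\<forall>k<n. Y g k = (if k = j then 1 else 0)" for i j f g \<alpha> \<beta>
  proof -
    have "qform \<mu> G (\<lambda>v. \<alpha> * f v + \<beta> * g v)
        = (\<Sum>k<n. (if k = i then (d i - (1 - \<mu>)) * \<alpha>\<^sup>2 else 0) + (if k = j then (d j - (1 - \<mu>)) * \<beta>\<^sup>2 else 0))"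
      unfolding quad lin using that by (intro sum.cong) auto
    then show ?thesis using that by (simp add: sum.distrib)
  qed
  have kill: "\<exists>\<alpha> \<beta>. (\<alpha>, \<beta>) \<noteq> (0, 0) \<and> \<alpha> * a + \<beta> * b = 0" for a b :: real
  proof (cases "a = 0")
    case True
    then have "(1 :: real, 0 :: real) \<noteq> (0, 0) \<and> 1 * a + 0 * b = 0" by simp
    then show ?thesis by blast
  next
    case False
    then have "(- b, a) \<noteq> (0, 0) \<and> (- b) * a + a * b = 0" by simp
    then show ?thesis by blast
  qed
  have less: "nl_eigenvalue 2 G < 1 - \<mu> \<longleftrightarrow> (\<exists>i<n. \<exists>j<n. i \<noteq> j \<and> d i < 1 - \<mu> \<and> d j < 1 - \<mu>)"
    unfolding ev by (rule two_indices_below[OF n]) simp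
  have le: "nl_eigenvalue 2 G \<le> 1 - \<mu> \<longleftrightarrow> (\<exists>i<n. \<exists>j<n. i \<noteq> j \<and> d i \<le> 1 - \<mu> \<and> d j \<le> 1 - \<mu>)"
    unfolding ev by (rule two_indices_below[OF n]) simp
  show "nl_eigenvalue 2 G < 1 - \<mu> \<longleftrightarrow> negative_plane \<mu> G"
  proof
    assume "nl_eigenvalue 2 G < 1 - \<mu>"
    then obtain i j where ij: "i < n" "j < n" "i \<noteq> j" "d i < 1 - \<mu>" "d j < 1 - \<mu>"
      using less by blast
    obtain f g where fg: "\<forall>k<n. Y f k = (if k = i then 1 else 0)" "\<forall>k<n. Y g k = (if k = j then 1 else 0)"
      using coords by blast
    show "negative_plane \<mu> G"
      unfolding negative_plane_def
    proof (rule exI[of _ f], rule exI[of _ g], intro allI impI)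
      fix \<alpha> \<beta> :: real assume "(\<alpha>, \<beta>) \<noteq> (0, 0)"
      then have "(d i - (1 - \<mu>)) * \<alpha>\<^sup>2 < 0 \<or> (d j - (1 - \<mu>)) * \<beta>\<^sup>2 < 0"
        using ij(4,5) by (auto simp: mult_less_0_iff)
      moreover have "(d i - (1 - \<mu>)) * \<alpha>\<^sup>2 \<le> 0" "(d j - (1 - \<mu>)) * \<beta>\<^sup>2 \<le> 0"
        using ij(4,5) by (auto simp: mult_le_0_iff)
      ultimately show "qform \<mu> G (\<lambda>v. \<alpha> * f v + \<beta> * g v) < 0"
        unfolding plane[OF ij(1-3) fg] by linarith
    qed
  next
    assume "negative_plane \<mu> G"
    then obtain f g where neg: "\<And>\<alpha> \<beta>. (\<alpha>, \<beta>) \<noteq> (0, 0) \<Longrightarrow> qform \<mu> G (\<lambda>v. \<alpha> * f v + \<beta> * g v) < 0"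
      unfolding negative_plane_def by blast
    show "nl_eigenvalue 2 G < 1 - \<mu>"
    proof (rule ccontr)
      assume "\<not> ?thesis"
      then have *: "\<not> (\<exists>i<n. \<exists>j<n. i \<noteq> j \<and> d i < 1 - \<mu> \<and> d j < 1 - \<mu>)"
        using less by blast
      have "\<exists>j. \<forall>i<n. i \<noteq> j \<longrightarrow> d i \<ge> 1 - \<mu>"
      proof (cases "\<exists>j<n. d j < 1 - \<mu>")
        case True
        then obtain j where "j < n" "d j < 1 - \<mu>" by blast
        then have "\<forall>i<n. i \<noteq> j \<longrightarrow> d i \<ge> 1 - \<mu>" using * not_le by blast
        then show ?thesis by blast
      next
        case False
        then have "\<forall>i<n. i \<noteq> 0 \<longrightarrow> d i \<ge> 1 - \<mu>" using not_le by blast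
        then show ?thesis by blast
      qed
      then obtain j where j: "\<And>i. i < n \<Longrightarrow> i \<noteq> j \<Longrightarrow> d i \<ge> 1 - \<mu>" by blast
      obtain \<alpha> \<beta> where ab: "(\<alpha>, \<beta>) \<noteq> (0, 0)" "\<alpha> * Y f j + \<beta> * Y g j = 0" using kill by blast
      have "qform \<mu> G (\<lambda>v. \<alpha> * f v + \<beta> * g v) \<ge> 0"
        unfolding quad lin
      proof (rule sum_nonneg)
        fix i assume "i \<in> {..<n}"
        then show "(d i - (1 - \<mu>)) * (\<alpha> * Y f i + \<beta> * Y g i)\<^sup>2 \<ge> 0"
          using j[of i] ab(2) by (cases "i = j") auto
      qed
      then show False using neg[OF ab(1)] by simp
    qed
  qed
  show "nl_eigenvalue 2 G \<le> 1 - \<mu> \<longleftrightarrow> nonpositive_plane \<mu> G"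
  proof
    assume "nl_eigenvalue 2 G \<le> 1 - \<mu>"
    then obtain i j where ij: "i < n" "j < n" "i \<noteq> j" "d i \<le> 1 - \<mu>" "d j \<le> 1 - \<mu>"
      using le by blast
    obtain f g where fg: "\<forall>k<n. Y f k = (if k = i then 1 else 0)" "\<forall>k<n. Y g k = (if k = j then 1 else 0)"
      using coords by blast
    show "nonpositive_plane \<mu> G"
      unfolding nonpositive_plane_def
    proof (rule exI[of _ f], rule exI[of _ g], intro conjI allI impI)
      fix \<alpha> \<beta> :: real
      show "qform \<mu> G (\<lambda>v. \<alpha> * f v + \<beta> * g v) \<le> 0"
        unfolding plane[OF ij(1-3) fg] using ij(4,5)
        by (intro add_nonpos_nonpos mult_nonpos_nonneg) auto
      assume ab: "(\<alpha>, \<beta>) \<noteq> (0, 0)"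
      show "\<exists>v\<in>pverts G. \<alpha> * f v + \<beta> * g v \<noteq> 0"
      proof (rule ccontr)
        assume "\<not> ?thesis"
        then have "qform x G (\<lambda>v. \<alpha> * f v + \<beta> * g v) = 0" for x
          unfolding qform_def by (intro sum.neutral) (auto dest: wf)
        \<comment> \<open>The difference of the forms at \<open>\<mu> = 1\<close> and \<open>\<mu> = 0\<close> is the squared norm of the coordinates.\<close>
        from this[of 0] this[of 1] have "(\<Sum>i<n. (\<alpha> * Y f i + \<beta> * Y g i)\<^sup>2) = 0"
          unfolding quad lin by (simp add: sum_subtractf algebra_simps)
        then have "\<forall>i<n. \<alpha> * Y f i + \<beta> * Y g i = 0"
          by (simp add: sum_nonneg_eq_0_iff)
        then have "\<alpha> * Y f i + \<beta> * Y g i = 0" "\<alpha> * Y f j + \<beta> * Y g j = 0" using ij by auto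
        then show False using fg ij ab by simp
      qed
    qed
  next
    assume "nonpositive_plane \<mu> G"
    then obtain f g where neg: "\<And>\<alpha> \<beta>. qform \<mu> G (\<lambda>v. \<alpha> * f v + \<beta> * g v) \<le> 0"
      and ind: "\<And>\<alpha> \<beta>. (\<alpha>, \<beta>) \<noteq> (0, 0) \<Longrightarrow> \<exists>v\<in>pverts G. \<alpha> * f v + \<beta> * g v \<noteq> 0"
      unfolding nonpositive_plane_def by blast
    show "nl_eigenvalue 2 G \<le> 1 - \<mu>"
    proof (rule ccontr)
      assume "\<not> ?thesis"
      then have *: "\<not> (\<exists>i<n. \<exists>j<n. i \<noteq> j \<and> d i \<le> 1 - \<mu> \<and> d j \<le> 1 - \<mu>)"
        using le by blast
      have "\<exists>j. \<forall>i<n. i \<noteq> j \<longrightarrow> d i > 1 - \<mu>"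
      proof (cases "\<exists>j<n. d j \<le> 1 - \<mu>")
        case True
        then obtain j where "j < n" "d j \<le> 1 - \<mu>" by blast
        then have "\<forall>i<n. i \<noteq> j \<longrightarrow> d i > 1 - \<mu>" using * not_le by blast
        then show ?thesis by blast
      next
        case False
        then have "\<forall>i<n. i \<noteq> 0 \<longrightarrow> d i > 1 - \<mu>" using not_le by blast
        then show ?thesis by blast
      qed
      then obtain j where j: "\<And>i. i < n \<Longrightarrow> i \<noteq> j \<Longrightarrow> d i > 1 - \<mu>" by blast
      obtain \<alpha> \<beta> where ab: "(\<alpha>, \<beta>) \<noteq> (0, 0)" "\<alpha> * Y f j + \<beta> * Y g j = 0" using kill by blast
      have nonneg: "(d i - (1 - \<mu>)) * (\<alpha> * Y f i + \<beta> * Y g i)\<^sup>2 \<ge> 0" if "i < n" for i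
      proof (cases "i = j")
        case False
        then show ?thesis using j[OF that] by (intro mult_nonneg_nonneg) auto
      qed (simp add: ab(2))
      have "(\<Sum>i<n. (d i - (1 - \<mu>)) * (\<alpha> * Y f i + \<beta> * Y g i)\<^sup>2) \<le> 0"
        using neg[of \<alpha> \<beta>] unfolding quad lin .
      moreover have "(\<Sum>i<n. (d i - (1 - \<mu>)) * (\<alpha> * Y f i + \<beta> * Y g i)\<^sup>2) > 0"
        if "k < n" "\<alpha> * Y f k + \<beta> * Y g k \<noteq> 0" for k
      proof (rule sum_pos2[of _ k])
        have "k \<noteq> j" using that ab(2) by auto
        then show "(d k - (1 - \<mu>)) * (\<alpha> * Y f k + \<beta> * Y g k)\<^sup>2 > 0"
          using j[of k] that by (intro mult_pos_pos) auto
      qed (use that nonneg in auto)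
      ultimately have "\<alpha> * Y f k + \<beta> * Y g k = 0" if "k < n" for k
        using that not_le by blast
      then have "\<forall>i<n. Y (\<lambda>v. \<alpha> * f v + \<beta> * g v) i = 0"
        by (simp only: lin) simp
      from zero[OF this] ind[OF ab(1)] show False by blast
    qed
  qed
qed

section \<open>Unicyclic graphs of girth 3 as rooted triangles\<close>

text \<open>
  A path from \<open>u\<close> to \<open>u'\<close> that avoids \<open>w\<close> closes up through \<open>w\<close>. The walk is shortened to a path
  first; it has at least one arc because \<open>u \<noteq> u'\<close>, so the cycle has length at least 3.
\<close>

lemma cycle_through_two_neighbours:
  fixes G :: "'a pair_pre_digraph"
  assumes G: "pair_graph G"
    and path: "(u, u') \<in> {(x, y) \<in> parcs G. x \<noteq> w \<and> y \<noteq> w}\<^sup>*"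
    and arcs: "(w, u) \<in> parcs G" "(u', w) \<in> parcs G" and neq: "u \<noteq> u'"
  shows "\<exists>C\<in>undirected_cycles G. {w, u} \<in> C"
proof -
  interpret pair_graph G by fact
  let ?R = "{(x, y) \<in> parcs G. x \<noteq> w \<and> y \<noteq> w}"
  have "\<exists>p. awalk u p u' \<and> set p \<subseteq> ?R" using path
  proof (induction rule: converse_rtrancl_induct)
    case base
    then show ?case using arcs by (intro exI[of _ "[]"]) (auto simp: awalk_Nil_iff dest: wellformed')
  next
    case (step y z)
    then obtain p where "awalk z p u'" "set p \<subseteq> ?R" by blast
    then show ?case using step(1) by (intro exI[of _ "(y, z) # p"]) (auto simp: awalk_Cons_iff)
  qed
  then obtain p where p: "awalk u p u'" "set p \<subseteq> ?R" by blast
  define q where "q = awalk_to_apath p"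
  have q: "apath u q u'" "set q \<subseteq> ?R"
    using apath_awalk_to_apath[OF p(1)] awalk_to_apath_subset[OF p(1)] p(2) by (auto simp: q_def)
  then have aw: "awalk u q u'" "distinct (pawalk_verts u q)" by (auto simp: apath_def)
  have "q \<noteq> []" using aw(1) neq by (auto simp: awalk_Nil_iff)
  have "w \<noteq> u" using arcs pair_no_loops by fastforce
  have w: "w \<notin> set (pawalk_verts u q)"
    using q(2) \<open>w \<noteq> u\<close> set_awalk_verts[OF aw(1)] by auto
  define c where "c = (w, u) # q @ [(u', w)]"
  have "awalk w c w"
    unfolding c_def using arcs aw(1) by (auto simp: awalk_Cons_iff awalk_Nil_iff dest: wellformed')
  moreover have "tl (pawalk_verts w c) = pawalk_verts u q @ [w]"
  proof -
    have "pawalk_verts x (q @ [(u', w)]) = pawalk_verts x q @ [w]" if "pcas x q u'" for x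
      using that by (induction q arbitrary: x) auto
    moreover have "pcas u q u'" using aw(1) by (auto simp: awalk_def)
    ultimately show ?thesis by (simp add: c_def)
  qed
  ultimately have "pre_digraph.cycle (with_proj G) c"
    unfolding cycle_def using aw(2) w by (auto simp: c_def)
  moreover have "3 \<le> length c" using \<open>q \<noteq> []\<close> by (cases q) (auto simp: c_def)
  ultimately have "(\<lambda>(u, v). {u, v}) ` set c \<in> undirected_cycles G"
    unfolding undirected_cycles_def by blast
  moreover have "{w, u} \<in> (\<lambda>(u, v). {u, v}) ` set c" by (auto simp: c_def)
  ultimately show ?thesis by (intro bexI)
qed

text \<open>
  The cardinality counts undirected edges, so a cycle longer than 3 has to be excluded: its first
  four edges are already pairwise different.
\<close>

lemma three_edge_cycle:
  fixes G :: "'a pair_pre_digraph"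
  assumes G: "pair_graph G" and C: "C \<in> undirected_cycles G" and card: "card C = 3"
  shows "\<exists>a b c. a \<noteq> b \<and> b \<noteq> c \<and> a \<noteq> c \<and> {(a, b), (b, c), (c, a)} \<subseteq> parcs G \<and>
    C = {{a, b}, {b, c}, {c, a}}"
proof -
  interpret pair_graph G by fact
  obtain p where p: "C = (\<lambda>(u, v). {u, v}) ` set p" "pre_digraph.cycle (with_proj G) p" "3 \<le> length p"
    using C unfolding undirected_cycles_def by auto
  then obtain u where u: "awalk u p u" "distinct (tl (pawalk_verts u p))"
    unfolding cycle_def by blast
  obtain e1 p1 where p1: "p = e1 # p1" using p(3) by (cases p) auto
  moreover obtain e2 p2 where p2: "p1 = e2 # p2" using p(3) p1 by (cases p1) auto
  moreover obtain e3 r where "p2 = e3 # r" using p(3) p1 p2 by (cases p2) auto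
  ultimately have r: "p = e1 # e2 # e3 # r" by simp
  obtain v1 v2 v3 where v: "e1 = (u, v1)" "e2 = (v1, v2)" "e3 = (v2, v3)" "awalk v3 r u"
    "e1 \<in> parcs G" "e2 \<in> parcs G" "e3 \<in> parcs G"
    using u(1) unfolding r by (cases e1; cases e2; cases e3) (auto simp: awalk_Cons_iff)
  show ?thesis
  proof (cases r)
    case Nil
    then have "v3 = u" using v(4) by (simp add: awalk_Nil_iff)
    then have "distinct [v1, v2, u]" "C = {{u, v1}, {v1, v2}, {v2, u}}"
      using u(2) p(1) unfolding r Nil v by simp_all
    then have "u \<noteq> v1 \<and> v1 \<noteq> v2 \<and> u \<noteq> v2 \<and> {(u, v1), (v1, v2), (v2, u)} \<subseteq> parcs G \<and>
      C = {{u, v1}, {v1, v2}, {v2, u}}"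
      using v(5-7) unfolding v \<open>v3 = u\<close> by auto
    then show ?thesis by blast
  next
    case (Cons e4 s)
    obtain v4 where e4: "e4 = (v3, v4)" "awalk v4 s u" using v(4) Cons by (cases e4) (auto simp: awalk_Cons_iff)
    have "u = last (pawalk_verts v4 s)" using e4(2) by auto
    moreover have "pawalk_verts v4 s \<noteq> []" by (cases s) auto
    ultimately have last: "u \<in> set (pawalk_verts v4 s)" by simp
    have d: "distinct (v1 # v2 # v3 # pawalk_verts v4 s)"
      using u(2) unfolding r Cons v e4 by simp
    have v4: "v4 \<in> set (pawalk_verts v4 s)" using set_awalk_verts[OF e4(2)] by simp
    have "finite C" unfolding p(1) by simp
    moreover have "{{u, v1}, {v1, v2}, {v2, v3}, {v3, v4}} \<subseteq> C"
      unfolding p(1) r Cons v e4 by simp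
    ultimately have "card {{u, v1}, {v1, v2}, {v2, v3}, {v3, v4}} \<le> 3"
      unfolding card[symmetric] by (rule card_mono)
    moreover have "u \<noteq> v1" "u \<noteq> v2" "u \<noteq> v3" "v1 \<noteq> v2" "v1 \<noteq> v3" "v2 \<noteq> v3" "v1 \<noteq> v4" "v2 \<noteq> v4" "v3 \<noteq> v4"
      using d last v4 by auto
    ultimately show ?thesis by (simp add: doubleton_eq_iff)
  qed
qed

text \<open>
  A triangle with trees attached, given by the parent function of the trees. The level \<open>lev\<close> is the distance
  to the triangle; it keeps the parent function free of cycles and serves as induction measure.
\<close>

locale rooted_triangle =
  fixes G :: "'a pair_pre_digraph" and a b c :: 'a and par :: "'a \<Rightarrow> 'a" and lev :: "'a \<Rightarrow> nat"
  assumes fin: "finite (pverts G)"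
    and dist: "a \<noteq> b" "b \<noteq> c" "a \<noteq> c"
    and tri: "{a, b, c} \<subseteq> pverts G"
    and lev0: "\<And>x. x \<in> pverts G \<Longrightarrow> lev x = 0 \<longleftrightarrow> x \<in> {a, b, c}"
    and par: "\<And>x. x \<in> pverts G - {a, b, c} \<Longrightarrow> par x \<in> pverts G \<and> lev x = Suc (lev (par x))"
    and arcs: "\<And>x y. (x, y) \<in> parcs G \<longleftrightarrow> x \<in> {a, b, c} \<and> y \<in> {a, b, c} \<and> x \<noteq> y \<or>
          x \<in> pverts G - {a, b, c} \<and> y = par x \<or> y \<in> pverts G - {a, b, c} \<and> x = par y"

text \<open>
  The level is the distance to the triangle. If a vertex \<open>w\<close> off the triangle had two neighbours that
  are not farther away than \<open>w\<close>, both could walk down to the triangle without meeting \<open>w\<close>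
  (\<open>climb\<close> below), which gives a second cycle through \<open>w\<close>. So each \<open>w\<close> has exactly one such neighbour,
  its parent, and no further edges exist.
\<close>

theorem unicyclic_girth_3_rooted:
  fixes U :: "'a pair_pre_digraph"
  assumes uni: "unicyclic U" and girth: "unicyclic_girth U = 3"
  obtains a b c par lev where "rooted_triangle U a b c par lev"
proof -
  have G: "pair_graph U" and conn: "connected (with_proj U)" and ex1: "\<exists>!C. C \<in> undirected_cycles U"
    using uni by (auto simp: unicyclic_def)
  interpret pair_graph U by (rule G)
  obtain C where C: "C \<in> undirected_cycles U" "\<And>C'. C' \<in> undirected_cycles U \<Longrightarrow> C' = C"
    using ex1 by blast
  have "(THE C. C \<in> undirected_cycles U) = C" by (rule the_equality) (rule C)+
  then have "card C = 3" using girth by (simp add: unicyclic_girth_def)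
  from three_edge_cycle[OF G C(1) this] obtain a b c where
    "a \<noteq> b \<and> b \<noteq> c \<and> a \<noteq> c \<and> {(a, b), (b, c), (c, a)} \<subseteq> parcs U \<and>
      C = {{a, b}, {b, c}, {c, a}}" by blast
  then have abc: "a \<noteq> b" "b \<noteq> c" "a \<noteq> c" "(a, b) \<in> parcs U" "(b, c) \<in> parcs U" "(c, a) \<in> parcs U"
    and Ceq: "C = {{a, b}, {b, c}, {c, a}}" by simp_all
  have sym: "(y, x) \<in> parcs U" if "(x, y) \<in> parcs U" for x y
    using pair_sym_arcs that by (auto simp: symmetric_def dest: symD)
  have ne: "x \<noteq> y" if "(x, y) \<in> parcs U" for x y
    using pair_no_loops[OF that] by simp
  let ?T = "{a, b, c}"
  have T: "?T \<subseteq> pverts U" using abc by (auto dest: wellformed')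
  have reach: "(a, x) \<in> (parcs U)\<^sup>*" if "x \<in> pverts U" for x
  proof -
    have "a \<rightarrow>\<^sup>*\<^bsub>mk_symmetric U\<^esub> x"
      using conn that T by (auto simp: connected_def strongly_connected_def)
    then have "a \<rightarrow>\<^sup>*\<^bsub>with_proj U\<^esub> x"
      using reachable_mk_symmetric_eq[OF pair_sym_arcs] by simp
    then show ?thesis using reachable_rtranclI[of U a x] by simp
  qed
  define D where "D k x \<longleftrightarrow> (\<exists>t\<in>?T. (t, x) \<in> (parcs U) ^^ k)" for k x
  define lev where "lev x = (LEAST k. D k x)" for x
  have D: "D (lev x) x" if x: "x \<in> pverts U" for x
  proof -
    obtain k where "(a, x) \<in> (parcs U) ^^ k" using reach[OF x] rtrancl_imp_relpow by metis
    then have "D k x" by (auto simp: D_def)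
    then show ?thesis unfolding lev_def by (rule LeastI)
  qed
  have le: "lev x \<le> k" if "D k x" for k x
    unfolding lev_def using that by (rule Least_le)
  have lev0: "lev x = 0 \<longleftrightarrow> x \<in> ?T" if "x \<in> pverts U" for x
  proof
    assume "lev x = 0"
    then have "D 0 x" using D[OF that] by simp
    then show "x \<in> ?T" by (auto simp: D_def)
  next
    assume "x \<in> ?T"
    then have "D 0 x" by (auto simp: D_def)
    then show "lev x = 0" using le by fastforce
  qed
  have up: "\<exists>y. (y, x) \<in> parcs U \<and> lev x = Suc (lev y)" if x: "x \<in> pverts U" "x \<notin> ?T" for x
  proof -
    obtain k where k: "lev x = Suc k" using lev0[OF x(1)] x(2) not0_implies_Suc by blast
    obtain t where t: "t \<in> ?T" "(t, x) \<in> (parcs U) ^^ Suc k" using D[OF x(1)] k unfolding D_def by auto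
    then obtain y where y: "(t, y) \<in> (parcs U) ^^ k" "(y, x) \<in> parcs U" by auto
    have "D k y" using t y by (auto simp: D_def)
    then have "lev y \<le> k" by (rule le)
    moreover have "D (Suc (lev y)) x"
    proof -
      obtain s where "s \<in> ?T" "(s, y) \<in> (parcs U) ^^ lev y"
        using D[of y] wellformed'(1)[OF y(2)] unfolding D_def by blast
      then show ?thesis using y(2) unfolding D_def by auto
    qed
    then have "Suc k \<le> Suc (lev y)" using le k by metis
    ultimately show ?thesis using y(2) k by auto
  qed
  have climb: "(x, a) \<in> {(x, y) \<in> parcs U. x \<noteq> w \<and> y \<noteq> w}\<^sup>*"
    if "x \<in> pverts U" "w \<notin> ?T" "w \<noteq> x" "lev x \<le> lev w" for x w
    using that
  proof (induction "lev x" arbitrary: x)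
    case 0
    then have "x \<in> ?T" using lev0 by simp
    then have "x = a \<or> (x, a) \<in> {(x, y) \<in> parcs U. x \<noteq> w \<and> y \<noteq> w}"
      using abc sym 0 by auto
    then show ?case by auto
  next
    case (Suc k)
    then have "x \<notin> ?T" using lev0[of x] by simp
    then obtain y where y: "(y, x) \<in> parcs U" "lev x = Suc (lev y)" using up Suc.prems by blast
    have "w \<noteq> y" using y Suc.prems by auto
    moreover have "(y, a) \<in> {(x, y) \<in> parcs U. x \<noteq> w \<and> y \<noteq> w}\<^sup>*"
      by (rule Suc.hyps(1)) (use y Suc \<open>w \<noteq> y\<close> in \<open>auto dest: wellformed'\<close>)
    ultimately show ?case using sym[OF y(1)] Suc.prems
      by (intro converse_rtrancl_into_rtrancl[of x y]) auto
  qed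
  have unique: "u = u'"
    if w: "w \<in> pverts U" "w \<notin> ?T" and u: "(w, u) \<in> parcs U" "lev u \<le> lev w"
      and u': "(w, u') \<in> parcs U" "lev u' \<le> lev w" for w u u'
  proof (rule ccontr)
    assume neq: "u \<noteq> u'"
    let ?R = "{(x, y) \<in> parcs U. x \<noteq> w \<and> y \<noteq> w}"
    have "(u, a) \<in> ?R\<^sup>*" using climb[of u w] u w ne[OF u(1)] by (auto dest: wellformed')
    moreover have "(u', a) \<in> ?R\<^sup>*" using climb[of u' w] u' w ne[OF u'(1)] by (auto dest: wellformed')
    moreover have "sym (?R\<^sup>*)" by (rule sym_rtrancl) (auto intro!: symI sym)
    ultimately have path: "(u, u') \<in> ?R\<^sup>*" by (meson rtrancl_trans symD)
    have "\<exists>C\<in>undirected_cycles U. {w, u} \<in> C"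
      using G path u(1) sym[OF u'(1)] neq by (rule cycle_through_two_neighbours)
    then obtain C' where "C' \<in> undirected_cycles U" "{w, u} \<in> C'" by blast
    then have "{w, u} \<in> C" using C(2) by simp
    then show False using w unfolding Ceq by auto
  qed
  define par where "par x = (SOME y. (y, x) \<in> parcs U \<and> lev x = Suc (lev y))" for x
  have par: "(par x, x) \<in> parcs U \<and> lev x = Suc (lev (par x))" if "x \<in> pverts U" "x \<notin> ?T" for x
    unfolding par_def by (rule someI_ex) (use up that in blast)
  have low: "y = par x" if "(x, y) \<in> parcs U" "x \<notin> ?T" "lev y \<le> lev x" for x y
  proof -
    have x: "x \<in> pverts U" using that by (auto dest: wellformed')
    show ?thesis
      using unique[OF x that(2) that(1,3), of "par x"] par[OF x that(2)] sym by simp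
  qed
  have arcs_iff: "(x, y) \<in> parcs U \<longleftrightarrow> x \<in> ?T \<and> y \<in> ?T \<and> x \<noteq> y \<or>
          x \<in> pverts U - ?T \<and> y = par x \<or> y \<in> pverts U - ?T \<and> x = par y"
    for x y
    proof (rule iffI)
      assume xy: "(x, y) \<in> parcs U"
      have V: "x \<in> pverts U" "y \<in> pverts U" using xy by (auto dest: wellformed')
      show "x \<in> ?T \<and> y \<in> ?T \<and> x \<noteq> y \<or>
          x \<in> pverts U - ?T \<and> y = par x \<or> y \<in> pverts U - ?T \<and> x = par y"
      proof (cases "lev y \<le> lev x")
        case True
        show ?thesis
        proof (cases "x \<in> ?T")
          case x: True
          then have "lev x = 0" using lev0[OF V(1)] by simp
          then have "lev y = 0" using True by simp
          then have "y \<in> ?T" using lev0[OF V(2)] by simp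
          then show ?thesis using x ne[OF xy] by blast
        next
          case False
          then show ?thesis using low[OF xy _ True] V by blast
        qed
      next
        case False
        then have "y \<notin> ?T" using lev0[OF V(2)] by linarith
        then show ?thesis using low[OF sym[OF xy]] V False by force
      qed
    next
      assume *: "x \<in> ?T \<and> y \<in> ?T \<and> x \<noteq> y \<or>
          x \<in> pverts U - ?T \<and> y = par x \<or> y \<in> pverts U - ?T \<and> x = par y"
      have "(x, y) \<in> parcs U" if "x \<in> ?T" "y \<in> ?T" "x \<noteq> y"
        using that abc(4-6) sym by auto
      moreover have "(x, y) \<in> parcs U" if "x \<in> pverts U - ?T" "y = par x"
        using par[of x] sym that by simp
      moreover have "(x, y) \<in> parcs U" if "y \<in> pverts U - ?T" "x = par y"
        using par[of y] that by simp
      ultimately show "(x, y) \<in> parcs U" using * by linarith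
    qed
  have par': "par x \<in> pverts U \<and> lev x = Suc (lev (par x))" if "x \<in> pverts U - ?T" for x
    using par[of x] that by (auto dest: wellformed')
  have "rooted_triangle U a b c par lev"
    by (rule rooted_triangle.intro[OF pair_finite_verts abc(1-3) T lev0 par' arcs_iff])
  then show thesis by (rule that)
qed

section \<open>Bridges and the depth of the branches\<close>

definition edge_form :: "real \<Rightarrow> real \<Rightarrow> real \<Rightarrow> real" where
  "edge_form \<mu> s t = \<mu> * (s\<^sup>2 + t\<^sup>2) - 2 * s * t"

lemma edge_form_scale: "edge_form \<mu> (\<alpha> * s) (\<alpha> * t) = \<alpha>\<^sup>2 * edge_form \<mu> s t"
  by (simp add: edge_form_def algebra_simps power2_eq_square)

text \<open>
  The shape that \<open>Q\<close> takes on functions that are multiples of two fixed ones on the sides of a bridge: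
  the bridge contributes the mixed term \<open>-2 \<alpha> \<beta>\<close>.
\<close>

lemma binary_form_negative:
  fixes A B \<alpha> \<beta> :: real
  assumes "A < 0" "A * B > 1" "(\<alpha>, \<beta>) \<noteq> (0, 0)"
  shows "A * \<alpha>\<^sup>2 - 2 * \<alpha> * \<beta> + B * \<beta>\<^sup>2 < 0"
proof -
  have "A * (A * \<alpha>\<^sup>2 - 2 * \<alpha> * \<beta> + B * \<beta>\<^sup>2) = (A * \<alpha> - \<beta>)\<^sup>2 + (A * B - 1) * \<beta>\<^sup>2"
    by (simp add: algebra_simps power2_eq_square)
  also have "\<dots> > 0"
  proof (cases "\<beta> = 0")
    case True
    then show ?thesis using assms by simp
  next
    case False
    then show ?thesis using assms by (intro add_nonneg_pos mult_pos_pos) auto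
  qed
  finally show ?thesis using assms(1) by (simp add: zero_less_mult_iff)
qed

context rooted_triangle
begin

abbreviation "tri_verts \<equiv> {a, b, c}"
abbreviation "tree_verts \<equiv> pverts G - tri_verts"

lemma par_in: "x \<in> tree_verts \<Longrightarrow> par x \<in> pverts G"
  and lev_par: "x \<in> tree_verts \<Longrightarrow> lev x = Suc (lev (par x))"
  using par by auto

lemma lev_tri: "lev a = 0" "lev b = 0" "lev c = 0"
  using lev0 tri by auto

lemma lev_pos: "x \<in> tree_verts \<Longrightarrow> lev x > 0"
  using lev_par by simp

lemma arcs_cases [consumes 1, case_names triangle up down]:
  assumes "(x, y) \<in> parcs G"
  obtains "x \<in> tri_verts" "y \<in> tri_verts" "x \<noteq> y"
    | "x \<in> tree_verts" "y = par x"
    | "y \<in> tree_verts" "x = par y"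
  using assms unfolding arcs by fast

lemma arcs_par: "x \<in> tree_verts \<Longrightarrow> (x, par x) \<in> parcs G"
  and arcs_tri: "x \<in> tri_verts \<Longrightarrow> y \<in> tri_verts \<Longrightarrow> x \<noteq> y \<Longrightarrow> (x, y) \<in> parcs G"
  unfolding arcs by fast+

lemma arcs_sym: "(x, y) \<in> parcs G \<Longrightarrow> (y, x) \<in> parcs G"
  unfolding arcs by fast

lemma arcs_wf:
  assumes "(x, y) \<in> parcs G"
  shows "x \<in> pverts G" "y \<in> pverts G" "x \<noteq> y"
proof -
  from assms have "x \<in> pverts G \<and> y \<in> pverts G \<and> x \<noteq> y"
  proof (cases rule: arcs_cases)
    case triangle
    then show ?thesis using tri by blast
  next
    case up
    then show ?thesis using par_in[OF up(1)] lev_par[OF up(1)] by force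
  next
    case down
    then show ?thesis using par_in[OF down(1)] lev_par[OF down(1)] by force
  qed
  then show "x \<in> pverts G" "y \<in> pverts G" "x \<noteq> y" by auto
qed

lemma pair_graph: "pair_graph G"
proof
  show "fst e \<in> pverts G" "snd e \<in> pverts G" "fst e \<noteq> snd e" if "e \<in> parcs G" for e
    using arcs_wf[of "fst e" "snd e"] that by auto
  show "finite (pverts G)" by (rule fin)
  have "parcs G \<subseteq> pverts G \<times> pverts G"
    by (rule subrelI) (simp add: arcs_wf)
  then show "finite (parcs G)" using fin finite_subset by blast
  show "symmetric (with_proj G)"
    unfolding symmetric_def by (rule symI) (simp add: arcs_sym)
qed

lemma no_isolated:
  assumes "x \<in> pverts G"
  shows "\<exists>y. (x, y) \<in> parcs G"
proof (cases "x \<in> tri_verts")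
  case True
  then obtain y where "y \<in> tri_verts" "x \<noteq> y" using dist by blast
  then show ?thesis using arcs_tri True by blast
next
  case False
  then show ?thesis using arcs_par assms by blast
qed

lemma qform_eq:
  "qform \<mu> G f = (\<Sum>x\<in>tree_verts. edge_form \<mu> (f x) (f (par x))) +
     edge_form \<mu> (f a) (f b) + edge_form \<mu> (f b) (f c) + edge_form \<mu> (f c) (f a)"
proof -
  define g where "g = (\<lambda>(u, v). \<mu> * (f u)\<^sup>2 - f u * f v)"
  define N where "N = tree_verts"
  let ?up = "(\<lambda>x. (x, par x)) ` N" and ?down = "(\<lambda>x. (par x, x)) ` N"
  let ?t = "{(a, b), (b, a), (b, c), (c, b), (c, a), (a, c)}"
  have finN: "finite N" using fin by (simp add: N_def)
  have eq: "parcs G = ?up \<union> (?down \<union> ?t)"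
  proof (rule Set.set_eqI)
    fix e :: "'a \<times> 'a"
    obtain x y where e: "e = (x, y)" by (cases e)
    have "(x, y) \<in> ?t \<longleftrightarrow> x \<in> tri_verts \<and> y \<in> tri_verts \<and> x \<noteq> y" using dist by auto
    moreover have "(x, y) \<in> ?up \<longleftrightarrow> x \<in> N \<and> y = par x" by auto
    moreover have "(x, y) \<in> ?down \<longleftrightarrow> y \<in> N \<and> x = par y" by auto
    ultimately show "e \<in> parcs G \<longleftrightarrow> e \<in> ?up \<union> (?down \<union> ?t)"
      unfolding e arcs N_def[symmetric] Un_iff by satx
  qed
  have "?up \<inter> ?down = {}"
  proof -
    have False if "x \<in> N" "y \<in> N" "x = par y" "par x = y" for x y
      using lev_par[of x] lev_par[of y] that by (simp add: N_def)
    then show ?thesis by blast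
  qed
  moreover have "?up \<inter> ?t = {}" "?down \<inter> ?t = {}" by (auto simp: N_def)
  ultimately have disj: "?up \<inter> (?down \<union> ?t) = {}" "?down \<inter> ?t = {}" by blast+
  have "sum g (parcs G) = sum g ?up + sum g (?down \<union> ?t)"
    unfolding eq by (rule sum.union_disjoint[OF _ _ disj(1)]) (use finN in simp_all)
  also have "sum g (?down \<union> ?t) = sum g ?down + sum g ?t"
    by (rule sum.union_disjoint[OF _ _ disj(2)]) (use finN in simp_all)
  also have "sum g ?up = (\<Sum>x\<in>N. g (x, par x))"
    by (subst sum.reindex) (auto simp: inj_on_def)
  also have "sum g ?down = (\<Sum>x\<in>N. g (par x, x))"
    by (subst sum.reindex) (auto simp: inj_on_def)
  also have "sum g ?t = edge_form \<mu> (f a) (f b) + edge_form \<mu> (f b) (f c) + edge_form \<mu> (f c) (f a)"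
    using dist by (simp add: g_def edge_form_def algebra_simps)
  finally have "sum g (parcs G) = (\<Sum>x\<in>N. g (x, par x) + g (par x, x)) +
      (edge_form \<mu> (f a) (f b) + edge_form \<mu> (f b) (f c) + edge_form \<mu> (f c) (f a))"
    by (simp add: sum.distrib)
  moreover have "g (x, par x) + g (par x, x) = edge_form \<mu> (f x) (f (par x))" for x
    by (simp add: g_def edge_form_def algebra_simps)
  ultimately show ?thesis
    unfolding qform_def g_def[symmetric] N_def by simp
qed

text \<open>
  The subtree at \<open>x\<close>. The number of steps up is fixed by the levels, which avoids an existential quantifier.
\<close>

definition desc :: "'a \<Rightarrow> 'a set" where
  "desc x = {y \<in> pverts G. lev x \<le> lev y \<and> (par ^^ (lev y - lev x)) y = x}"

lemma desc_subset: "x \<in> tree_verts \<Longrightarrow> desc x \<subseteq> tree_verts"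
  using lev_pos[of x] lev_tri by (auto simp: desc_def)

lemma self_desc: "x \<in> pverts G \<Longrightarrow> x \<in> desc x"
  by (simp add: desc_def)

lemma par_not_desc: "x \<in> tree_verts \<Longrightarrow> par x \<notin> desc x"
  using lev_par by (simp add: desc_def)

lemma par_desc_iff:
  assumes "y \<in> tree_verts" "y \<noteq> x"
  shows "par y \<in> desc x \<longleftrightarrow> y \<in> desc x"
proof (cases "lev x < lev y")
  case True
  then have "lev y - lev x = Suc (lev (par y) - lev x)" "lev x \<le> lev (par y)"
    using lev_par[OF assms(1)] by auto
  then show ?thesis using True assms(1) par_in[OF assms(1)] lev_par[OF assms(1)]
    by (simp add: desc_def funpow_Suc_right del: funpow.simps)
next
  case False
  then show ?thesis using assms lev_par[OF assms(1)] by (auto simp: desc_def)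
qed

text \<open>
  The plane is spanned by a function \<open>w\<close> supported on the branch at \<open>x\<close> and the indicator of the
  complement. On the complement, each edge off the bridge contributes \<open>-2(1 - \<mu>) \<beta>\<^sup>2\<close>, and there are as many
  such edges as vertices because the complement contains the triangle.
\<close>

lemma bridge_negative_plane:
  assumes x: "x \<in> tree_verts" and w: "w x = 1"
    and A: "A = \<mu> + (\<Sum>y\<in>desc x - {x}. edge_form \<mu> (w y) (w (par y)))" "A < 0"
    and B: "B = \<mu> - 2 * (1 - \<mu>) * (real (card (pverts G)) - real (card (desc x)))" "A * B > 1"
  shows "negative_plane \<mu> G"
  unfolding negative_plane_def
proof (rule exI[of _ "\<lambda>y. if y \<in> desc x then w y else 0"],
    rule exI[of _ "\<lambda>y. if y \<in> desc x then 0 else 1"], intro allI impI)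
  fix \<alpha> \<beta> :: real
  assume nz: "(\<alpha>, \<beta>) \<noteq> (0, 0)"
  define f where "f y = \<alpha> * (if y \<in> desc x then w y else 0) + \<beta> * (if y \<in> desc x then 0 else 1)" for y
  have f: "f y = (if y \<in> desc x then \<alpha> * w y else \<beta>)" for y by (simp add: f_def)
  have sub: "desc x \<subseteq> tree_verts" by (rule desc_subset[OF x])
  have xd: "x \<in> desc x" using self_desc x by auto
  have tri_out: "a \<notin> desc x" "b \<notin> desc x" "c \<notin> desc x" using sub by auto
  have split: "tree_verts = insert x (desc x - {x}) \<union> (tree_verts - desc x)" using sub xd x by auto
  have fin': "finite (desc x)" using sub fin finite_subset by blast
  have "(\<Sum>y\<in>tree_verts. edge_form \<mu> (f y) (f (par y)))
      = (\<Sum>y\<in>insert x (desc x - {x}). edge_form \<mu> (f y) (f (par y)))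
        + (\<Sum>y\<in>tree_verts - desc x. edge_form \<mu> (f y) (f (par y)))"
    by (subst split, rule sum.union_disjoint) (use fin fin' xd in auto)
  also have "(\<Sum>y\<in>insert x (desc x - {x}). edge_form \<mu> (f y) (f (par y)))
      = edge_form \<mu> \<alpha> \<beta> + (\<Sum>y\<in>desc x - {x}. edge_form \<mu> (f y) (f (par y)))"
    using fin' xd par_not_desc[OF x] w by (simp add: f del: insert_Diff_single)
  also have "(\<Sum>y\<in>desc x - {x}. edge_form \<mu> (f y) (f (par y)))
      = (\<Sum>y\<in>desc x - {x}. \<alpha>\<^sup>2 * edge_form \<mu> (w y) (w (par y)))"
  proof (rule sum.cong[OF refl])
    fix y assume y: "y \<in> desc x - {x}"
    then have "par y \<in> desc x" using par_desc_iff[of y x] sub by auto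
    then show "edge_form \<mu> (f y) (f (par y)) = \<alpha>\<^sup>2 * edge_form \<mu> (w y) (w (par y))"
      using y by (simp add: f edge_form_scale)
  qed
  also have "(\<Sum>y\<in>tree_verts - desc x. edge_form \<mu> (f y) (f (par y)))
      = (\<Sum>y\<in>tree_verts - desc x. edge_form \<mu> \<beta> \<beta>)"
  proof (rule sum.cong[OF refl])
    fix y assume y: "y \<in> tree_verts - desc x"
    then have "y \<noteq> x" using xd by auto
    then have "par y \<notin> desc x" using par_desc_iff[of y x] y by auto
    then show "edge_form \<mu> (f y) (f (par y)) = edge_form \<mu> \<beta> \<beta>" using y by (simp add: f)
  qed
  finally have sum: "(\<Sum>y\<in>tree_verts. edge_form \<mu> (f y) (f (par y))) = edge_form \<mu> \<alpha> \<beta>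
      + \<alpha>\<^sup>2 * (A - \<mu>) + real (card (tree_verts - desc x)) * edge_form \<mu> \<beta> \<beta>"
    using A by (simp add: sum_distrib_left)
  have "card (tree_verts - desc x) = card tree_verts - card (desc x)"
    using sub fin' by (simp add: card_Diff_subset)
  moreover have "card tree_verts = card (pverts G) - 3"
    using tri fin dist by (subst card_Diff_subset) auto
  moreover have "card (desc x) \<le> card tree_verts" using sub fin by (intro card_mono) auto
  moreover have "card tri_verts \<le> card (pverts G)" using tri fin by (rule card_mono[rotated])
  moreover have "card tri_verts = 3" using dist by simp
  ultimately have "real (card (tree_verts - desc x)) + 3 = real (card (pverts G)) - real (card (desc x))"
    by linarith
  then have B': "B = \<mu> - 2 * (1 - \<mu>) * (real (card (tree_verts - desc x)) + 3)" using B by simp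
  have "qform \<mu> G f = A * \<alpha>\<^sup>2 - 2 * \<alpha> * \<beta> + B * \<beta>\<^sup>2"
    unfolding qform_eq sum B' using tri_out
    by (simp add: f edge_form_def algebra_simps power2_eq_square)
  also have "\<dots> < 0" by (rule binary_form_negative[OF A(2) B(2) nz])
  finally show "qform \<mu> G (\<lambda>y. \<alpha> * (if y \<in> desc x then w y else 0) + \<beta> * (if y \<in> desc x then 0 else 1)) < 0"
    unfolding f_def .
qed

end

abbreviation (input) mu :: real where "mu \<equiv> sqrt 6 / 3"

lemma mu_sq: "mu * mu = 2 / 3" by (simp add: field_simps)

lemma mu_bounds: "mu > 0.81649" "mu < 0.8165"
proof -
  have "2.44948 < sqrt 6" by (rule real_less_rsqrt) (simp add: power2_eq_square)
  then show "mu > 0.81649" by simp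
  have "sqrt 6 < 2.4495" by (rule real_less_lsqrt) (simp_all add: power2_eq_square)
  then show "mu < 0.8165" by simp
qed

context rooted_triangle
begin

text \<open>
  Already the indicator functions of the two sides work: a side with \<open>e\<close> edges has value
  \<open>\<mu> - 2 e (1 - \<mu>)\<close>, which is negative from \<open>e = 3\<close> on and strongly negative for the larger side.
\<close>

lemma large_branches_negative_plane:
  assumes n: "card (pverts G) \<ge> 21" and x: "x \<in> tree_verts" and big: "card (desc x) \<ge> 4"
  shows "negative_plane mu G"
proof -
  \<comment> \<open>With \<open>i + 4\<close> vertices in the branch and \<open>j + 3\<close> outside, indicator functions give
    \<open>A = -(u + t i)\<close> and \<open>B = -(u + t j)\<close> with \<open>u = 6 - 7 \<mu>\<close>. Dropping \<open>t\<^sup>2 i j\<close>, the product is at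
    least \<open>u (u + t (i + j))\<close>, and \<open>i + j \<ge> 14\<close>.\<close>
  define t where "t = 2 * (1 - mu)"
  define i where "i = real (card (desc x)) - 4"
  define j where "j = real (card (pverts G)) - real (card (desc x)) - 3"
  have sub: "desc x \<subseteq> tree_verts" by (rule desc_subset[OF x])
  have "card tri_verts + card (desc x) \<le> card (pverts G)"
  proof -
    have "card (tri_verts \<union> desc x) = card tri_verts + card (desc x)"
      using sub fin by (intro card_Un_disjoint) (auto intro: finite_subset)
    moreover have "card (tri_verts \<union> desc x) \<le> card (pverts G)"
      using sub tri fin by (intro card_mono) auto
    ultimately show ?thesis by simp
  qed
  moreover have "card tri_verts = 3" using dist by simp
  ultimately have ij: "i \<ge> 0" "j \<ge> 0" "i + j \<ge> 14" using n big by (auto simp: i_def j_def)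
  have xd: "x \<in> desc x" using self_desc x by auto
  have fin': "finite (desc x)" using sub fin finite_subset by blast
  have one: "edge_form mu 1 1 = - t" by (simp add: edge_form_def t_def)
  have cd: "real (card (desc x - {x})) = i + 3"
    using xd fin' big by (simp add: i_def)
  define u where "u = 3 * t - mu"
  have t: "t > 0.367" and u: "u > 0.284" using mu_bounds by (auto simp: t_def u_def)
  have A: "mu + (\<Sum>y\<in>desc x - {x}. edge_form mu 1 1) = - (u + t * i)"
    unfolding one sum_constant cd by (simp add: u_def algebra_simps)
  have B: "mu - 2 * (1 - mu) * (real (card (pverts G)) - real (card (desc x))) = - (u + t * j)"
    by (simp add: u_def t_def j_def field_simps)
  have "1 < 0.284 * (0.284 + 0.367 * 14 :: real)" by simp
  also have "\<dots> \<le> u * (u + t * 14)" using t u by (intro mult_mono add_mono) auto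
  also have "\<dots> \<le> u * (u + t * (i + j))" using t u ij by (intro mult_left_mono add_left_mono) auto
  also have "\<dots> \<le> u * (u + t * (i + j)) + t * i * (t * j)" using t ij by simp
  also have "\<dots> = (u + t * i) * (u + t * j)" by (simp add: algebra_simps)
  finally have AB: "(- (u + t * i)) * (- (u + t * j)) > 1" by (simp only: minus_mult_minus)
  have "- (u + t * i) < 0" using t u ij by (simp only: neg_less_0_iff_less) (intro add_pos_nonneg mult_nonneg_nonneg, auto)
  then show ?thesis
    using bridge_negative_plane[OF x, of "\<lambda>_. 1" "- (u + t * i)" mu "- (u + t * j)"] A B AB by simp
qed

text \<open>
  A branch with three vertices is too small for its indicator function. The weights \<open>1, 5/2, 3\<close> approximate
  the optimal ones \<open>1, 2/\<mu>, 3\<close>, for which the value of the form is \<open>-\<mu>\<close>.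
\<close>

lemma pendant_path_negative_plane:
  assumes n: "card (pverts G) \<ge> 21" and x: "x \<in> tree_verts" and path: "desc x = {x, y, z}"
    and ne: "x \<noteq> y" "x \<noteq> z" "y \<noteq> z" and pary: "par y = x" and parz: "par z = y"
  shows "negative_plane mu G"
proof -
  define w where "w v = (if v = x then 1 else if v = y then 5 / 2 else 3 :: real)" for v
  have ds: "desc x - {x} = {y, z}" using path ne by auto
  have A: "mu + (\<Sum>v\<in>desc x - {x}. edge_form mu (w v) (w (par v))) = 47 / 2 * mu - 20"
    unfolding ds using ne pary parz by (simp add: w_def edge_form_def power2_eq_square)
  have card: "card (desc x) = 3" using path ne by simp
  define B where "B = mu - 2 * (1 - mu) * (real (card (pverts G)) - real (card (desc x)))"
  have "2 * (1 - mu) * (real (card (pverts G)) - real (card (desc x))) \<ge> 2 * (1 - mu) * 18"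
    using mu_bounds n by (intro mult_left_mono) (auto simp: card)
  then have "B \<le> -5" using mu_bounds by (simp add: B_def)
  moreover have A0: "47 / 2 * mu - 20 < - 1 / 2" using mu_bounds by simp
  ultimately have "(- (47 / 2 * mu - 20)) * (- B) \<ge> 1 / 2 * 5" by (intro mult_mono) auto
  then have "(47 / 2 * mu - 20) * B > 1" by (simp add: algebra_simps)
  then show ?thesis
    using bridge_negative_plane[OF x, of w "47 / 2 * mu - 20" mu B] A B_def A0 by (simp add: w_def)
qed

definition kids :: "'a \<Rightarrow> 'a set" where "kids x = {y \<in> tree_verts. par y = x}"

text \<open>
  A vertex of level 3 would lie, together with its parent and grandparent, in a branch that is either
  large or the path excluded above.
\<close>

lemma branches_are_small:
  assumes n: "card (pverts G) \<ge> 21" and no: "\<not> negative_plane mu G"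
  shows "x \<in> pverts G \<Longrightarrow> lev x \<le> 2" and "x \<in> tree_verts \<Longrightarrow> card (kids x) \<le> 2"
proof -
  have small: "card (desc x) \<le> 3" if "x \<in> tree_verts" for x
    using large_branches_negative_plane[OF n that] no by linarith
  have findesc: "finite (desc x)" if "x \<in> tree_verts" for x
    using desc_subset[OF that] fin finite_subset by blast
  show "lev z \<le> 2" if z: "z \<in> pverts G" for z
  proof (rule ccontr)
    assume "\<not> lev z \<le> 2"
    then have l: "lev z \<ge> 3" by simp
    have zt: "z \<in> tree_verts" using z l lev0[OF z] by auto
    define y where "y = par z"
    define x where "x = par y"
    have y: "y \<in> pverts G" "lev z = Suc (lev y)" using par[OF zt] by (auto simp: y_def)
    then have yt: "y \<in> tree_verts" using l lev0[OF y(1)] by auto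
    have x: "x \<in> pverts G" "lev y = Suc (lev x)" using par[OF yt] by (auto simp: x_def)
    then have xt: "x \<in> tree_verts" using l y lev0[OF x(1)] by auto
    have ne: "x \<noteq> y" "x \<noteq> z" "y \<noteq> z" using x y by auto
    have in_d: "x \<in> desc x" "y \<in> desc x" "z \<in> desc x"
      using self_desc[OF x(1)] par_desc_iff[OF yt ne(1)[symmetric]] par_desc_iff[OF zt ne(2)[symmetric]]
      by (simp_all add: x_def y_def)
    have "card {x, y, z} = 3" using ne by simp
    then have "{x, y, z} = desc x"
      using in_d by (intro card_seteq[OF findesc[OF xt]]) (simp_all add: small[OF xt])
    from pendant_path_negative_plane[OF n xt this[symmetric] ne x_def[symmetric] y_def[symmetric]] no
    show False by contradiction
  qed
  show "card (kids x) \<le> 2" if x: "x \<in> tree_verts" for x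
  proof -
    have "kids x \<subseteq> desc x - {x}"
    proof
      fix y assume "y \<in> kids x"
      then have y: "y \<in> tree_verts" "par y = x" by (auto simp: kids_def)
      then have ne: "y \<noteq> x" using lev_par[OF y(1)] by auto
      have "x \<in> desc x" using self_desc x by simp
      then have "y \<in> desc x" using par_desc_iff[OF y(1) ne] y(2) by simp
      then show "y \<in> desc x - {x}" using ne by simp
    qed
    then have "card (kids x) \<le> card (desc x - {x})" using findesc[OF x] by (intro card_mono) auto
    also have "\<dots> = card (desc x) - 1" using self_desc x findesc[OF x] by simp
    finally show ?thesis using small[OF x] by simp
  qed
qed

end

section \<open>Isomorphism invariance\<close>

lemma bij_betw_parcs:
  fixes G :: "'a pair_pre_digraph" and H :: "'b pair_pre_digraph"
  assumes G: "pair_wf_digraph G" and H: "pair_wf_digraph H" and g: "bij_betw g (pverts G) (pverts H)"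
    and iff: "\<And>u v. u \<in> pverts G \<Longrightarrow> v \<in> pverts G \<Longrightarrow> (u, v) \<in> parcs G \<longleftrightarrow> (g u, g v) \<in> parcs H"
  shows "bij_betw (\<lambda>(u, v). (g u, g v)) (parcs G) (parcs H)"
  unfolding bij_betw_def
proof
  interpret G: pair_wf_digraph G by fact
  interpret H: pair_wf_digraph H by fact
  show "inj_on (\<lambda>(u, v). (g u, g v)) (parcs G)"
    by (rule inj_onI) (use g in \<open>auto simp: bij_betw_def inj_on_def intro: G.wellformed'\<close>)
  show "(\<lambda>(u, v). (g u, g v)) ` parcs G = parcs H"
  proof (intro Set.equalityI subsetI)
    fix e assume e: "e \<in> parcs H"
    obtain x y where xy: "e = (x, y)" by (cases e)
    then obtain u v where "u \<in> pverts G" "v \<in> pverts G" "x = g u" "y = g v"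
      using e g unfolding bij_betw_def by (blast dest: H.wellformed')
    then show "e \<in> (\<lambda>(u, v). (g u, g v)) ` parcs G" using iff e xy by force
  next
    fix e assume "e \<in> (\<lambda>(u, v). (g u, g v)) ` parcs G"
    then obtain u v where "(u, v) \<in> parcs G" "e = (g u, g v)" by auto
    then show "e \<in> parcs H" using iff G.wellformed' by blast
  qed
qed

text \<open>
  An isomorphism of digraphs in general carries its own map on arcs; for digraphs given by sets of pairs
  that map is determined by the one on vertices.
\<close>

lemma isomorphic_iff:
  fixes G :: "'a pair_pre_digraph" and H :: "'b pair_pre_digraph"
  assumes G: "pair_wf_digraph G" and H: "pair_wf_digraph H"
  shows "G \<simeq> H \<longleftrightarrow> (\<exists>g. bij_betw g (pverts G) (pverts H) \<and>
    (\<forall>u\<in>pverts G. \<forall>v\<in>pverts G. (u, v) \<in> parcs G \<longleftrightarrow> (g u, g v) \<in> parcs H))"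
proof
  interpret G: pair_wf_digraph G by fact
  interpret H: pair_wf_digraph H by fact
  {
    assume "G \<simeq> H"
    then obtain f where f: "G.digraph_isomorphism f" "with_proj H = app_iso f (with_proj G)"
      unfolding digraph_iso_def by blast
    define g where "g = iso_verts f"
    have V: "pverts H = g ` pverts G"
      using arg_cong[OF f(2), of verts] by (simp add: g_def)
    have A: "parcs H = iso_arcs f ` parcs G"
      using arg_cong[OF f(2), of pre_digraph.arcs] by simp
    have t: "fst = iso_tail f" "snd = iso_head f"
      using arg_cong[OF f(2), of tail] arg_cong[OF f(2), of head] by simp_all
    have inj: "inj_on g (pverts G)"
      using f(1) by (simp add: G.digraph_isomorphism_def g_def)
    have im: "iso_arcs f (u, v) = (g u, g v)" if "(u, v) \<in> parcs G" for u v
    proof -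
      have "fst (iso_arcs f (u, v)) = g u" "snd (iso_arcs f (u, v)) = g v"
        using f(1) that unfolding G.digraph_isomorphism_def t g_def by fastforce+
      then show ?thesis by (metis prod.collapse)
    qed
    have "(u, v) \<in> parcs G \<longleftrightarrow> (g u, g v) \<in> parcs H" if uv: "u \<in> pverts G" "v \<in> pverts G" for u v
    proof
      assume "(u, v) \<in> parcs G"
      then show "(g u, g v) \<in> parcs H" using im unfolding A by force
    next
      assume "(g u, g v) \<in> parcs H"
      then obtain e where e: "e \<in> parcs G" "(g u, g v) = iso_arcs f e" unfolding A by blast
      obtain x y where xy: "e = (x, y)" by (cases e)
      then have "g u = g x" "g v = g y" using e im by simp_all
      moreover have "x \<in> pverts G" "y \<in> pverts G" using e(1) unfolding xy by (auto dest: G.wellformed')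
      ultimately have "u = x" "v = y" using inj uv by (auto dest: inj_onD)
      then show "(u, v) \<in> parcs G" using e xy by simp
    qed
    then show "\<exists>g. bij_betw g (pverts G) (pverts H) \<and>
      (\<forall>u\<in>pverts G. \<forall>v\<in>pverts G. (u, v) \<in> parcs G \<longleftrightarrow> (g u, g v) \<in> parcs H)"
      using inj V by (intro exI[of _ g]) (auto simp: bij_betw_def)
  }
  {
    assume "\<exists>g. bij_betw g (pverts G) (pverts H) \<and>
      (\<forall>u\<in>pverts G. \<forall>v\<in>pverts G. (u, v) \<in> parcs G \<longleftrightarrow> (g u, g v) \<in> parcs H)"
    then obtain g where g: "bij_betw g (pverts G) (pverts H)"
      and iff: "\<And>u v. u \<in> pverts G \<Longrightarrow> v \<in> pverts G \<Longrightarrow> (u, v) \<in> parcs G \<longleftrightarrow> (g u, g v) \<in> parcs H"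
      by blast
    define f where "f = \<lparr>iso_verts = g, iso_arcs = (\<lambda>(u, v). (g u, g v)), iso_head = snd, iso_tail = fst\<rparr>"
    note arcs = bij_betw_parcs[OF G H g iff, unfolded bij_betw_def]
    have "G.digraph_isomorphism f"
      unfolding G.digraph_isomorphism_def f_def using g arcs G.wf_digraph_axioms by (auto simp: bij_betw_def)
    moreover have "with_proj H = app_iso f (with_proj G)"
      using g arcs by (simp add: with_proj_def app_iso_def f_def bij_betw_def)
    ultimately show "G \<simeq> H" unfolding digraph_iso_def by blast
  }
qed

lemma isomorphic_sym:
  assumes "G \<simeq> H" "pair_wf_digraph G" "pair_wf_digraph H"
  shows "H \<simeq> G"
proof -
  interpret pair_wf_digraph G by fact
  show ?thesis using assms(1) digraph_iso_swap[OF wf_digraph_axioms] by blast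
qed

lemma isomorphic_planes_pullback:
  fixes G :: "'a pair_pre_digraph" and H :: "'b pair_pre_digraph"
  assumes G: "pair_wf_digraph G" and H: "pair_wf_digraph H" and iso: "G \<simeq> H"
  shows "negative_plane \<mu> H \<Longrightarrow> negative_plane \<mu> G"
    and "nonpositive_plane \<mu> H \<Longrightarrow> nonpositive_plane \<mu> G"
    and "card (pverts G) = card (pverts H)"
proof -
  obtain g where g: "bij_betw g (pverts G) (pverts H)"
    and iff: "\<And>u v. u \<in> pverts G \<Longrightarrow> v \<in> pverts G \<Longrightarrow> (u, v) \<in> parcs G \<longleftrightarrow> (g u, g v) \<in> parcs H"
    using iso unfolding isomorphic_iff[OF G H] by blast
  have Q: "qform \<mu> G (\<lambda>v. f (g v)) = qform \<mu> H f" for f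
    using sum.reindex_bij_betw[OF bij_betw_parcs[OF G H g iff], of "\<lambda>(u, v). \<mu> * (f u)\<^sup>2 - f u * f v"]
    unfolding qform_def by (simp add: case_prod_unfold)
  {
    assume "negative_plane \<mu> H"
    then obtain f1 f2 where f: "\<forall>\<alpha> \<beta>. (\<alpha>, \<beta>) \<noteq> (0, 0) \<longrightarrow> qform \<mu> H (\<lambda>v. \<alpha> * f1 v + \<beta> * f2 v) < 0"
      unfolding negative_plane_def by blast
    show "negative_plane \<mu> G" unfolding negative_plane_def
      by (rule exI[of _ "\<lambda>v. f1 (g v)"], rule exI[of _ "\<lambda>v. f2 (g v)"])
        (use f Q[of "\<lambda>v. _ * f1 v + _ * f2 v"] in simp)
  }
  {
    assume "nonpositive_plane \<mu> H"
    then obtain f1 f2 where f: "\<And>\<alpha> \<beta>. qform \<mu> H (\<lambda>v. \<alpha> * f1 v + \<beta> * f2 v) \<le> 0"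
      and ind: "\<And>\<alpha> \<beta>. (\<alpha>, \<beta>) \<noteq> (0, 0) \<Longrightarrow> \<exists>v\<in>pverts H. \<alpha> * f1 v + \<beta> * f2 v \<noteq> 0"
      unfolding nonpositive_plane_def by blast
    show "nonpositive_plane \<mu> G" unfolding nonpositive_plane_def
    proof (rule exI[of _ "\<lambda>v. f1 (g v)"], rule exI[of _ "\<lambda>v. f2 (g v)"], intro conjI allI impI)
      show "qform \<mu> G (\<lambda>v. \<alpha> * f1 (g v) + \<beta> * f2 (g v)) \<le> 0" for \<alpha> \<beta>
        using f Q[of "\<lambda>v. \<alpha> * f1 v + \<beta> * f2 v"] by simp
      show "\<exists>v\<in>pverts G. \<alpha> * f1 (g v) + \<beta> * f2 (g v) \<noteq> 0" if "(\<alpha>, \<beta>) \<noteq> (0, 0)" for \<alpha> \<beta>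
        using ind[OF that] g unfolding bij_betw_def by (metis (no_types, lifting) imageE)
    qed
  }
  show "card (pverts G) = card (pverts H)" by (rule bij_betw_same_card[OF g])
qed

lemma isomorphic_planes:
  fixes G :: "'a pair_pre_digraph" and H :: "'b pair_pre_digraph"
  assumes G: "pair_wf_digraph G" and H: "pair_wf_digraph H" and iso: "G \<simeq> H"
  shows "negative_plane \<mu> G \<longleftrightarrow> negative_plane \<mu> H"
    and "nonpositive_plane \<mu> G \<longleftrightarrow> nonpositive_plane \<mu> H"
    and "card (pverts G) = card (pverts H)"
proof -
  note 1 = isomorphic_planes_pullback[OF G H iso]
  note 2 = isomorphic_planes_pullback[OF H G isomorphic_sym[OF iso G H]]
  show "negative_plane \<mu> G \<longleftrightarrow> negative_plane \<mu> H" using 1(1) 2(1) by (rule iffI[rotated])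
  show "nonpositive_plane \<mu> G \<longleftrightarrow> nonpositive_plane \<mu> H" using 1(2) 2(2) by (rule iffI[rotated])
  show "card (pverts G) = card (pverts H)" by (rule 1(3))
qed

lemma isomorphic_trans:
  assumes "pair_wf_digraph G" "pair_wf_digraph H" "pair_wf_digraph K" "G \<simeq> H" "H \<simeq> K"
  shows "G \<simeq> K"
proof -
  obtain g where g: "bij_betw g (pverts G) (pverts H)"
    "\<And>u v. u \<in> pverts G \<Longrightarrow> v \<in> pverts G \<Longrightarrow> (u, v) \<in> parcs G \<longleftrightarrow> (g u, g v) \<in> parcs H"
    using assms(4) unfolding isomorphic_iff[OF assms(1,2)] by blast
  obtain h where h: "bij_betw h (pverts H) (pverts K)"
    "\<And>u v. u \<in> pverts H \<Longrightarrow> v \<in> pverts H \<Longrightarrow> (u, v) \<in> parcs H \<longleftrightarrow> (h u, h v) \<in> parcs K"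
    using assms(5) unfolding isomorphic_iff[OF assms(2,3)] by blast
  have "g u \<in> pverts H" if "u \<in> pverts G" for u using g(1) that by (auto simp: bij_betw_def)
  then show ?thesis unfolding isomorphic_iff[OF assms(1,3)]
    using bij_betw_trans[OF g(1) h(1)] g(2) h(2) by (intro exI[of _ "h \<circ> g"]) auto
qed

section \<open>Triangles with spiders attached\<close>

text \<open>
  The trees \<open>T(l\<^sub>0, l\<^sub>1, l\<^sub>2)\<close> with their children listed one by one: the \<open>c\<close>-th child of the root has
  \<open>ks ! c\<close> leaves. This form allows proofs that treat all children alike.
\<close>

definition spider :: "nat list \<Rightarrow> rooted_tree" where
  "spider ks = RNode (map star ks)"

abbreviation spider_triangle :: "nat list \<Rightarrow> nat list \<Rightarrow> nat list \<Rightarrow> (nat \<times> nat list) pair_pre_digraph" where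
  "spider_triangle k l m \<equiv> cycle_with_trees [spider k, spider l, spider m]"

definition leg_list :: "nat \<Rightarrow> nat \<Rightarrow> nat \<Rightarrow> nat list" where
  "leg_list l0 l1 l2 = replicate l0 0 @ replicate l1 1 @ replicate l2 2"

lemma tree_T_spider: "tree_T l0 l1 l2 = spider (leg_list l0 l1 l2)"
  by (simp add: tree_T_def spider_def leg_list_def)

lemma star_tree_T: "star m = tree_T m 0 0"
  by (simp add: star_def tree_T_def)

lemma K1_tree_T: "K1 = tree_T 0 0 0"
  by (simp add: tree_T_def)

lemma is_vertex_star: "is_vertex (star m) q \<longleftrightarrow> q = [] \<or> (\<exists>d<m. q = [d])"
proof (cases q)
  case (Cons d r)
  then show ?thesis by (cases r) (auto simp: star_def)
qed simp

lemma is_vertex_spider: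
  "is_vertex (spider ks) q \<longleftrightarrow>
     q = [] \<or> (\<exists>c<length ks. q = [c]) \<or> (\<exists>c<length ks. \<exists>d<ks ! c. q = [c, d])"
proof (cases q)
  case (Cons c r)
  then show ?thesis by (auto simp: spider_def is_vertex_star)
qed simp

lemma is_vertex_append: "is_vertex t (p @ q) \<Longrightarrow> is_vertex t p"
  by (induction t p rule: is_vertex.induct) auto

lemma less_3: "i < (3 :: nat) \<longleftrightarrow> i = 0 \<or> i = 1 \<or> i = 2"
  by auto

lemma verts_triangle:
  "pverts (cycle_with_trees [t0, t1, t2]) = {(i, q). i < 3 \<and> is_vertex ([t0, t1, t2] ! i) q}"
proof -
  have "length [t0, t1, t2] = 3" by simp
  then show ?thesis by (simp only: cycle_with_trees_def Let_def pair_pre_digraph.simps)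
qed

text \<open>
  For three trees the cyclic adjacency of the roots is just inequality of their indices.
\<close>

lemma parcs_triangle:
  "((i, p), (j, q)) \<in> parcs (cycle_with_trees [t0, t1, t2]) \<longleftrightarrow>
    (i, p) \<in> pverts (cycle_with_trees [t0, t1, t2]) \<and> (j, q) \<in> pverts (cycle_with_trees [t0, t1, t2]) \<and>
    (i = j \<and> ((\<exists>c. q = p @ [c]) \<or> (\<exists>c. p = q @ [c])) \<or> p = [] \<and> q = [] \<and> i \<noteq> j)"
proof -
  let ?V = "pverts (cycle_with_trees [t0, t1, t2])"
  have "((i, p), (j, q)) \<in> parcs (cycle_with_trees [t0, t1, t2]) \<longleftrightarrow> (i, p) \<in> ?V \<and> (j, q) \<in> ?V \<and>
    (i = j \<and> ((\<exists>c. q = p @ [c]) \<or> (\<exists>c. p = q @ [c])) \<or>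
     p = [] \<and> q = [] \<and> (j = Suc i mod 3 \<or> i = Suc j mod 3))"
  proof -
    have "length [t0, t1, t2] = 3" by simp
    then show ?thesis
      by (simp only: cycle_with_trees_def Let_def pair_pre_digraph.simps mem_Collect_eq prod.inject) blast
  qed
  moreover have "j = Suc i mod 3 \<or> i = Suc j mod 3 \<longleftrightarrow> i \<noteq> j" if "(i, p) \<in> ?V" "(j, q) \<in> ?V"
  proof -
    have "i = 0 \<or> i = 1 \<or> i = 2" "j = 0 \<or> j = 1 \<or> j = 2"
      using that unfolding verts_triangle less_3[symmetric] by simp_all
    then show ?thesis by (elim disjE) simp_all
  qed
  ultimately show ?thesis by blast
qed

text \<open>
  All permutations of three cyclically arranged trees are realized by rotations and reflections.
\<close>

lemma triangle_permute:
  assumes \<pi>: "bij_betw \<pi> {..<3} {..<3}"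
    and t: "\<And>i. i < 3 \<Longrightarrow> [s0, s1, s2] ! (\<pi> i) = [t0, t1, t2] ! i"
  shows "cycle_with_trees [t0, t1, t2] \<simeq> cycle_with_trees [s0, s1, s2]"
proof -
  define G where "G = cycle_with_trees [t0, t1, t2]"
  define H where "H = cycle_with_trees [s0, s1, s2]"
  have pi: "\<pi> i < 3" if "i < 3" for i using \<pi> that by (auto simp: bij_betw_def)
  have VG: "(i, q) \<in> pverts G \<longleftrightarrow> i < 3 \<and> is_vertex ([t0, t1, t2] ! i) q" for i q
    by (simp add: G_def verts_triangle)
  have VH: "(i, q) \<in> pverts H \<longleftrightarrow> i < 3 \<and> is_vertex ([s0, s1, s2] ! i) q" for i q
    by (simp add: H_def verts_triangle)
  have wf: "pair_wf_digraph (cycle_with_trees [t0, t1, t2])" for t0 t1 t2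
    by unfold_locales (auto simp: cycle_with_trees_def Let_def)
  have V: "(\<pi> i, q) \<in> pverts H \<longleftrightarrow> (i, q) \<in> pverts G" if "i < 3" for i q
    using t[OF that] pi[OF that] that by (simp add: VG VH)
  have inj: "\<pi> i = \<pi> j \<longleftrightarrow> i = j" if "i < 3" "j < 3" for i j
    using \<pi> that unfolding bij_betw_def inj_on_def by auto
  let ?g = "\<lambda>(i, q). (\<pi> i, q :: nat list)"
  have "bij_betw ?g (pverts G) (pverts H)"
    unfolding bij_betw_def
  proof
    show "inj_on ?g (pverts G)" by (rule inj_onI) (auto simp: VG inj)
    show "?g ` pverts G = pverts H"
    proof (intro Set.equalityI subsetI)
      fix x assume "x \<in> ?g ` pverts G"
      then show "x \<in> pverts H" using V by (auto simp: VG)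
    next
      fix x assume x: "x \<in> pverts H"
      obtain j q where jq: "x = (j, q)" by (cases x)
      then have "j < 3" using x VH by blast
      then obtain i where i: "i < 3" "j = \<pi> i" using \<pi> unfolding bij_betw_def by (metis imageE lessThan_iff)
      then have "(i, q) \<in> pverts G" using V[OF i(1)] x jq by simp
      then show "x \<in> ?g ` pverts G" using jq i by force
    qed
  qed
  moreover have "(u, v) \<in> parcs G \<longleftrightarrow> (?g u, ?g v) \<in> parcs H" if uv: "u \<in> pverts G" "v \<in> pverts G" for u v
  proof -
    obtain i p j q where e: "u = (i, p)" "v = (j, q)" by (cases u; cases v)
    then have "i < 3" "j < 3" using uv VG by auto
    then show ?thesis
      using V[of i p] V[of j q] uv inj[of i j] unfolding e G_def H_def by (simp add: parcs_triangle)
  qed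
  ultimately have "G \<simeq> H" unfolding isomorphic_iff[OF wf[of t0 t1 t2, folded G_def] wf[of s0 s1 s2, folded H_def]]
    by (intro exI[of _ ?g]) blast
  then show ?thesis by (simp add: G_def H_def)
qed

lemma finite_is_vertex_spider: "finite {q. is_vertex (spider ks) q}"
proof -
  have "{q. is_vertex (spider ks) q} = {[]} \<union> (\<lambda>c. [c]) ` {..<length ks} \<union> 
      (\<lambda>(c, d). [c, d]) ` (SIGMA c:{..<length ks}. {..<ks ! c})"
    by (auto simp: is_vertex_spider)
  then show ?thesis by simp
qed

lemma spider_triangle_rooted:
  "rooted_triangle (spider_triangle k l m) (0, []) (1, []) (2, [])
     (\<lambda>(i, q). (i, butlast q)) (\<lambda>(i, q). length q)"
proof (rule rooted_triangle.intro)
  let ?G = "spider_triangle k l m"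
  note V = verts_triangle[of "spider k" "spider l" "spider m"]
  have "pverts ?G = (SIGMA i:{..<3}. {q. is_vertex ([spider k, spider l, spider m] ! i) q})"
    unfolding V by auto
  moreover have "finite {q. is_vertex ([spider k, spider l, spider m] ! i) q}" if "i < 3" for i
    using that finite_is_vertex_spider unfolding less_3 by auto
  ultimately show "finite (pverts ?G)" by (simp only:) (rule finite_SigmaI, auto)
  show "(0 :: nat, [] :: nat list) \<noteq> (1, [])" "(1 :: nat, [] :: nat list) \<noteq> (2, [])"
    "(0 :: nat, [] :: nat list) \<noteq> (2, [])" by auto
  show "{(0, []), (1, []), (2, [])} \<subseteq> pverts ?G" unfolding V by auto
  show "(case x of (i, q) \<Rightarrow> length q) = 0 \<longleftrightarrow> x \<in> {(0, []), (1, []), (2, [])}"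
    if "x \<in> pverts ?G" for x
    using that unfolding V less_3 by auto
  have butlast: "(i, butlast q) \<in> pverts ?G" if "(i, q) \<in> pverts ?G" for i q
    using that is_vertex_append[of _ "butlast q" "[last q]"] unfolding V by (cases "q = []") auto
  have root: "(i, q) \<in> pverts ?G - {(0, []), (1, []), (2, [])} \<longleftrightarrow> (i, q) \<in> pverts ?G \<and> q \<noteq> []" for i q
    unfolding V less_3 by auto
  show "(case x of (i, q) \<Rightarrow> (i, butlast q)) \<in> pverts ?G \<and>
      (case x of (i, q) \<Rightarrow> length q) = Suc (case (case x of (i, q) \<Rightarrow> (i, butlast q)) of (i, q) \<Rightarrow> length q)"
    if "x \<in> pverts ?G - {(0, []), (1, []), (2, [])}" for x
  proof -
    obtain i q where x: "x = (i, q)" by (cases x)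
    then have "(i, q) \<in> pverts ?G" "q \<noteq> []" using that root by blast+
    then show ?thesis using butlast[of i q] unfolding x by (simp add: Suc_le_eq)
  qed
  show "(x, y) \<in> parcs ?G \<longleftrightarrow> x \<in> {(0, []), (1, []), (2, [])} \<and> y \<in> {(0, []), (1, []), (2, [])} \<and> x \<noteq> y \<or>
      x \<in> pverts ?G - {(0, []), (1, []), (2, [])} \<and> y = (case x of (i, q) \<Rightarrow> (i, butlast q)) \<or>
      y \<in> pverts ?G - {(0, []), (1, []), (2, [])} \<and> x = (case y of (i, q) \<Rightarrow> (i, butlast q))" for x y
  proof -
    obtain i p j q where xy: "x = (i, p)" "y = (j, q)" by (cases x; cases y)
    have T: "(i', q') \<in> {(0, []), (1, []), (2, [])} \<longleftrightarrow> (i', q') \<in> pverts ?G \<and> q' = []" for i' q'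
      unfolding V less_3 by auto
    have ex: "(\<exists>c. q' = p' @ [c]) \<longleftrightarrow> q' \<noteq> [] \<and> p' = butlast q'" for p' q' :: "nat list"
      by (metis append_butlast_last_id butlast_snoc snoc_eq_iff_butlast)
    show ?thesis
      unfolding xy parcs_triangle root T ex using butlast by auto
  qed
qed

lemma sum_tree_verts_spider_triangle:
  fixes g :: "nat \<times> nat list \<Rightarrow> 'c :: comm_monoid_add"
  shows "(\<Sum>x\<in>pverts (spider_triangle k l m) - {(0, []), (1, []), (2, [])}. g x) =
    (\<Sum>i<3. \<Sum>c<length ([k, l, m] ! i). g (i, [c]) + (\<Sum>d<[k, l, m] ! i ! c. g (i, [c, d])))"
proof -
  define K where "K i = [k, l, m] ! i" for i
  have S: "[spider k, spider l, spider m] ! i = spider (K i)" if "i < 3" for i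
    using that unfolding less_3 by (auto simp: K_def)
  let ?A = "(\<lambda>(i, c). (i, [c])) ` (SIGMA i:{..<3}. {..<length (K i)})"
  let ?B = "(\<lambda>(i, c, d). (i, [c, d])) ` (SIGMA i:{..<3}. SIGMA c:{..<length (K i)}. {..<K i ! c})"
  have "pverts (spider_triangle k l m) - {(0, []), (1, []), (2, [])} = ?A \<union> ?B"
  proof (rule Set.set_eqI)
    fix x :: "nat \<times> nat list"
    obtain i q where x: "x = (i, q)" by (cases x)
    have "x \<in> pverts (spider_triangle k l m) - {(0, []), (1, []), (2, [])} \<longleftrightarrow>
        i < 3 \<and> is_vertex (spider (K i)) q \<and> q \<noteq> []"
      using S[of i] unfolding x verts_triangle by (auto simp: less_3)
    also have "\<dots> \<longleftrightarrow> i < 3 \<and> ((\<exists>c<length (K i). q = [c]) \<or> (\<exists>c<length (K i). \<exists>d<K i ! c. q = [c, d]))"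
      unfolding is_vertex_spider by auto
    also have "\<dots> \<longleftrightarrow> x \<in> ?A \<union> ?B"
    proof -
      have "x \<in> ?A \<longleftrightarrow> i < 3 \<and> (\<exists>c<length (K i). q = [c])" unfolding x by auto
      moreover have "x \<in> ?B \<longleftrightarrow> i < 3 \<and> (\<exists>c<length (K i). \<exists>d<K i ! c. q = [c, d])"
        unfolding x by (auto simp: image_iff)
      ultimately show ?thesis by blast
    qed
    finally show "x \<in> pverts (spider_triangle k l m) - {(0, []), (1, []), (2, [])} \<longleftrightarrow> x \<in> ?A \<union> ?B" .
  qed
  then have "(\<Sum>x\<in>pverts (spider_triangle k l m) - {(0, []), (1, []), (2, [])}. g x) = sum g ?A + sum g ?B"
    by (simp only:) (rule sum.union_disjoint, auto)
  also have "sum g ?A = (\<Sum>i<3. \<Sum>c<length (K i). g (i, [c]))"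
    by (subst sum.reindex) (auto simp: inj_on_def sum.Sigma case_prod_unfold)
  also have "sum g ?B = (\<Sum>i<3. \<Sum>c<length (K i). \<Sum>d<K i ! c. g (i, [c, d]))"
    by (subst sum.reindex) (auto simp: inj_on_def sum.Sigma case_prod_unfold)
  finally show ?thesis by (simp add: K_def sum.distrib)
qed

text \<open>
  The parent function determines all edges, so it is enough to respect it and the triangle.
\<close>

lemma rooted_triangle_isomorphic:
  fixes G :: "'a pair_pre_digraph" and H :: "'b pair_pre_digraph"
  assumes G: "rooted_triangle G a b c par lev" and H: "rooted_triangle H a' b' c' par' lev'"
    and g: "bij_betw g (pverts G) (pverts H)" "g a = a'" "g b = b'" "g c = c'"
    and par: "\<And>x. x \<in> pverts G - {a, b, c} \<Longrightarrow> g (par x) = par' (g x)"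
  shows "G \<simeq> H"
proof -
  interpret G: rooted_triangle G a b c par lev by (rule G)
  interpret H: rooted_triangle H a' b' c' par' lev' by (rule H)
  have inj: "g x = g y \<longleftrightarrow> x = y" if "x \<in> pverts G" "y \<in> pverts G" for x y
    using g(1) that by (auto simp: bij_betw_def inj_on_def)
  have im: "g x \<in> pverts H" if "x \<in> pverts G" for x
    using g(1) that by (auto simp: bij_betw_def)
  have T: "g x \<in> {a', b', c'} \<longleftrightarrow> x \<in> {a, b, c}" if x: "x \<in> pverts G" for x
  proof -
    have "a \<in> pverts G" "b \<in> pverts G" "c \<in> pverts G" using G.tri by auto
    then have "g x = a' \<longleftrightarrow> x = a" "g x = b' \<longleftrightarrow> x = b" "g x = c' \<longleftrightarrow> x = c"
      using inj[OF x] g(2-4) by metis+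
    then show ?thesis by simp
  qed
  have P: "g x \<in> pverts H - {a', b', c'} \<and> g y = par' (g x) \<longleftrightarrow> x \<in> pverts G - {a, b, c} \<and> y = par x"
    if "x \<in> pverts G" "y \<in> pverts G" for x y
  proof (cases "x \<in> {a, b, c}")
    case True
    then show ?thesis using T[OF that(1)] by blast
  next
    case False
    then have x: "x \<in> pverts G - {a, b, c}" using that by simp
    have "g y = par' (g x) \<longleftrightarrow> y = par x"
      using par[OF x] inj[OF that(2) G.par_in[OF x]] by metis
    moreover have "g x \<in> pverts H - {a', b', c'}" using T[OF that(1)] False im[OF that(1)] by blast
    ultimately show ?thesis using x by blast
  qed
  have "(x, y) \<in> parcs G \<longleftrightarrow> (g x, g y) \<in> parcs H" if "x \<in> pverts G" "y \<in> pverts G" for x y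
    unfolding G.arcs H.arcs T[OF that(1)] T[OF that(2)] P[OF that] P[OF that(2,1)] inj[OF that] ..
  moreover have "pair_wf_digraph G" "pair_wf_digraph H"
    using G.pair_graph H.pair_graph by (auto simp: pair_graph_def pair_digraph_def pair_fin_digraph_def)
  ultimately show ?thesis using g(1) isomorphic_iff by blast
qed

context rooted_triangle
begin

lemma kids_iff: "y \<in> kids x \<longleftrightarrow> y \<in> tree_verts \<and> par y = x"
  by (simp add: kids_def)

lemma finite_kids: "finite (kids x)"
  using fin by (simp add: kids_def)

text \<open>
  The isomorphism is built from the spiders to \<open>G\<close>: an address is read as a sequence of positions in
  fixed enumerations of the children. Injectivity follows because the parent of the image determines the address
  up to its last entry, surjectivity because no vertex has level above 2.
\<close>

lemma isomorphic_spider_triangle: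
  assumes depth: "\<And>x. x \<in> pverts G \<Longrightarrow> lev x \<le> 2"
    and cs: "\<And>v. v \<in> tri_verts \<Longrightarrow> distinct (cs v) \<and> set (cs v) = kids v"
  defines "legs \<equiv> \<lambda>v. map (\<lambda>y. card (kids y)) (cs v)"
  shows "G \<simeq> spider_triangle (legs a) (legs b) (legs c)"
proof -
  let ?H = "spider_triangle (legs a) (legs b) (legs c)"
  have "\<exists>ds. distinct ds \<and> set ds = kids y" for y
    using finite_distinct_list[OF finite_kids] by metis
  then obtain ds where ds: "\<And>y. distinct (ds y) \<and> set (ds y) = kids y" by metis
  define root where "root i = [a, b, c] ! i" for i
  define g where "g x = (case x of (i, q) \<Rightarrow> case q of [] \<Rightarrow> root i
    | k # r \<Rightarrow> (case r of [] \<Rightarrow> cs (root i) ! k | d # _ \<Rightarrow> ds (cs (root i) ! k) ! d))" for x :: "nat \<times> nat list"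
  have root: "root i \<in> tri_verts" if "i < 3" for i
    using that unfolding less_3 by (auto simp: root_def)
  have root_inj: "root i = root j \<longleftrightarrow> i = j" if "i < 3" "j < 3" for i j
  proof -
    have "root 0 = a" "root 1 = b" "root 2 = c" by (simp_all add: root_def)
    then show ?thesis using that dist unfolding less_3 by (elim disjE) simp_all
  qed
  have kid: "cs (root i) ! k \<in> kids (root i)" if "i < 3" "k < length (cs (root i))" for i k
    using conjunct2[OF cs[OF root[OF that(1)]]] nth_mem[OF that(2)] by (simp only:)
  have len: "length (ds y) = card (kids y)" for y
    using ds[of y] distinct_card by metis
  have gkid: "ds y ! d \<in> kids y" if "d < card (kids y)" for y d
    using ds[of y] that len[of y] nth_mem by metis
  have V: "(i, q) \<in> pverts ?H \<longleftrightarrow> i < 3 \<and> (q = [] \<or> (\<exists>k<length (cs (root i)). q = [k]) \<or>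
      (\<exists>k<length (cs (root i)). \<exists>d<card (kids (cs (root i) ! k)). q = [k, d]))" for i q
  proof -
    have S: "[spider (legs a), spider (legs b), spider (legs c)] ! i = spider (legs (root i))" if "i < 3"
      using that unfolding less_3 by (auto simp: root_def)
    have I: "is_vertex (spider (legs v)) q \<longleftrightarrow> q = [] \<or> (\<exists>k<length (cs v). q = [k]) \<or>
        (\<exists>k<length (cs v). \<exists>d<card (kids (cs v ! k)). q = [k, d])" for v
      by (simp add: is_vertex_spider legs_def cong: conj_cong)
    show ?thesis
    proof (cases "i < 3")
      case True
      then have "(i, q) \<in> pverts ?H \<longleftrightarrow> is_vertex (spider (legs (root i))) q"
        unfolding verts_triangle mem_Collect_eq prod.case S[OF True] by (simp only: simp_thms)
      then show ?thesis using True by (simp only: I simp_thms)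
    next
      case False
      then show ?thesis unfolding verts_triangle by (simp only: mem_Collect_eq prod.case simp_thms)
    qed
  qed
  have g_simps: "g (i, []) = root i" "g (i, [k]) = cs (root i) ! k" "g (i, [k, d]) = ds (cs (root i) ! k) ! d" for i k d
    by (simp_all add: g_def)
  have rootV: "root i \<in> pverts G" "lev (root i) = 0" if "i < 3" for i
    using root[OF that] tri lev_tri by auto
  have lev_kid: "lev y = Suc (lev x)" "y \<in> tree_verts" if "y \<in> kids x" for x y
    using that lev_par by (auto simp: kids_iff)
  have g: "g (i, q) \<in> pverts G \<and> lev (g (i, q)) = length q \<and> (q \<noteq> [] \<longrightarrow> par (g (i, q)) = g (i, butlast q))"
    if iq: "(i, q) \<in> pverts ?H" for i q
  proof -
    have i: "i < 3" using iq V by blast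
    consider "q = []" | k where "k < length (cs (root i))" "q = [k]"
      | k d where "k < length (cs (root i))" "d < card (kids (cs (root i) ! k))" "q = [k, d]"
      using iq V by blast
    then show ?thesis
    proof cases
      case 1
      then show ?thesis using rootV[OF i] by (simp add: g_simps)
    next
      case (2 k)
      note k = kid[OF i 2(1)]
      show ?thesis unfolding 2(2) using k lev_kid[OF k] rootV[OF i] by (simp add: g_simps kids_iff)
    next
      case (3 k d)
      note k = kid[OF i 3(1)]
      note d = gkid[OF 3(2)]
      show ?thesis unfolding 3(3) using k lev_kid[OF k] lev_kid[OF d] d rootV[OF i] by (simp add: g_simps kids_iff)
    qed
  qed
  have "inj_on g (pverts ?H)"
  proof (rule inj_onI)
    fix x y assume xy: "x \<in> pverts ?H" "y \<in> pverts ?H" "g x = g y"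
    obtain i q j r where e: "x = (i, q)" "y = (j, r)" by (cases x; cases y)
    have ij: "i < 3" "j < 3" using xy V unfolding e by blast+
    have key1: "i' = j' \<and> k = k'" if "i' < 3" "j' < 3" "k < length (cs (root i'))" "k' < length (cs (root j'))"
      "cs (root i') ! k = cs (root j') ! k'" for i' j' k k'
    proof -
      have "root i' = root j'" using kid[OF that(1,3)] kid[OF that(2,4)] that(5) by (simp add: kids_iff)
      then have "i' = j'" using root_inj that by simp
      then show ?thesis using cs[OF root[OF that(1)]] that nth_eq_iff_index_eq by metis
    qed
    have "length q = length r" using g xy unfolding e by metis
    moreover have "q = [] \<or> (\<exists>k<length (cs (root i)). q = [k]) \<or>
      (\<exists>k<length (cs (root i)). \<exists>d<card (kids (cs (root i) ! k)). q = [k, d])"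
      "r = [] \<or> (\<exists>k<length (cs (root j)). r = [k]) \<or>
      (\<exists>k<length (cs (root j)). \<exists>d<card (kids (cs (root j) ! k)). r = [k, d])"
      using xy V unfolding e by blast+
    ultimately consider "q = []" "r = []"
      | k k' where "k < length (cs (root i))" "k' < length (cs (root j))" "q = [k]" "r = [k']"
      | k d k' d' where "k < length (cs (root i))" "k' < length (cs (root j))"
         "d < card (kids (cs (root i) ! k))" "d' < card (kids (cs (root j) ! k'))" "q = [k, d]" "r = [k', d']"
      by fastforce
    then show "x = y"
    proof cases
      case 1
      then show ?thesis using xy(3) root_inj ij unfolding e by (simp add: g_simps)
    next
      case (2 k k')
      then show ?thesis using xy(3) key1 ij unfolding e by (simp add: g_simps)
    next
      case (3 k d k' d')
      have eq: "ds (cs (root i) ! k) ! d = ds (cs (root j) ! k') ! d'" using xy(3) 3 unfolding e by (simp add: g_simps)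
      then have "cs (root i) ! k = cs (root j) ! k'" using gkid[OF 3(3)] gkid[OF 3(4)] by (simp add: kids_iff)
      with key1[OF ij 3(1,2)] have ik: "i = j" "k = k'" by auto
      then have "d = d'" using eq ds len 3(3,4) nth_eq_iff_index_eq by metis
      then show ?thesis using ik 3 unfolding e by simp
    qed
  qed
  moreover have "g ` pverts ?H = pverts G"
  proof (intro Set.equalityI subsetI)
    fix y assume "y \<in> g ` pverts ?H"
    then show "y \<in> pverts G" using g by auto
  next
    fix y assume y: "y \<in> pverts G"
    have tri0: "\<exists>i<3. z = root i" if "z \<in> tri_verts" for z
    proof -
      have "root 0 = a" "root 1 = b" "root 2 = c" by (simp_all add: root_def)
      then show ?thesis using that by (metis empty_iff insert_iff less_3)
    qed
    have up0: "z \<in> tri_verts" if "z \<in> pverts G" "lev z = 0" for z using lev0 that by blast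
    have up1: "\<exists>i<3. \<exists>k<length (cs (root i)). z = cs (root i) ! k" if z: "z \<in> pverts G" "lev z = 1" for z
    proof -
      have zt: "z \<in> tree_verts" using z lev0[OF z(1)] by auto
      then have "par z \<in> tri_verts" using up0 par_in[OF zt] lev_par[OF zt] z by simp
      then obtain i where i: "i < 3" "par z = root i" using tri0 by blast
      then have "z \<in> set (cs (root i))" using cs[OF root[OF i(1)]] zt by (simp add: kids_iff)
      then show ?thesis using i(1) in_set_conv_nth by metis
    qed
    have "lev y = 0 \<or> lev y = 1 \<or> lev y = 2" using depth[OF y] by auto
    then show "y \<in> g ` pverts ?H"
    proof (elim disjE)
      assume "lev y = 0"
      then obtain i where "i < 3" "y = root i" using tri0 up0 y by blast
      then show ?thesis using V[of i "[]"] g_simps(1)[of i] by (metis imageI)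
    next
      assume "lev y = 1"
      then obtain i k where "i < 3" "k < length (cs (root i))" "y = cs (root i) ! k" using up1 y by blast
      then show ?thesis using V[of i "[k]"] g_simps(2)[of i k] by (metis imageI)
    next
      assume l: "lev y = 2"
      have yt: "y \<in> tree_verts" using y l lev0[OF y] by auto
      have "lev (par y) = 1" using lev_par[OF yt] l by simp
      then obtain i k where ik: "i < 3" "k < length (cs (root i))" "par y = cs (root i) ! k"
        using up1 par_in[OF yt] by blast
      have "y \<in> set (ds (par y))" using ds yt by (simp add: kids_iff)
      then obtain d where d: "d < length (ds (par y))" "y = ds (par y) ! d" using in_set_conv_nth by metis
      then show ?thesis using V[of i "[k, d]"] g_simps(3)[of i k d] ik len by (metis imageI)
    qed
  qed
  ultimately have bij: "bij_betw g (pverts ?H) (pverts G)" by (simp add: bij_betw_def)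
  interpret H: rooted_triangle ?H "(0, [])" "(1, [])" "(2, [])" "\<lambda>(i, q). (i, butlast q)" "\<lambda>(i, q). length q"
    by (rule spider_triangle_rooted)
  have iso: "?H \<simeq> G"
  proof (rule rooted_triangle_isomorphic[OF H.rooted_triangle_axioms rooted_triangle_axioms bij])
    show "g (0, []) = a" "g (1, []) = b" "g (2, []) = c" by (simp_all add: g_simps root_def)
    fix x assume x: "x \<in> pverts ?H - {(0, []), (1, []), (2, [])}"
    obtain i q where e: "x = (i, q)" by (cases x)
    have "(i, q) \<in> pverts ?H" "q \<noteq> []" using x V unfolding e less_3 by blast+
    then show "g (case x of (i, q) \<Rightarrow> (i, butlast q)) = par (g x)" using g unfolding e by simp
  qed
  have wf: "pair_wf_digraph G" "pair_wf_digraph ?H"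
    using pair_graph H.pair_graph by (auto simp: pair_graph_def pair_digraph_def pair_fin_digraph_def)
  show ?thesis by (rule isomorphic_sym[OF iso wf(2,1)])
qed

text \<open>
  Enumerating the children of each triangle vertex by increasing number of leaves puts the spiders
  into the form \<open>T(l\<^sub>0, l\<^sub>1, l\<^sub>2)\<close>.
\<close>

lemma isomorphic_tree_T_triangle:
  assumes depth: "\<And>x. x \<in> pverts G \<Longrightarrow> lev x \<le> 2"
    and kids: "\<And>x. x \<in> tree_verts \<Longrightarrow> card (kids x) \<le> 2"
  shows "\<exists>la lb lc. G \<simeq> cycle_with_trees [case la of (l0, l1, l2) \<Rightarrow> tree_T l0 l1 l2,
    case lb of (l0, l1, l2) \<Rightarrow> tree_T l0 l1 l2, case lc of (l0, l1, l2) \<Rightarrow> tree_T l0 l1 l2]"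
proof -
  have "\<exists>l. distinct l \<and> set l = {y \<in> kids v. card (kids y) = t}" for v t
  proof -
    have "finite {y \<in> kids v. card (kids y) = t}" using finite_kids[of v] by simp
    then show ?thesis using finite_distinct_list by metis
  qed
  then obtain L where L: "\<And>v t. distinct (L v t)" "\<And>v t. set (L v t) = {y \<in> kids v. card (kids y) = t}"
    by metis
  define cs where "cs v = L v 0 @ L v 1 @ L v 2" for v
  have "set (cs v) = kids v" for v
  proof -
    have "card (kids y) \<le> 2" if "y \<in> kids v" for y using kids that kids_iff by blast
    then show ?thesis by (fastforce simp: cs_def L)
  qed
  moreover have "distinct (cs v)" for v by (auto simp: cs_def L)
  ultimately have iso: "G \<simeq> spider_triangle (map (\<lambda>y. card (kids y)) (cs a)) (map (\<lambda>y. card (kids y)) (cs b))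
    (map (\<lambda>y. card (kids y)) (cs c))"
    by (intro isomorphic_spider_triangle depth) auto
  have const: "map (\<lambda>y. card (kids y)) (L v t) = replicate (length (L v t)) t" for v t
    by (rule replicate_eqI) (auto simp: L)
  have "map (\<lambda>y. card (kids y)) (cs v) = leg_list (length (L v 0)) (length (L v 1)) (length (L v 2))" for v
    unfolding cs_def map_append const leg_list_def ..
  then show ?thesis
    using iso unfolding tree_T_spider[symmetric]
    by (intro exI[of _ "(length (L a 0), length (L a 1), length (L a 2))"]
        exI[of _ "(length (L b 0), length (L b 1), length (L b 2))"]
        exI[of _ "(length (L c 0), length (L c 1), length (L c 2))"]) (simp add: tree_T_spider)
qed

end

section \<open>Completing squares along the legs\<close>

lemma qform_spider_triangle:
  fixes k l m :: "nat list"
  defines "K \<equiv> \<lambda>i. [k, l, m] ! i"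
  shows "qform \<mu> (spider_triangle k l m) f =
    (\<Sum>i<3. \<Sum>c<length (K i). edge_form \<mu> (f (i, [c])) (f (i, [])) +
       (\<Sum>d<K i ! c. edge_form \<mu> (f (i, [c, d])) (f (i, [c])))) +
    edge_form \<mu> (f (0, [])) (f (1, [])) + edge_form \<mu> (f (1, [])) (f (2, [])) +
    edge_form \<mu> (f (2, [])) (f (0, []))"
proof -
  interpret H: rooted_triangle "spider_triangle k l m" "(0, [])" "(1, [])" "(2, [])"
    "\<lambda>(i, q). (i, butlast q)" "\<lambda>(i, q). length q"
    by (rule spider_triangle_rooted)
  show ?thesis
    unfolding H.qform_eq sum_tree_verts_spider_triangle K_def by simp
qed

text \<open>
  The part of \<open>Q\<close> that belongs to one child of a triangle vertex: \<open>x\<close> is the value at the triangle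
  vertex, \<open>y\<close> at the child and \<open>z d\<close> at its \<open>t\<close> leaves.
\<close>

definition leg_form :: "nat \<Rightarrow> real \<Rightarrow> real \<Rightarrow> (nat \<Rightarrow> real) \<Rightarrow> real" where
  "leg_form t x y z = edge_form mu y x + (\<Sum>d<t. edge_form mu (z d) y)"

text \<open>
  The minimum of \<open>leg_form\<close> over \<open>z\<close> and, if \<open>t < 2\<close>, also over \<open>y\<close>. For \<open>t = 2\<close> the coefficient of \<open>y\<^sup>2\<close>
  vanishes after minimizing over \<open>z\<close>, and \<open>y\<close> remains as a free linear variable.
\<close>

definition leg_min :: "nat \<Rightarrow> real \<Rightarrow> real \<Rightarrow> real" where
  "leg_min t x y = (if t = 0 then - (mu / 2) * x\<^sup>2 else if t = 1 then - 2 * mu * x\<^sup>2 else mu * x\<^sup>2 - 2 * x * y)"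

text \<open>
  The value of \<open>y\<close> at which that minimum is attained; for \<open>t = 2\<close>, where \<open>y\<close> is free, \<open>y\<close> itself.
\<close>

definition leg_opt :: "nat \<Rightarrow> real \<Rightarrow> real \<Rightarrow> real" where
  "leg_opt t x y = (if t = 0 then 3 / 2 * mu * x else if t = 1 then 3 * mu * x else y)"

lemma leg_form_complete_squares:
  assumes "t \<le> 2"
  shows "leg_form t x y z = leg_min t x y + (if t = 0 then mu else if t = 1 then mu / 2 else 0) * (y - leg_opt t x y)\<^sup>2
    + (\<Sum>d<t. mu * (z d - 3 / 2 * mu * y)\<^sup>2)"
proof -
  define m where "m = mu"
  have m2: "m * m = 2 / 3" unfolding m_def by (rule mu_sq)
  have m3: "m * (m * (m * u)) = 2 / 3 * (m * u)" "m * (m * u) = 2 / 3 * u" for u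
    using m2 by (metis mult.assoc)+
  have sq: "edge_form m w y = m * (w - 3 / 2 * m * y)\<^sup>2 - m / 2 * y\<^sup>2" for w y
    unfolding edge_form_def power2_eq_square by (simp add: algebra_simps m3)
  note unf = leg_form_def leg_min_def leg_opt_def m_def[symmetric]
  have "t = 0 \<or> t = 1 \<or> t = 2" using assms by auto
  then show ?thesis
  proof (elim disjE)
    assume "t = 0"
    then show ?thesis unfolding unf using sq[of y x] by simp
  next
    assume t: "t = 1"
    have "edge_form m y x - m / 2 * y\<^sup>2 = - 2 * m * x\<^sup>2 + m / 2 * (y - 3 * m * x)\<^sup>2"
      unfolding edge_form_def power2_eq_square by (simp add: algebra_simps m3)
    then show ?thesis unfolding unf using sq[of "z 0" y] by (simp add: t)
  next
    assume t: "t = 2"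
    have "edge_form m y x - m * y\<^sup>2 = m * x\<^sup>2 - 2 * x * y"
      unfolding edge_form_def power2_eq_square by (simp add: algebra_simps)
    then show ?thesis unfolding unf using sq[of "z 0" y] sq[of "z 1" y] by (simp add: t numeral_2_eq_2)
  qed
qed

lemma length_leg_list: "length (leg_list l0 l1 l2) = l0 + l1 + l2"
  by (simp add: leg_list_def)

lemma leg_list_nth:
  "c < l0 + l1 + l2 \<Longrightarrow> leg_list l0 l1 l2 ! c = (if c < l0 then 0 else if c < l0 + l1 then 1 else 2)"
  by (auto simp: leg_list_def nth_append)

lemma leg_list_le: "c < l0 + l1 + l2 \<Longrightarrow> leg_list l0 l1 l2 ! c \<le> 2"
  by (simp add: leg_list_nth)

lemma sum_leg_min:
  "(\<Sum>c<l0 + l1 + l2. leg_min (leg_list l0 l1 l2 ! c) x (y c)) =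
     mu * (real l2 - real l0 / 2 - 2 * real l1) * x\<^sup>2 - 2 * x * (\<Sum>c\<in>{l0 + l1..<l0 + l1 + l2}. y c)"
proof -
  have split: "{..<l0 + l1 + l2} = {..<l0} \<union> ({l0..<l0 + l1} \<union> {l0 + l1..<l0 + l1 + l2})" by auto
  have "(\<Sum>c<l0 + l1 + l2. leg_min (leg_list l0 l1 l2 ! c) x (y c)) =
      (\<Sum>c<l0. leg_min (leg_list l0 l1 l2 ! c) x (y c)) +
      ((\<Sum>c\<in>{l0..<l0 + l1}. leg_min (leg_list l0 l1 l2 ! c) x (y c)) +
      (\<Sum>c\<in>{l0 + l1..<l0 + l1 + l2}. leg_min (leg_list l0 l1 l2 ! c) x (y c)))"
    unfolding split by (subst sum.union_disjoint, simp, simp, force)+ simp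
  also have "(\<Sum>c<l0. leg_min (leg_list l0 l1 l2 ! c) x (y c)) = (\<Sum>c<l0. - (mu / 2) * x\<^sup>2)"
    by (intro sum.cong) (auto simp: leg_list_nth leg_min_def)
  also have "(\<Sum>c\<in>{l0..<l0 + l1}. leg_min (leg_list l0 l1 l2 ! c) x (y c)) = (\<Sum>c\<in>{l0..<l0 + l1}. - 2 * mu * x\<^sup>2)"
    by (intro sum.cong) (auto simp: leg_list_nth leg_min_def)
  also have "(\<Sum>c\<in>{l0 + l1..<l0 + l1 + l2}. leg_min (leg_list l0 l1 l2 ! c) x (y c)) =
      (\<Sum>c\<in>{l0 + l1..<l0 + l1 + l2}. mu * x\<^sup>2 - 2 * x * y c)"
    by (intro sum.cong) (auto simp: leg_list_nth leg_min_def)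
  finally show ?thesis
    by (simp add: sum_subtractf sum_distrib_left algebra_simps)
qed

text \<open>
  The quadratic form that is left after minimization, in six variables: \<open>v i\<close> is the value at the \<open>i\<close>-th
  triangle vertex and \<open>v (3 + i)\<close> the sum of the values at those of its children that have two leaves.
  The individual values enter only through this sum.
\<close>

definition reduced_form :: "(nat \<Rightarrow> real) \<Rightarrow> (nat \<Rightarrow> real) \<Rightarrow> real" where
  "reduced_form p v = (\<Sum>i<3. p i * (v i)\<^sup>2 - 2 * v i * v (3 + i)) - 2 * (v 0 * v 1 + v 1 * v 2 + v 2 * v 0)"

lemma reduced_form_expand:
  "reduced_form p v = p 0 * (v 0)\<^sup>2 + p 1 * (v 1)\<^sup>2 + p 2 * (v 2)\<^sup>2
     - 2 * v 0 * v 3 - 2 * v 1 * v 4 - 2 * v 2 * v 5 - 2 * (v 0 * v 1 + v 1 * v 2 + v 2 * v 0)"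
  by (simp add: reduced_form_def eval_nat_numeral)

text \<open>
  The graph \<open>C\<^sub>3(T(l\<^sub>0, l\<^sub>1, l\<^sub>2), \<dots>)\<close>, where \<open>l0 i\<close>, \<open>l1 i\<close>, \<open>l2 i\<close> are the parameters of the tree at the
  triangle vertex \<open>i < 3\<close>. In this locale, \<open>weight i\<close> is the diagonal entry of this vertex in the reduced form,
  \<open>long i\<close> indexes its children with two leaves, and \<open>extension\<close> prolongs values on these vertices by the
  minimizing values at all others.
\<close>

locale leg_triangle =
  fixes l0 l1 l2 :: "nat \<Rightarrow> nat"
begin

definition "legs i = leg_list (l0 i) (l1 i) (l2 i)"
definition "tgraph = spider_triangle (legs 0) (legs 1) (legs 2)"
definition "weight i = mu * (2 + real (l2 i) - real (l0 i) / 2 - 2 * real (l1 i))"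
definition "long i = {l0 i + l1 i..<l0 i + l1 i + l2 i}"
definition "coords f j = (if j < 3 then f (j, []) else \<Sum>c\<in>long (j - 3). f (j - 3, [c]))"
  for f :: "nat \<times> nat list \<Rightarrow> real" and j :: nat
definition "extension v y x = (case x of (i, q) \<Rightarrow> (case q of [] \<Rightarrow> v i
    | c # r \<Rightarrow> (case r of [] \<Rightarrow> leg_opt (legs i ! c) (v i) (y i c)
    | _ \<Rightarrow> 3 / 2 * mu * leg_opt (legs i ! c) (v i) (y i c))))"
  for v :: "nat \<Rightarrow> real" and y :: "nat \<Rightarrow> nat \<Rightarrow> real" and x :: "nat \<times> nat list"

sublocale rooted_triangle tgraph "(0, [])" "(1, [])" "(2, [])"
    "\<lambda>(i, q). (i, butlast q)" "\<lambda>(i, q). length q"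
  unfolding tgraph_def by (rule spider_triangle_rooted)

lemma length_legs: "length (legs i) = l0 i + l1 i + l2 i"
  by (simp add: legs_def length_leg_list)

lemma legs_le: "c < l0 i + l1 i + l2 i \<Longrightarrow> legs i ! c \<le> 2"
  by (simp add: legs_def leg_list_le)

lemma legs_long: "c < l0 i + l1 i + l2 i \<Longrightarrow> c \<in> long i \<longleftrightarrow> legs i ! c = 2"
  by (auto simp: legs_def leg_list_nth long_def)

lemma nth_legs: "i < 3 \<Longrightarrow> [legs 0, legs 1, legs 2] ! i = legs i"
  unfolding less_3 by auto

lemma verts: "(i, q) \<in> pverts tgraph \<longleftrightarrow> i < 3 \<and> (q = [] \<or> (\<exists>c<l0 i + l1 i + l2 i. q = [c]) \<or>
   (\<exists>c<l0 i + l1 i + l2 i. \<exists>d<legs i ! c. q = [c, d]))"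
proof -
  have "[spider (legs 0), spider (legs 1), spider (legs 2)] ! i = spider (legs i)" if "i < 3"
    using that unfolding less_3 by auto
  then show ?thesis unfolding tgraph_def verts_triangle
    by (auto simp: is_vertex_spider length_legs)
qed

lemma form:
  "qform mu tgraph f = (\<Sum>i<3. \<Sum>c<l0 i + l1 i + l2 i.
      leg_form (legs i ! c) (f (i, [])) (f (i, [c])) (\<lambda>d. f (i, [c, d]))) +
    edge_form mu (f (0, [])) (f (1, [])) + edge_form mu (f (1, [])) (f (2, [])) +
    edge_form mu (f (2, [])) (f (0, []))"
proof -
  have "(\<Sum>i<3. \<Sum>c<length ([legs 0, legs 1, legs 2] ! i). edge_form mu (f (i, [c])) (f (i, [])) +
       (\<Sum>d<[legs 0, legs 1, legs 2] ! i ! c. edge_form mu (f (i, [c, d])) (f (i, [c])))) =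
    (\<Sum>i<3. \<Sum>c<l0 i + l1 i + l2 i. leg_form (legs i ! c) (f (i, [])) (f (i, [c])) (\<lambda>d. f (i, [c, d])))"
    by (rule sum.cong[OF refl]) (simp only: lessThan_iff nth_legs length_legs leg_form_def)
  then show ?thesis
    unfolding tgraph_def qform_spider_triangle by (simp only:)
qed

lemma reduced:
  "(\<Sum>i<3. \<Sum>c<l0 i + l1 i + l2 i. leg_min (legs i ! c) (f (i, [])) (f (i, [c]))) +
    edge_form mu (f (0, [])) (f (1, [])) + edge_form mu (f (1, [])) (f (2, [])) +
    edge_form mu (f (2, [])) (f (0, [])) = reduced_form weight (coords f)"
proof -
  define m where "m = mu"
  have num: "{..<3 :: nat} = {0, 1, 2}" by auto
  show ?thesis
    unfolding legs_def sum_leg_min reduced_form_def num coords_def weight_def long_def edge_form_def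
      m_def[symmetric]
    by (simp add: algebra_simps power2_eq_square)
qed

lemma leg_ge: "t \<le> 2 \<Longrightarrow> leg_min t x y \<le> leg_form t x y z"
  using mu_bounds by (simp add: leg_form_complete_squares sum_nonneg)

lemma reduced_le: "reduced_form weight (coords f) \<le> qform mu tgraph f"
  unfolding reduced[symmetric] form
  by (intro add_right_mono sum_mono leg_ge legs_le) auto

lemma reduced_extension:
  "qform mu tgraph (extension v y) = reduced_form weight (coords (extension v y))"
proof -
  have "leg_form t x (leg_opt t x u) (\<lambda>d. 3 / 2 * mu * leg_opt t x u) = leg_min t x (leg_opt t x u)"
    if "t \<le> 2" for t x u
    using that by (simp add: leg_form_complete_squares leg_opt_def)
  then show ?thesis
    unfolding reduced[symmetric] form
    by (auto simp: extension_def legs_le intro!: sum.cong)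
qed

lemma extension_linear:
  "extension (\<lambda>j. \<alpha> * v j + \<beta> * w j) (\<lambda>i c. \<alpha> * y i c + \<beta> * z i c) x = \<alpha> * extension v y x + \<beta> * extension w z x"
  by (auto simp: extension_def leg_opt_def algebra_simps split: prod.split list.split)

lemma coords_linear: "coords (\<lambda>x. \<alpha> * f x + \<beta> * g x) j = \<alpha> * coords f j + \<beta> * coords g j"
  by (simp add: coords_def sum.distrib sum_distrib_left)

lemma coords_extension:
  "coords (extension v y) j = (if j < 3 then v j else \<Sum>c\<in>long (j - 3). y (j - 3) c)"
proof -
  have "leg_opt (legs i ! c) (v i) (y i c) = y i c" if "c \<in> long i" for i c
    using that legs_long[of c i] by (auto simp: leg_opt_def long_def)
  then show ?thesis by (auto simp: coords_def extension_def intro!: sum.cong)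
qed

text \<open>
  If minimization gains nothing, all the completed squares vanish, so a function that is zero at the vertices
  kept by the reduction is zero everywhere.
\<close>

lemma reduced_eq_zero:
  assumes le: "qform mu tgraph f \<le> reduced_form weight (coords f)"
    and roots: "\<And>i. i < 3 \<Longrightarrow> f (i, []) = 0" and long: "\<And>i c. i < 3 \<Longrightarrow> c \<in> long i \<Longrightarrow> f (i, [c]) = 0"
  shows "\<forall>x\<in>pverts tgraph. f x = 0"
proof -
  let ?F = "\<lambda>i c. leg_form (legs i ! c) (f (i, [])) (f (i, [c])) (\<lambda>d. f (i, [c, d]))"
  let ?M = "\<lambda>i c. leg_min (legs i ! c) (f (i, [])) (f (i, [c]))"
  have "(\<Sum>i<3. \<Sum>c<l0 i + l1 i + l2 i. ?F i c - ?M i c) \<le> 0"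
    using le unfolding reduced[symmetric] form by (simp add: sum_subtractf)
  moreover have nn: "?F i c - ?M i c \<ge> 0" if "c < l0 i + l1 i + l2 i" for i c
    using leg_ge[OF legs_le[OF that]] by simp
  ultimately have "(\<Sum>i<3. \<Sum>c<l0 i + l1 i + l2 i. ?F i c - ?M i c) = 0"
    by (intro antisym sum_nonneg) auto
  moreover have inner_nn: "(\<Sum>c<l0 i + l1 i + l2 i. ?F i c - ?M i c) \<ge> 0" for i
    by (rule sum_nonneg) (simp only: lessThan_iff nn)
  ultimately have "\<forall>i\<in>{..<3}. (\<Sum>c<l0 i + l1 i + l2 i. ?F i c - ?M i c) = 0"
    by (subst (asm) sum_nonneg_eq_0_iff) simp_all
  then have inner: "(\<Sum>c<l0 i + l1 i + l2 i. ?F i c - ?M i c) = 0" if "i < 3" for i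
    using that by simp
  have zero: "?F i c - ?M i c = 0" if "i < 3" "c < l0 i + l1 i + l2 i" for i c
  proof -
    have "\<forall>c\<in>{..<l0 i + l1 i + l2 i}. ?F i c - ?M i c = 0"
      by (rule iffD1[OF sum_nonneg_eq_0_iff inner[OF that(1)]]) (simp_all only: finite_lessThan lessThan_iff nn)
    then show ?thesis using that(2) by simp
  qed
  have leg: "f (i, [c]) = 0 \<and> (\<forall>d<legs i ! c. f (i, [c, d]) = 0)" if i: "i < 3" and c: "c < l0 i + l1 i + l2 i" for i c
  proof -
    let ?t = "legs i ! c"
    have t: "?t \<le> 2" by (rule legs_le[OF c])
    let ?k = "if ?t = 0 then mu else if ?t = 1 then mu / 2 else 0"
    have sq: "?k * (f (i, [c]) - leg_opt ?t 0 (f (i, [c])))\<^sup>2 + (\<Sum>d<?t. mu * (f (i, [c, d]) - 3 / 2 * mu * f (i, [c]))\<^sup>2) = 0"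
      using zero[OF i c] unfolding leg_form_complete_squares[OF t] roots[OF i] by simp
    have 1: "?k * (f (i, [c]) - leg_opt ?t 0 (f (i, [c])))\<^sup>2 \<ge> 0"
      using mu_bounds by simp
    have 2: "(\<Sum>d<?t. mu * (f (i, [c, d]) - 3 / 2 * mu * f (i, [c]))\<^sup>2) \<ge> 0"
      by (intro sum_nonneg) simp
    have k0: "?k * (f (i, [c]) - leg_opt ?t 0 (f (i, [c])))\<^sup>2 = 0" using sq 1 2 by linarith
    have s0: "(\<Sum>d<?t. mu * (f (i, [c, d]) - 3 / 2 * mu * f (i, [c]))\<^sup>2) = 0" using sq 1 2 by linarith
    have y: "f (i, [c]) = 0"
    proof (cases "?t = 2")
      case True
      then show ?thesis using long[OF i] legs_long[OF c] by simp
    next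
      case False
      then have "?t = 0 \<or> ?t = 1" using t by auto
      then show ?thesis using k0 by (auto simp: leg_opt_def)
    qed
    have "\<forall>d\<in>{..<?t}. mu * (f (i, [c, d]) - 3 / 2 * mu * f (i, [c]))\<^sup>2 = 0"
      using s0 by (subst (asm) sum_nonneg_eq_0_iff) auto
    then show ?thesis using y by auto
  qed
  show ?thesis
  proof
    fix x assume x: "x \<in> pverts tgraph"
    obtain i q where e: "x = (i, q)" by (cases x)
    from x[unfolded e verts] show "f x = 0" unfolding e using roots leg by blast
  qed
qed

end

lemma reduced_form_cong: "(\<And>k. k < 6 \<Longrightarrow> v k = w k) \<Longrightarrow> reduced_form p v = reduced_form p w"
  by (simp add: reduced_form_expand)

context leg_triangle
begin

text \<open>
  Without children that have two leaves, the sum of the values at them is zero.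
\<close>

definition "admissible v \<longleftrightarrow> (\<forall>i<3. l2 i = 0 \<longrightarrow> v (3 + i) = 0)" for v :: "nat \<Rightarrow> real"

lemma admissible_coords: "admissible (coords f)"
  by (simp add: admissible_def coords_def long_def)

definition "lift_coords v = extension v (\<lambda>i c. if c = l0 i + l1 i then v (3 + i) else 0)" for v :: "nat \<Rightarrow> real"

lemma coords_lift:
  assumes "admissible v" "k < 6"
  shows "coords (lift_coords v) k = v k"
proof (cases "k < 3")
  case True
  then show ?thesis by (simp add: lift_coords_def coords_extension)
next
  case False
  define i where "i = k - 3"
  have k: "k = 3 + i" "i < 3" using False assms(2) by (auto simp: i_def)
  show ?thesis
  proof (cases "l2 i = 0")
    case True
    then show ?thesis using assms(1) k by (simp add: lift_coords_def coords_extension long_def admissible_def)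
  next
    case False
    then have "l0 i + l1 i \<in> long i" by (simp add: long_def)
    then show ?thesis using k by (simp add: lift_coords_def coords_extension long_def)
  qed
qed

lemma lift_linear:
  "(\<lambda>x. \<alpha> * lift_coords v x + \<beta> * lift_coords w x) = lift_coords (\<lambda>k. \<alpha> * v k + \<beta> * w k)"
proof
  fix x
  have "(\<lambda>i c. if c = l0 i + l1 i then \<alpha> * v (3 + i) + \<beta> * w (3 + i) else 0) =
    (\<lambda>i c. \<alpha> * (if c = l0 i + l1 i then v (3 + i) else 0) + \<beta> * (if c = l0 i + l1 i then w (3 + i) else 0))"
    by (auto simp: fun_eq_iff)
  then show "\<alpha> * lift_coords v x + \<beta> * lift_coords w x = lift_coords (\<lambda>k. \<alpha> * v k + \<beta> * w k) x"
    unfolding lift_coords_def by (simp only: extension_linear)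
qed

lemma admissible_linear: "admissible v \<Longrightarrow> admissible w \<Longrightarrow> admissible (\<lambda>k. \<alpha> * v k + \<beta> * w k)"
  by (simp add: admissible_def)

lemma qform_lift:
  assumes "admissible v"
  shows "qform mu tgraph (lift_coords v) = reduced_form weight v"
proof -
  have "qform mu tgraph (lift_coords v) = reduced_form weight (coords (lift_coords v))"
    unfolding lift_coords_def by (rule reduced_extension)
  also have "\<dots> = reduced_form weight v"
    by (rule reduced_form_cong) (rule coords_lift[OF assms])
  finally show ?thesis .
qed

text \<open>
  Passing to coordinates can only decrease the form, which gives one direction; minimizing extensions
  give the other one.
\<close>

lemma negative_plane_reduced:
  "negative_plane mu tgraph \<longleftrightarrow> (\<exists>v w. admissible v \<and> admissible w \<and>
     (\<forall>\<alpha> \<beta>. (\<alpha>, \<beta>) \<noteq> (0, 0) \<longrightarrow> reduced_form weight (\<lambda>k. \<alpha> * v k + \<beta> * w k) < 0))"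
proof
  assume "negative_plane mu tgraph"
  then obtain f g where fg: "\<And>\<alpha> \<beta>. (\<alpha>, \<beta>) \<noteq> (0, 0) \<Longrightarrow> qform mu tgraph (\<lambda>v. \<alpha> * f v + \<beta> * g v) < 0"
    unfolding negative_plane_def by blast
  have "reduced_form weight (\<lambda>k. \<alpha> * coords f k + \<beta> * coords g k) < 0" if "(\<alpha>, \<beta>) \<noteq> (0, 0)" for \<alpha> \<beta>
    using reduced_le[of "\<lambda>v. \<alpha> * f v + \<beta> * g v"] fg[OF that] unfolding coords_linear by linarith
  then show "\<exists>v w. admissible v \<and> admissible w \<and>
     (\<forall>\<alpha> \<beta>. (\<alpha>, \<beta>) \<noteq> (0, 0) \<longrightarrow> reduced_form weight (\<lambda>k. \<alpha> * v k + \<beta> * w k) < 0)"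
    using admissible_coords by blast
next
  assume "\<exists>v w. admissible v \<and> admissible w \<and>
     (\<forall>\<alpha> \<beta>. (\<alpha>, \<beta>) \<noteq> (0, 0) \<longrightarrow> reduced_form weight (\<lambda>k. \<alpha> * v k + \<beta> * w k) < 0)"
  then obtain v w where vw: "admissible v" "admissible w"
    "\<And>\<alpha> \<beta>. (\<alpha>, \<beta>) \<noteq> (0, 0) \<Longrightarrow> reduced_form weight (\<lambda>k. \<alpha> * v k + \<beta> * w k) < 0" by blast
  show "negative_plane mu tgraph" unfolding negative_plane_def
    by (rule exI[of _ "lift_coords v"], rule exI[of _ "lift_coords w"])
      (simp only: lift_linear qform_lift[OF admissible_linear[OF vw(1,2)]], use vw(3) in blast)
qed

lemma root_in: "i < 3 \<Longrightarrow> (i, []) \<in> pverts tgraph"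
  by (simp add: verts)

lemma long_in: "i < 3 \<Longrightarrow> c \<in> long i \<Longrightarrow> (i, [c]) \<in> pverts tgraph"
  by (simp add: verts long_def)

lemma coords_zero:
  assumes "\<And>x. x \<in> pverts tgraph \<Longrightarrow> f x = 0" "k < 6"
  shows "coords f k = 0"
proof (cases "k < 3")
  case True
  then show ?thesis using assms(1)[OF root_in] by (simp add: coords_def)
next
  case False
  then have "k - 3 < 3" using assms(2) by simp
  then show ?thesis using False assms(1)[OF long_in] by (simp add: coords_def)
qed

lemma nonpositive_plane_reducedI:
  assumes "admissible v" "admissible w"
    and le: "\<And>\<alpha> \<beta>. reduced_form weight (\<lambda>k. \<alpha> * v k + \<beta> * w k) \<le> 0"
    and ind: "\<And>\<alpha> \<beta>. (\<alpha>, \<beta>) \<noteq> (0, 0) \<Longrightarrow> \<exists>k<6. \<alpha> * v k + \<beta> * w k \<noteq> 0"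
  shows "nonpositive_plane mu tgraph"
  unfolding nonpositive_plane_def
proof (rule exI[of _ "lift_coords v"], rule exI[of _ "lift_coords w"], intro conjI allI impI)
  fix \<alpha> \<beta> :: real
  note adm = admissible_linear[OF assms(1,2), of \<alpha> \<beta>]
  show "qform mu tgraph (\<lambda>x. \<alpha> * lift_coords v x + \<beta> * lift_coords w x) \<le> 0"
    unfolding lift_linear qform_lift[OF adm] by (rule le)
  assume "(\<alpha>, \<beta>) \<noteq> (0, 0)"
  then obtain k where k: "k < 6" "\<alpha> * v k + \<beta> * w k \<noteq> 0" using ind by blast
  show "\<exists>x\<in>pverts tgraph. \<alpha> * lift_coords v x + \<beta> * lift_coords w x \<noteq> 0"
  proof (rule ccontr)
    assume "\<not> ?thesis"
    then have "\<And>x. x \<in> pverts tgraph \<Longrightarrow> lift_coords (\<lambda>k. \<alpha> * v k + \<beta> * w k) x = 0"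
      unfolding lift_linear[symmetric] by blast
    from coords_zero[OF this k(1)] show False using coords_lift[OF adm k(1)] k(2) by simp
  qed
qed

text \<open>
  With at most one child of the kind in question per triangle vertex, its value is recovered from the coordinates;
  with two of them, a function with opposite values there has zero coordinates, and the statement fails.
\<close>

lemma nonpositive_plane_reducedD:
  assumes "nonpositive_plane mu tgraph" and l2: "\<And>i. i < 3 \<Longrightarrow> l2 i \<le> 1"
  obtains v w where "admissible v" "admissible w"
    "\<And>\<alpha> \<beta>. reduced_form weight (\<lambda>k. \<alpha> * v k + \<beta> * w k) \<le> 0"
    "\<And>\<alpha> \<beta>. (\<alpha>, \<beta>) \<noteq> (0, 0) \<Longrightarrow> \<exists>k<6. \<alpha> * v k + \<beta> * w k \<noteq> 0"
proof -
  obtain f g where fg: "\<And>\<alpha> \<beta>. qform mu tgraph (\<lambda>v. \<alpha> * f v + \<beta> * g v) \<le> 0"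
    "\<And>\<alpha> \<beta>. (\<alpha>, \<beta>) \<noteq> (0, 0) \<Longrightarrow> \<exists>v\<in>pverts tgraph. \<alpha> * f v + \<beta> * g v \<noteq> 0"
    using assms(1) unfolding nonpositive_plane_def by blast
  show thesis
  proof (rule that[of "coords f" "coords g", OF admissible_coords admissible_coords])
    show "reduced_form weight (\<lambda>k. \<alpha> * coords f k + \<beta> * coords g k) \<le> 0" for \<alpha> \<beta>
      using reduced_le[of "\<lambda>v. \<alpha> * f v + \<beta> * g v"] fg(1)[of \<alpha> \<beta>] unfolding coords_linear by linarith
    fix \<alpha> \<beta> :: real assume nz: "(\<alpha>, \<beta>) \<noteq> (0, 0)"
    show "\<exists>k<6. \<alpha> * coords f k + \<beta> * coords g k \<noteq> 0"
    proof (rule ccontr)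
      assume none: "\<not> ?thesis"
      define F where "F x = \<alpha> * f x + \<beta> * g x" for x
      have z: "coords F k = 0" if "k < 6" for k
        using none that unfolding F_def coords_linear by blast
      have roots: "F (i, []) = 0" if "i < 3" for i
        using z[of i] that by (simp add: coords_def)
      have longs: "F (i, [c]) = 0" if i: "i < 3" and c: "c \<in> long i" for i c
      proof -
        have "long i = {c}" using l2[OF i] c by (auto simp: long_def)
        then show ?thesis using z[of "3 + i"] i by (simp add: coords_def)
      qed
      have "reduced_form weight (coords F) = 0" using z by (simp add: reduced_form_expand)
      then have "qform mu tgraph F \<le> reduced_form weight (coords F)" using fg(1) unfolding F_def by simp
      from reduced_eq_zero[OF this roots longs] have "\<forall>x\<in>pverts tgraph. F x = 0" by simp
      then show False using fg(2)[OF nz] unfolding F_def by blast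
    qed
  qed
qed

text \<open>
  The function with values \<open>1\<close> and \<open>-1\<close> at two children with two leaves each, continued to these leaves, lies in
  the radical of \<open>Q\<close>. It is combined with a function that has value \<open>1\<close> at the triangle vertex and a large
  value \<open>K\<close> at one of the children.
\<close>

lemma nonpositive_plane_two_long:
  assumes "i < 3" "l2 i \<ge> 2"
  shows "nonpositive_plane mu tgraph"
proof -
  define c where "c = l0 i + l1 i"
  define y where "y j k = (if j = i \<and> k = c then 1 else if j = i \<and> k = Suc c then -1 else 0 :: real)" for j k
  define v where "v j = (if j = i then 1 else 0 :: real)" for j
  define K where "K = \<bar>weight i\<bar>"
  define z where "z j k = (if j = i \<and> k = c then K else 0)" for j k
  have cl: "c \<in> long i" "Suc c \<in> long i" using assms(2) by (auto simp: c_def long_def)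
  have fl: "finite (long j)" for j by (simp add: long_def)
  have sy: "(\<Sum>k\<in>long j. y j k) = 0" for j
  proof (cases "j = i")
    case True
    have "(\<Sum>k\<in>long i. y i k) = (\<Sum>k\<in>{c, Suc c}. y i k)"
      by (rule sum.mono_neutral_right) (use cl fl in \<open>auto simp: y_def\<close>)
    then show ?thesis using True by (simp add: y_def)
  qed (simp add: y_def)
  have sz: "(\<Sum>k\<in>long j. z j k) = (if j = i then K else 0)" for j
    using cl fl by (simp add: z_def)
  define f where "f = extension (\<lambda>_. 0) y"
  define g where "g = extension v z"
  have comb: "(\<lambda>x. \<alpha> * f x + \<beta> * g x) = extension (\<lambda>j. \<beta> * v j) (\<lambda>j k. \<alpha> * y j k + \<beta> * z j k)" for \<alpha> \<beta>
    unfolding f_def g_def by (rule ext) (simp add: extension_linear[symmetric])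
  have "qform mu tgraph (\<lambda>x. \<alpha> * f x + \<beta> * g x) \<le> 0" for \<alpha> \<beta>
  proof -
    have "qform mu tgraph (\<lambda>x. \<alpha> * f x + \<beta> * g x) =
      reduced_form weight (\<lambda>j. if j < 3 then \<beta> * v j else if j - 3 = i then \<beta> * K else 0)"
      unfolding comb reduced_extension coords_extension sum.distrib
      by (rule arg_cong[of _ _ "reduced_form weight"]) (auto simp: fun_eq_iff sy sz simp flip: sum_distrib_left)
    also have "\<dots> = (weight i - 2 * K) * \<beta>\<^sup>2"
      using assms(1) unfolding less_3
      by (elim disjE) (simp_all add: reduced_form_expand v_def algebra_simps power2_eq_square)
    also have "\<dots> \<le> 0" by (intro mult_nonpos_nonneg) (auto simp: K_def)
    finally show ?thesis .
  qed
  moreover have "\<exists>x\<in>pverts tgraph. \<alpha> * f x + \<beta> * g x \<noteq> 0" if "(\<alpha>, \<beta>) \<noteq> (0, 0)" for \<alpha> \<beta>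
  proof (cases "\<beta> = 0")
    case True
    have "legs i ! c = 2" using legs_long[of c i] cl assms(2) by (simp add: c_def)
    then have "f (i, [c]) = 1" by (simp add: f_def extension_def leg_opt_def y_def)
    then show ?thesis using True that long_in[OF assms(1) cl(1)] by (intro bexI[of _ "(i, [c])"]) auto
  next
    case False
    have "f (i, []) = 0" "g (i, []) = 1" by (simp_all add: f_def g_def extension_def v_def)
    then show ?thesis using False root_in[OF assms(1)] by (intro bexI[of _ "(i, [])"]) auto
  qed
  ultimately show ?thesis unfolding nonpositive_plane_def by blast
qed

end

section \<open>The inertia of the reduced form\<close>

lemma binary_form_takes_negative:
  fixes p q m :: real
  assumes "\<not> (p \<ge> 0 \<and> q \<ge> 0 \<and> p * q \<ge> m\<^sup>2)"
  obtains x y where "p * x\<^sup>2 + q * y\<^sup>2 - 2 * m * x * y < 0"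
proof -
  consider "p < 0" | "q < 0" | "p = 0" "m \<noteq> 0" | "p > 0" "p * q < m\<^sup>2"
    using assms by fastforce
  then show thesis
  proof cases
    case 1
    then show thesis using that[of 1 0] by simp
  next
    case 2
    then show thesis using that[of 0 1] by simp
  next
    case 3
    then show thesis using that[of "(q + 1) / (2 * m)" 1] by simp
  next
    case 4
    have "p * m\<^sup>2 + q * p\<^sup>2 - 2 * m * m * p = p * (p * q - m\<^sup>2)"
      by (simp add: algebra_simps power2_eq_square)
    also have "\<dots> < 0" using 4 by (intro mult_pos_neg) auto
    finally show thesis using that[of m p] by blast
  qed
qed

lemma binary_form_square:
  fixes p q m x y :: real
  assumes "p > 0"
  shows "p * x\<^sup>2 + q * y\<^sup>2 - 2 * m * x * y = p * (x - m * y / p)\<^sup>2 + (q - m\<^sup>2 / p) * y\<^sup>2"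
  using assms by (simp add: field_simps power2_eq_square)

lemma linear_relation:
  fixes u w :: real
  obtains \<alpha> \<beta> where "(\<alpha>, \<beta>) \<noteq> (0, 0)" "\<alpha> * u + \<beta> * w = 0"
proof (cases "u = 0")
  case True
  then show thesis using that[of 1 0] by simp
next
  case False
  then show thesis using that[of "- w" u] by simp
qed

context leg_triangle
begin

lemma negative_imp_nonpositive: "negative_plane mu tgraph \<Longrightarrow> nonpositive_plane mu tgraph"
proof -
  assume "negative_plane mu tgraph"
  then obtain v w where vw: "admissible v" "admissible w"
    "\<And>\<alpha> \<beta>. (\<alpha>, \<beta>) \<noteq> (0, 0) \<Longrightarrow> reduced_form weight (\<lambda>k. \<alpha> * v k + \<beta> * w k) < 0"
    unfolding negative_plane_reduced by blast
  have zero: "reduced_form weight u = 0" if "\<And>k. k < 6 \<Longrightarrow> u k = 0" for u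
    using that by (simp add: reduced_form_expand)
  show ?thesis
  proof (rule nonpositive_plane_reducedI[OF vw(1,2)])
    show "reduced_form weight (\<lambda>k. \<alpha> * v k + \<beta> * w k) \<le> 0" for \<alpha> \<beta>
    proof (cases "(\<alpha>, \<beta>) = (0, 0)")
      case True
      then show ?thesis using zero[of "\<lambda>k. \<alpha> * v k + \<beta> * w k"] by simp
    next
      case False
      then show ?thesis using vw(3) less_imp_le by blast
    qed
    show "\<exists>k<6. \<alpha> * v k + \<beta> * w k \<noteq> 0" if "(\<alpha>, \<beta>) \<noteq> (0, 0)" for \<alpha> \<beta>
      using vw(3)[OF that] zero[of "\<lambda>k. \<alpha> * v k + \<beta> * w k"] by force
  qed
qed

text \<open>
  A triangle vertex with a free linear variable makes the form as negative as desired: setting the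
  variable to a large \<open>K\<close> adds \<open>-2 K\<close> to the diagonal. Two such vertices give two negative directions.
\<close>

lemma two_long_roots_negative:
  assumes "l2 0 \<ge> 1" and j: "j = 1 \<or> j = 2" "l2 j \<ge> 1"
  shows "negative_plane mu tgraph"
proof -
  define K where "K = \<bar>weight 0\<bar> + \<bar>weight j\<bar> + 2"
  define v where "v k = (if k = 0 then 1 else if k = 3 then K else 0)" for k :: nat
  define w where "w k = (if k = j then 1 else if k = 3 + j then K else 0)" for k :: nat
  have "admissible v" "admissible w" using assms by (auto simp: admissible_def v_def w_def)
  moreover have "reduced_form weight (\<lambda>k. \<alpha> * v k + \<beta> * w k) < 0" if nz: "(\<alpha>, \<beta>) \<noteq> (0, 0)" for \<alpha> \<beta>
  proof -
    have "reduced_form weight (\<lambda>k. \<alpha> * v k + \<beta> * w k) =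
        (weight 0 - 2 * K) * \<alpha>\<^sup>2 + (weight j - 2 * K) * \<beta>\<^sup>2 - 2 * \<alpha> * \<beta>"
      using j(1) by (elim disjE) (simp_all add: reduced_form_expand v_def w_def algebra_simps power2_eq_square)
    moreover have "(weight 0 - 2 * K) * \<alpha>\<^sup>2 \<le> - 4 * \<alpha>\<^sup>2" "(weight j - 2 * K) * \<beta>\<^sup>2 \<le> - 4 * \<beta>\<^sup>2"
      unfolding K_def by (intro mult_right_mono; simp)+
    moreover have "(\<alpha> + \<beta>)\<^sup>2 \<ge> 0" "\<alpha>\<^sup>2 \<ge> 0" "\<beta>\<^sup>2 \<ge> 0" "\<alpha>\<^sup>2 > 0 \<or> \<beta>\<^sup>2 > 0" using nz by auto
    moreover have "(\<alpha> + \<beta>)\<^sup>2 = \<alpha>\<^sup>2 + \<beta>\<^sup>2 + 2 * \<alpha> * \<beta>" by (simp add: power2_eq_square algebra_simps)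
    ultimately show ?thesis by linarith
  qed
  ultimately show ?thesis unfolding negative_plane_reduced by blast
qed

text \<open>
  One negative direction comes from the other two triangle vertices. The vertex with the free variable gives a second
  one; \<open>K\<close> is chosen so that the determinant on the plane is \<open>-R > 0\<close>.
\<close>

lemma long_root_negative:
  assumes l2: "l2 0 \<ge> 1" and neg: "\<not> (weight 1 \<ge> 0 \<and> weight 2 \<ge> 0 \<and> weight 1 * weight 2 \<ge> 1)"
  shows "negative_plane mu tgraph"
proof -
  obtain x y where xy: "weight 1 * x\<^sup>2 + weight 2 * y\<^sup>2 - 2 * 1 * x * y < 0"
    using binary_form_takes_negative[of "weight 1" "weight 2" 1] neg by auto
  define R where "R = weight 1 * x\<^sup>2 + weight 2 * y\<^sup>2 - 2 * x * y"
  have R: "R < 0" using xy by (simp add: R_def)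
  define K where "K = (weight 0 + 1 - (x + y)\<^sup>2 / R) / 2"
  define v where "v k = (if k = 1 then x else if k = 2 then y else 0)" for k :: nat
  define w where "w k = (if k = 0 then 1 else if k = 3 then K else 0)" for k :: nat
  have "admissible v" "admissible w" using l2 by (auto simp: admissible_def v_def w_def)
  moreover have "reduced_form weight (\<lambda>k. \<alpha> * v k + \<beta> * w k) < 0" if nz: "(\<alpha>, \<beta>) \<noteq> (0, 0)" for \<alpha> \<beta>
  proof -
    have "reduced_form weight (\<lambda>k. \<alpha> * v k + \<beta> * w k) =
        R * \<alpha>\<^sup>2 - 2 * (x + y) * \<alpha> * \<beta> + (weight 0 - 2 * K) * \<beta>\<^sup>2"
      by (simp add: reduced_form_expand v_def w_def R_def algebra_simps power2_eq_square)
    also have "weight 0 - 2 * K = (x + y)\<^sup>2 / R - 1" using R by (simp add: K_def field_simps)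
    also have "R * \<alpha>\<^sup>2 - 2 * (x + y) * \<alpha> * \<beta> + ((x + y)\<^sup>2 / R - 1) * \<beta>\<^sup>2 = R * (\<alpha> - (x + y) * \<beta> / R)\<^sup>2 - \<beta>\<^sup>2"
      using R by (simp add: field_simps power2_eq_square)
    also have "\<dots> < 0"
    proof (cases "\<beta> = 0")
      case True
      then show ?thesis using nz R by (simp add: mult_neg_pos)
    next
      case False
      moreover have "R * (\<alpha> - (x + y) * \<beta> / R)\<^sup>2 \<le> 0" using R by (intro mult_nonpos_nonneg) auto
      moreover from False have "\<beta>\<^sup>2 > 0" by simp
      ultimately show ?thesis by linarith
    qed
    finally show ?thesis .
  qed
  ultimately show ?thesis unfolding negative_plane_reduced by blast
qed

text \<open>
  On the hyperplane \<open>v 0 = 0\<close>, which every plane meets in a nonzero vector, the form reduces to the binary form at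
  the other two triangle vertices.
\<close>

lemma small_pair_not_negative:
  assumes l2: "l2 1 = 0" "l2 2 = 0" and p: "weight 1 \<ge> 0" "weight 1 * weight 2 \<ge> 1"
  shows "\<not> negative_plane mu tgraph"
proof
  assume "negative_plane mu tgraph"
  then obtain v w where vw: "admissible v" "admissible w"
    "\<And>\<alpha> \<beta>. (\<alpha>, \<beta>) \<noteq> (0, 0) \<Longrightarrow> reduced_form weight (\<lambda>k. \<alpha> * v k + \<beta> * w k) < 0"
    unfolding negative_plane_reduced by blast
  obtain \<alpha> \<beta> where ab: "(\<alpha>, \<beta>) \<noteq> (0, 0)" "\<alpha> * v 0 + \<beta> * w 0 = 0" by (rule linear_relation)
  define u where "u k = \<alpha> * v k + \<beta> * w k" for k
  have "v 4 = 0" "v 5 = 0" "w 4 = 0" "w 5 = 0"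
    using vw(1,2) l2 unfolding admissible_def by (auto dest: spec[of _ 1] spec[of _ 2])
  then have "u 0 = 0" "u 4 = 0" "u 5 = 0" using ab by (auto simp: u_def)
  then have "reduced_form weight u = weight 1 * (u 1)\<^sup>2 + weight 2 * (u 2)\<^sup>2 - 2 * 1 * u 1 * u 2"
    by (simp add: reduced_form_expand)
  moreover have p1: "weight 1 > 0" using p by (cases "weight 1 = 0") auto
  ultimately have "reduced_form weight u = weight 1 * (u 1 - 1 * u 2 / weight 1)\<^sup>2 + (weight 2 - 1\<^sup>2 / weight 1) * (u 2)\<^sup>2"
    using binary_form_square[OF p1] by metis
  also have "\<dots> \<ge> 0" using p1 p(2) by (intro add_nonneg_nonneg mult_nonneg_nonneg) (auto simp: field_simps)
  finally show False using vw(3)[OF ab(1)] unfolding u_def by simp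
qed

text \<open>
  The null vector \<open>(1, p)\<close> of the binary form is corrected by the free variable at vertex 0 so that it becomes
  orthogonal to vertex 0.
\<close>

lemma singular_pair_nonpositive:
  assumes l2: "l2 0 \<ge> 1" and p: "weight 1 * weight 2 = 1"
  shows "nonpositive_plane mu tgraph"
proof -
  let ?p = "weight 1"
  define K where "K = \<bar>weight 0\<bar>"
  define v where "v k = (if k = 1 then 1 else if k = 2 then ?p else if k = 3 then - (1 + ?p) else 0)" for k :: nat
  define w where "w k = (if k = 0 then 1 else if k = 3 then K else 0)" for k :: nat
  have adm: "admissible v" "admissible w" using l2 by (auto simp: admissible_def v_def w_def)
  show ?thesis
  proof (rule nonpositive_plane_reducedI[OF adm])
    fix \<alpha> \<beta> :: real
    have "reduced_form weight (\<lambda>k. \<alpha> * v k + \<beta> * w k) =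
        (weight 0 - 2 * K) * \<beta>\<^sup>2 + ?p * \<alpha>\<^sup>2 * (?p * weight 2 - 1)"
      by (simp add: reduced_form_expand v_def w_def algebra_simps power2_eq_square)
    also have "\<dots> \<le> 0" unfolding p by (simp add: K_def mult_nonpos_nonneg)
    finally show "reduced_form weight (\<lambda>k. \<alpha> * v k + \<beta> * w k) \<le> 0" .
    assume "(\<alpha>, \<beta>) \<noteq> (0, 0)"
    then have "\<alpha> * v 1 + \<beta> * w 1 \<noteq> 0 \<or> \<alpha> * v 0 + \<beta> * w 0 \<noteq> 0" by (auto simp: v_def w_def)
    moreover have "(0 :: nat) < 6" "(1 :: nat) < 6" by auto
    ultimately show "\<exists>k<6. \<alpha> * v k + \<beta> * w k \<noteq> 0" by blast
  qed
qed

text \<open>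
  The hyperplane is now \<open>v 3 = - K v 0\<close> with \<open>K\<close> large. On it the free variable contributes \<open>2 K (v 0)\<^sup>2\<close>, which makes the
  form positive definite; \<open>K\<close> is chosen so that exactly \<open>(v 0)\<^sup>2\<close> remains after completing squares.
\<close>

lemma small_pair_not_nonpositive:
  assumes l2: "l2 0 = 1" "l2 1 = 0" "l2 2 = 0" and p: "weight 1 \<ge> 0" "weight 1 * weight 2 > 1"
  shows "\<not> nonpositive_plane mu tgraph"
proof
  assume np: "nonpositive_plane mu tgraph"
  have "l2 i \<le> 1" if "i < 3" for i using that l2 unfolding less_3 by auto
  from nonpositive_plane_reducedD[OF np this] obtain v w where vw: "admissible v" "admissible w"
    "\<And>\<alpha> \<beta>. reduced_form weight (\<lambda>k. \<alpha> * v k + \<beta> * w k) \<le> 0"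
    "\<And>\<alpha> \<beta>. (\<alpha>, \<beta>) \<noteq> (0, 0) \<Longrightarrow> \<exists>k<6. \<alpha> * v k + \<beta> * w k \<noteq> 0" by blast
  define p1 where "p1 = weight 1"
  have p1: "p1 > 0" using p by (cases "weight 1 = 0") (auto simp: p1_def)
  define e where "e = weight 2 - 1 / p1"
  have e: "e > 0" using p p1 by (simp add: e_def p1_def field_simps)
  define m where "m = 1 + 1 / p1"
  define K where "K = (1 / p1 + m\<^sup>2 / e + 1 - weight 0) / 2"
  obtain \<alpha> \<beta> where ab: "(\<alpha>, \<beta>) \<noteq> (0, 0)" "\<alpha> * (v 3 + K * v 0) + \<beta> * (w 3 + K * w 0) = 0"
    by (rule linear_relation)
  define u where "u k = \<alpha> * v k + \<beta> * w k" for k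
  have "v 4 = 0" "v 5 = 0" "w 4 = 0" "w 5 = 0"
    using vw(1,2) l2 unfolding admissible_def by (auto dest: spec[of _ 1] spec[of _ 2])
  then have u45: "u 4 = 0" "u 5 = 0" by (auto simp: u_def)
  have u3: "u 3 = - (K * u 0)" using ab(2) by (simp add: u_def algebra_simps)
  define r where "r = u 1 - u 2 / p1"
  have "reduced_form weight u = (weight 0 + 2 * K) * (u 0)\<^sup>2 - 2 * u 0 * (u 1 + u 2)
      + (p1 * (u 1)\<^sup>2 + weight 2 * (u 2)\<^sup>2 - 2 * 1 * u 1 * u 2)"
    using u45 u3 by (simp add: reduced_form_expand p1_def algebra_simps power2_eq_square)
  also have "weight 0 + 2 * K = 1 / p1 + m\<^sup>2 / e + 1" using p1 e by (simp add: K_def field_simps)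
  also have "p1 * (u 1)\<^sup>2 + weight 2 * (u 2)\<^sup>2 - 2 * 1 * u 1 * u 2 = p1 * r\<^sup>2 + e * (u 2)\<^sup>2"
    unfolding binary_form_square[OF p1] by (simp add: r_def e_def)
  also have "u 1 + u 2 = r + m * u 2" by (simp add: r_def m_def algebra_simps)
  also have "(1 / p1 + m\<^sup>2 / e + 1) * (u 0)\<^sup>2 - 2 * u 0 * (r + m * u 2) + (p1 * r\<^sup>2 + e * (u 2)\<^sup>2) =
      p1 * (r - u 0 / p1)\<^sup>2 + e * (u 2 - m * u 0 / e)\<^sup>2 + (u 0)\<^sup>2"
    using p1 e by (simp add: field_simps power2_eq_square)
  finally have "p1 * (r - u 0 / p1)\<^sup>2 + e * (u 2 - m * u 0 / e)\<^sup>2 + (u 0)\<^sup>2 \<le> 0"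
    using vw(3)[of \<alpha> \<beta>] unfolding u_def by simp
  moreover have "p1 * (r - u 0 / p1)\<^sup>2 \<ge> 0" "e * (u 2 - m * u 0 / e)\<^sup>2 \<ge> 0" "(u 0)\<^sup>2 \<ge> 0" using p1 e by auto
  ultimately have z: "(u 0)\<^sup>2 = 0" "p1 * (r - u 0 / p1)\<^sup>2 = 0" "e * (u 2 - m * u 0 / e)\<^sup>2 = 0" by linarith+
  then have "u 0 = 0" by simp
  then have "u 2 = 0" "r = 0" using z p1 e by auto
  then have "u 1 = 0" by (simp add: r_def)
  have "u k = 0" if "k < 6" for k
  proof -
    have "k = 0 \<or> k = 1 \<or> k = 2 \<or> k = 3 \<or> k = 4 \<or> k = 5" using that by auto
    then show ?thesis using \<open>u 0 = 0\<close> \<open>u 1 = 0\<close> \<open>u 2 = 0\<close> u3 u45 by auto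
  qed
  then show False using vw(4)[OF ab(1)] unfolding u_def by blast
qed

text \<open>
  One negative direction is vertex 0 itself; a second one, orthogonal to it, comes from the Schur
  complement of its entry.
\<close>

lemma heavy_root_negative:
  assumes p0: "weight 0 < 0"
    and neg: "\<not> (weight 1 - 1 / weight 0 \<ge> 0 \<and> weight 2 - 1 / weight 0 \<ge> 0 \<and>
      (weight 1 - 1 / weight 0) * (weight 2 - 1 / weight 0) \<ge> (1 + 1 / weight 0)\<^sup>2)"
  shows "negative_plane mu tgraph"
proof -
  let ?p = "weight 0"
  obtain x y where xy: "(weight 1 - 1 / ?p) * x\<^sup>2 + (weight 2 - 1 / ?p) * y\<^sup>2 - 2 * (1 + 1 / ?p) * x * y < 0"
    by (rule binary_form_takes_negative[OF neg])
  define v where "v k = (if k = 0 then 1 else 0 :: real)" for k :: nat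
  define w where "w k = (if k = 0 then (x + y) / ?p else if k = 1 then x else if k = 2 then y else 0)" for k :: nat
  have "admissible v" "admissible w" by (auto simp: admissible_def v_def w_def)
  moreover have "reduced_form weight (\<lambda>k. \<alpha> * v k + \<beta> * w k) < 0" if nz: "(\<alpha>, \<beta>) \<noteq> (0, 0)" for \<alpha> \<beta>
  proof -
    have "reduced_form weight (\<lambda>k. \<alpha> * v k + \<beta> * w k) = ?p * \<alpha>\<^sup>2 +
        ((weight 1 - 1 / ?p) * x\<^sup>2 + (weight 2 - 1 / ?p) * y\<^sup>2 - 2 * (1 + 1 / ?p) * x * y) * \<beta>\<^sup>2"
      using p0 by (simp add: reduced_form_expand v_def w_def field_simps power2_eq_square)
    also have "\<dots> < 0"
    proof (cases "\<beta> = 0")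
      case True
      then show ?thesis using nz p0 by (simp add: mult_neg_pos)
    next
      case False
      then show ?thesis using xy p0 by (intro add_nonpos_neg mult_neg_pos mult_nonpos_nonneg) auto
    qed
    finally show ?thesis .
  qed
  ultimately show ?thesis unfolding negative_plane_reduced by blast
qed

text \<open>
  The hyperplane orthogonal to vertex 0 carries the Schur complement, here positive definite.
\<close>

lemma heavy_root_not_nonpositive:
  assumes l2: "\<And>i. i < 3 \<Longrightarrow> l2 i = 0" and p0: "weight 0 < 0"
    and pos: "weight 1 - 1 / weight 0 \<ge> 0"
      "(weight 1 - 1 / weight 0) * (weight 2 - 1 / weight 0) > (1 + 1 / weight 0)\<^sup>2"
  shows "\<not> nonpositive_plane mu tgraph"
proof
  let ?p = "weight 0"
  assume np: "nonpositive_plane mu tgraph"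
  have "l2 i \<le> 1" if "i < 3" for i using l2[OF that] by simp
  from nonpositive_plane_reducedD[OF np this] obtain v w where vw: "admissible v" "admissible w"
    "\<And>\<alpha> \<beta>. reduced_form weight (\<lambda>k. \<alpha> * v k + \<beta> * w k) \<le> 0"
    "\<And>\<alpha> \<beta>. (\<alpha>, \<beta>) \<noteq> (0, 0) \<Longrightarrow> \<exists>k<6. \<alpha> * v k + \<beta> * w k \<noteq> 0" by blast
  define q1 where "q1 = weight 1 - 1 / ?p"
  define q2 where "q2 = weight 2 - 1 / ?p"
  define m where "m = 1 + 1 / ?p"
  have "q1 \<noteq> 0" using pos(2) by (metis mult_zero_left not_less q1_def zero_le_power2)
  then have q1: "q1 > 0" using pos(1) by (simp add: q1_def)
  have "m\<^sup>2 < q1 * q2" using pos(2) by (simp only: q1_def q2_def m_def)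
  then have e: "q2 - m\<^sup>2 / q1 > 0" using q1 by (simp add: field_simps)
  obtain \<alpha> \<beta> where ab: "(\<alpha>, \<beta>) \<noteq> (0, 0)"
    "\<alpha> * (?p * v 0 - v 1 - v 2) + \<beta> * (?p * w 0 - w 1 - w 2) = 0"
    by (rule linear_relation)
  define u where "u k = \<alpha> * v k + \<beta> * w k" for k
  have "v 3 = 0" "v 4 = 0" "v 5 = 0" "w 3 = 0" "w 4 = 0" "w 5 = 0"
    using vw(1,2) l2 unfolding admissible_def by (auto dest: spec[of _ 0] spec[of _ 1] spec[of _ 2])
  then have u345: "u 3 = 0" "u 4 = 0" "u 5 = 0" by (auto simp: u_def)
  have "?p * u 0 = u 1 + u 2" using ab(2) by (simp add: u_def algebra_simps)
  then have u0: "u 0 = (u 1 + u 2) / ?p" using p0 by (simp add: field_simps)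
  have "reduced_form weight u = q1 * (u 1)\<^sup>2 + q2 * (u 2)\<^sup>2 - 2 * m * u 1 * u 2"
    using u345 p0 unfolding reduced_form_expand u0 q1_def q2_def m_def
    by (simp add: field_simps power2_eq_square)
  also have "\<dots> = q1 * (u 1 - m * u 2 / q1)\<^sup>2 + (q2 - m\<^sup>2 / q1) * (u 2)\<^sup>2"
    by (rule binary_form_square[OF q1])
  finally have "q1 * (u 1 - m * u 2 / q1)\<^sup>2 + (q2 - m\<^sup>2 / q1) * (u 2)\<^sup>2 \<le> 0"
    using vw(3)[of \<alpha> \<beta>] unfolding u_def by simp
  moreover have "q1 * (u 1 - m * u 2 / q1)\<^sup>2 \<ge> 0" "(q2 - m\<^sup>2 / q1) * (u 2)\<^sup>2 \<ge> 0" using q1 e by auto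
  ultimately have z: "(q2 - m\<^sup>2 / q1) * (u 2)\<^sup>2 = 0" "q1 * (u 1 - m * u 2 / q1)\<^sup>2 = 0" by linarith+
  then have u2: "u 2 = 0" using e by auto
  then have u1: "u 1 = 0" using z q1 by auto
  have "u k = 0" if "k < 6" for k
  proof -
    have "k = 0 \<or> k = 1 \<or> k = 2 \<or> k = 3 \<or> k = 4 \<or> k = 5" using that by auto
    then show ?thesis using u0 u1 u2 u345 by auto
  qed
  then show False using vw(4)[OF ab(1)] unfolding u_def by blast
qed

text \<open>
  Each child without leaves lowers the diagonal entry by \<open>\<mu>/2\<close>, each child with one leaf by \<open>2 \<mu>\<close>.
\<close>

definition "load i = int (l0 i) + 4 * int (l1 i)"

lemma weight_load: "l2 i = 0 \<Longrightarrow> weight i = mu * (4 - real_of_int (load i)) / 2"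
  by (simp add: weight_def load_def field_simps)

definition "small_pair \<longleftrightarrow> l2 1 = 0 \<and> l2 2 = 0 \<and> load 1 \<le> 3 \<and> load 2 \<le> 3 \<and> (4 - load 1) * (4 - load 2) \<ge> 6"

lemma weight_product:
  assumes "l2 1 = 0" "l2 2 = 0"
  shows "weight 1 * weight 2 = real_of_int ((4 - load 1) * (4 - load 2)) / 6"
proof -
  have "weight 1 * weight 2 = mu * mu * ((4 - real_of_int (load 1)) * (4 - real_of_int (load 2))) / 4"
  proof -
    have "(m * x / 2) * (m * y / 2) = m * m * (x * y) / 4" for m x y :: real by simp
    then show ?thesis unfolding weight_load[OF assms(1)] weight_load[OF assms(2)] .
  qed
  then show ?thesis unfolding mu_sq by simp
qed

lemma weight_nonneg_iff: "l2 i = 0 \<Longrightarrow> weight i \<ge> 0 \<longleftrightarrow> load i \<le> 4"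
  by (simp add: weight_load zero_le_mult_iff) 

lemma small_pair_iff:
  assumes "l2 1 = 0" "l2 2 = 0"
  shows "small_pair \<longleftrightarrow> weight 1 \<ge> 0 \<and> weight 2 \<ge> 0 \<and> weight 1 * weight 2 \<ge> 1"
proof -
  have "weight 1 * weight 2 \<ge> 1 \<longleftrightarrow> (4 - load 1) * (4 - load 2) \<ge> 6"
    unfolding weight_product[OF assms] by linarith
  moreover have "load 1 \<noteq> 4 \<and> load 2 \<noteq> 4" if "(4 - load 1) * (4 - load 2) \<ge> 6" using that by auto
  ultimately show ?thesis
    using assms weight_nonneg_iff[of 1] weight_nonneg_iff[of 2] unfolding small_pair_def by fastforce
qed

theorem small_pair_planes:
  assumes small_pair
  shows "\<not> negative_plane mu tgraph"
    and "l2 0 \<ge> 1 \<Longrightarrow> nonpositive_plane mu tgraph \<longleftrightarrow> l2 0 \<ge> 2 \<or> (4 - load 1) * (4 - load 2) = 6"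
proof -
  have l2: "l2 1 = 0" "l2 2 = 0" using assms by (auto simp: small_pair_def)
  have w: "weight 1 \<ge> 0" "weight 1 * weight 2 \<ge> 1" using assms small_pair_iff[OF l2] by auto
  show "\<not> negative_plane mu tgraph" by (rule small_pair_not_negative[OF l2 w])
  assume l20: "l2 0 \<ge> 1"
  have eq: "weight 1 * weight 2 = 1 \<longleftrightarrow> (4 - load 1) * (4 - load 2) = 6"
    unfolding weight_product[OF l2] by linarith
  show "nonpositive_plane mu tgraph \<longleftrightarrow> l2 0 \<ge> 2 \<or> (4 - load 1) * (4 - load 2) = 6"
  proof
    assume "nonpositive_plane mu tgraph"
    then have "\<not> (l2 0 = 1 \<and> weight 1 * weight 2 > 1)"
      using small_pair_not_nonpositive l2 w(1) by blast
    then show "l2 0 \<ge> 2 \<or> (4 - load 1) * (4 - load 2) = 6" using w(2) eq l20 by linarith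
  next
    assume "l2 0 \<ge> 2 \<or> (4 - load 1) * (4 - load 2) = 6"
    then show "nonpositive_plane mu tgraph"
      using nonpositive_plane_two_long[of 0] singular_pair_nonpositive[OF l20] eq by auto
  qed
qed

theorem long_root_planes:
  assumes "l2 0 \<ge> 1" "\<not> negative_plane mu tgraph"
  shows small_pair
proof -
  have "\<not> l2 1 \<ge> 1" "\<not> l2 2 \<ge> 1"
    using two_long_roots_negative[OF assms(1), of 1] two_long_roots_negative[OF assms(1), of 2] assms(2) by blast+
  then have l2: "l2 1 = 0" "l2 2 = 0" by linarith+
  show ?thesis unfolding small_pair_iff[OF l2] using long_root_negative assms by blast
qed

text \<open>
  The first two conditions say that the diagonal of the Schur complement is nonnegative, the third one that its
  determinant is. The integer 29 stands for \<open>36 \<mu> = 12\<surd>6\<close>, which lies strictly between 29 and 30.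
\<close>

definition "heavy_ok \<longleftrightarrow> (4 - load 1) * (load 0 - 4) \<ge> -6 \<and> (4 - load 2) * (load 0 - 4) \<ge> -6 \<and>
   (load 0 - 4) * ((4 - load 1) * (4 - load 2) - 6) + 6 * (8 - load 1 - load 2) + 29 \<ge> 0"

theorem heavy_root_planes:
  assumes l2: "\<And>i. i < 3 \<Longrightarrow> l2 i = 0" and heavy: "load 0 \<ge> 5"
  shows "negative_plane mu tgraph \<longleftrightarrow> \<not> heavy_ok"
    and "heavy_ok \<Longrightarrow> \<not> nonpositive_plane mu tgraph"
proof -
  define m where "m = mu"
  have m2: "m * m = 2 / 3" unfolding m_def by (rule mu_sq)
  have m3: "m * (m * (m * u)) = 2 / 3 * (m * u)" "m * (m * u) = 2 / 3 * u" for u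
    using m2 by (metis mult.assoc)+
  have mb: "m > 0.81649" "m < 0.8165" using mu_bounds by (simp_all add: m_def)
  define a where "a = (real_of_int (load 0) - 4) / 2"
  have a: "a > 0" using heavy by (simp add: a_def)
  define b where "b i = (4 - real_of_int (load i)) / 2" for i
  have w0: "weight 0 = - (m * a)" using weight_load[of 0] l2[of 0] by (simp add: a_def m_def field_simps)
  have w: "weight i = m * b i" if "i < 3" for i
    using weight_load[of i] l2[OF that] by (simp add: b_def m_def)
  have p0: "weight 0 < 0" using a mb by (simp add: w0)
  have inv: "1 / weight 0 = - (3 / 2 * m / a)"
    using a mb m2 by (simp add: w0 field_simps)
  have q: "weight i - 1 / weight 0 = m / a * (a * b i + 3 / 2)" if "i < 3" for i
    using a by (simp add: w[OF that] inv field_simps)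
  have qpos: "weight i - 1 / weight 0 \<ge> 0 \<longleftrightarrow> (4 - load i) * (load 0 - 4) \<ge> -6" if "i < 3" for i
  proof -
    have "weight i - 1 / weight 0 \<ge> 0 \<longleftrightarrow> a * b i + 3 / 2 \<ge> 0"
    proof -
      have "m / a > 0" using a mb by simp
      then show ?thesis unfolding q[OF that] by (metis mult_le_cancel_left_pos mult_zero_right)
    qed
    also have "a * b i + 3 / 2 = (real_of_int ((4 - load i) * (load 0 - 4)) + 6) / 4"
      by (simp add: a_def b_def field_simps)
    also have "\<dots> \<ge> 0 \<longleftrightarrow> (4 - load i) * (load 0 - 4) \<ge> -6"
    proof -
      have "P \<ge> -6 \<longleftrightarrow> real_of_int P \<ge> -6" for P
        by (metis of_int_le_iff of_int_neg_numeral)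
      moreover have "(r + 6) / 4 \<ge> 0 \<longleftrightarrow> r \<ge> -6" for r :: real by (auto simp: field_simps)
      ultimately show ?thesis by (simp only:)
    qed
    finally show ?thesis .
  qed
  define E where "E = (load 0 - 4) * ((4 - load 1) * (4 - load 2) - 6) + 6 * (8 - load 1 - load 2) + 29"
  \<comment> \<open>The determinant of the Schur complement; since \<open>0 < 36 m - 29 < 1\<close>, its sign is that of the
    integer \<open>E\<close>, with zero counted as positive.\<close>
  have disc: "(weight 1 - 1 / weight 0) * (weight 2 - 1 / weight 0) - (1 + 1 / weight 0)\<^sup>2
      = (real_of_int E + (36 * m - 29)) / (12 * a)"
  proof -
    have "(weight 1 - 1 / weight 0) * (weight 2 - 1 / weight 0) - (1 + 1 / weight 0)\<^sup>2
      = m * m * ((a * b 1 + 3 / 2) * (a * b 2 + 3 / 2)) / (a * a) - (1 - 3 * m / a + 9 / 4 * (m * m) / (a * a))"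
    proof -
      have q1: "weight 1 - 1 / weight 0 = m / a * (a * b 1 + 3 / 2)" by (rule q) simp
      have q2: "weight 2 - 1 / weight 0 = m / a * (a * b 2 + 3 / 2)" by (rule q) simp
      have i1: "1 + 1 / weight 0 = 1 - 3 / 2 * m / a" unfolding inv by simp
      show ?thesis unfolding q1 q2 i1 using a by (simp add: field_simps power2_eq_square)
    qed
    also have "\<dots> = 2 / 3 * b 1 * b 2 - 1 + (b 1 + b 2 + 3 * m) / a"
      unfolding m2 using a by (simp add: field_simps)
    also have "\<dots> = (8 * a * b 1 * b 2 - 12 * a + 12 * (b 1 + b 2) + 36 * m) / (12 * a)"
      using a by (simp add: field_simps)
    also have "8 * a * b 1 * b 2 - 12 * a + 12 * (b 1 + b 2) = real_of_int E - 29"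
      by (simp add: E_def a_def b_def field_simps)
    finally show ?thesis by (simp add: algebra_simps)
  qed
  have "(real_of_int E + (36 * m - 29)) / (12 * a) \<ge> 0 \<longleftrightarrow> real_of_int E + (36 * m - 29) \<ge> 0"
    "(real_of_int E + (36 * m - 29)) / (12 * a) > 0 \<longleftrightarrow> real_of_int E + (36 * m - 29) > 0"
    using a by (simp_all add: zero_le_divide_iff zero_less_divide_iff)
  moreover have "real_of_int E + (36 * m - 29) \<ge> 0 \<longleftrightarrow> E \<ge> 0" "real_of_int E + (36 * m - 29) > 0 \<longleftrightarrow> E \<ge> 0"
  proof -
    have "E \<ge> 0 \<or> E \<le> -1" by linarith
    then have "E \<ge> 0 \<and> real_of_int E \<ge> 0 \<or> \<not> E \<ge> 0 \<and> real_of_int E \<le> -1" by linarith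
    then show "real_of_int E + (36 * m - 29) \<ge> 0 \<longleftrightarrow> E \<ge> 0" "real_of_int E + (36 * m - 29) > 0 \<longleftrightarrow> E \<ge> 0"
      using mb by auto
  qed
  ultimately have D: "(weight 1 - 1 / weight 0) * (weight 2 - 1 / weight 0) \<ge> (1 + 1 / weight 0)\<^sup>2 \<longleftrightarrow> E \<ge> 0"
    "(weight 1 - 1 / weight 0) * (weight 2 - 1 / weight 0) > (1 + 1 / weight 0)\<^sup>2 \<longleftrightarrow> E \<ge> 0"
    using disc by linarith+
  show np: "\<not> nonpositive_plane mu tgraph" if heavy_ok
    by (rule heavy_root_not_nonpositive[OF l2 p0])
      (use that qpos[of 1] D in \<open>auto simp: heavy_ok_def E_def\<close>)
  have "negative_plane mu tgraph" if "\<not> heavy_ok"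
    by (rule heavy_root_negative[OF p0])
      (use that qpos[of 1] qpos[of 2] D in \<open>auto simp: heavy_ok_def E_def\<close>)
  then show "negative_plane mu tgraph \<longleftrightarrow> \<not> heavy_ok"
    using np negative_imp_nonpositive by blast
qed

end

section \<open>From inertia to the list of graphs\<close>

text \<open>
  The parameters \<open>(l\<^sub>0, l\<^sub>1, l\<^sub>2)\<close> of one tree, so that permutations of the three trees become permutations
  of arguments.
\<close>

type_synonym legs = "nat \<times> nat \<times> nat"

definition trees_triangle :: "legs \<Rightarrow> legs \<Rightarrow> legs \<Rightarrow> (nat \<times> nat list) pair_pre_digraph" where
  "trees_triangle x y z = cycle_with_trees
     (map (\<lambda>(l0, l1, l2). tree_T l0 l1 l2) [x, y, z])"

text \<open>
  The number of vertices of the tree other than its root.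
\<close>

definition limb_order :: "legs \<Rightarrow> nat" where "limb_order = (\<lambda>(l0, l1, l2). l0 + 2 * l1 + 3 * l2)"

definition limb_load :: "legs \<Rightarrow> int" where "limb_load = (\<lambda>(l0, l1, l2). int l0 + 4 * int l1)"

definition limb_long :: "legs \<Rightarrow> nat" where "limb_long = (\<lambda>(l0, l1, l2). l2)"

lemma trees_triangle_rooted:
  "\<exists>a b c par lev. rooted_triangle (trees_triangle x y z) a b c par lev"
proof -
  define k where "k = (\<lambda>(l0, l1, l2). leg_list l0 l1 l2)"
  have "trees_triangle x y z = spider_triangle (k x) (k y) (k z)"
    by (cases x; cases y; cases z) (simp add: trees_triangle_def tree_T_spider k_def)
  then show ?thesis using spider_triangle_rooted[of "k x" "k y" "k z"] by metis
qed

lemma wf_trees_triangle: "pair_wf_digraph (trees_triangle x y z)"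
  using trees_triangle_rooted[of x y z] rooted_triangle.pair_graph
  by (metis pair_digraph_def pair_fin_digraph_def pair_graph_def)

lemma trees_triangle_swap:
  "trees_triangle x y z \<simeq> trees_triangle y x z" "trees_triangle x y z \<simeq> trees_triangle x z y"
proof -
  have 1: "bij_betw (Transposition.transpose 0 1) {..<3 :: nat} {..<3}"
    by (rule bij_betw_byWitness[of _ "Transposition.transpose 0 1"]) (auto simp: Transposition.transpose_def)
  have 2: "bij_betw (Transposition.transpose 1 2) {..<3 :: nat} {..<3}"
    by (rule bij_betw_byWitness[of _ "Transposition.transpose 1 2"]) (auto simp: Transposition.transpose_def)
  show "trees_triangle x y z \<simeq> trees_triangle y x z"
    unfolding trees_triangle_def list.map
    by (rule triangle_permute[OF 1]) (auto simp: less_3 Transposition.transpose_def)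
  show "trees_triangle x y z \<simeq> trees_triangle x z y"
    unfolding trees_triangle_def list.map
    by (rule triangle_permute[OF 2]) (auto simp: less_3 Transposition.transpose_def)
qed

lemma card_trees_triangle: "card (pverts (trees_triangle x y z)) = 3 + limb_order x + limb_order y + limb_order z"
proof -
  define k where "k = (\<lambda>(l0, l1, l2). leg_list l0 l1 l2)"
  have eq: "trees_triangle x y z = spider_triangle (k x) (k y) (k z)"
    by (cases x; cases y; cases z) (simp add: trees_triangle_def tree_T_spider k_def)
  interpret rooted_triangle "spider_triangle (k x) (k y) (k z)" "(0, [])" "(1, [])" "(2, [])"
    "\<lambda>(i, q). (i, butlast q)" "\<lambda>(i, q). length q"
    by (rule spider_triangle_rooted)
  have legs: "(\<Sum>c<length (k u). 1 + k u ! c) = limb_order u" for u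
  proof -
    obtain l0 l1 l2 where u: "u = (l0, l1, l2)" by (cases u)
    have "(\<Sum>c<length (k u). 1 + k u ! c) = length (k u) + sum_list (k u)"
      by (simp add: sum_list_sum_nth atLeast0LessThan sum_Suc)
    then show ?thesis by (simp add: u k_def limb_order_def leg_list_def sum_list_replicate)
  qed
  have "card tree_verts = (\<Sum>i<3. \<Sum>c<length ([k x, k y, k z] ! i). 1 + [k x, k y, k z] ! i ! c)"
    unfolding card_eq_sum sum_tree_verts_spider_triangle by simp
  also have "\<dots> = limb_order x + limb_order y + limb_order z"
  proof -
    have num: "{..<3 :: nat} = {0, 1, 2}" by auto
    show ?thesis unfolding num using legs[of x] legs[of y] legs[of z] by simp
  qed
  finally have "card tree_verts = limb_order x + limb_order y + limb_order z" .
  moreover have "card tree_verts = card (pverts (spider_triangle (k x) (k y) (k z))) - card tri_verts"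
    using tri by (intro card_Diff_subset) auto
  moreover have "card tri_verts = 3" by simp
  moreover have "card tri_verts \<le> card (pverts (spider_triangle (k x) (k y) (k z)))"
    using tri fin by (rule card_mono[rotated])
  ultimately show ?thesis unfolding eq by linarith
qed

definition small_legs :: "legs \<Rightarrow> legs \<Rightarrow> bool" where
  "small_legs y z \<longleftrightarrow> limb_long y = 0 \<and> limb_long z = 0 \<and> limb_load y \<le> 3 \<and> limb_load z \<le> 3 \<and> (4 - limb_load y) * (4 - limb_load z) \<ge> 6"

definition heavy_legs :: "legs \<Rightarrow> legs \<Rightarrow> legs \<Rightarrow> bool" where
  "heavy_legs x y z \<longleftrightarrow> (4 - limb_load y) * (limb_load x - 4) \<ge> -6 \<and> (4 - limb_load z) * (limb_load x - 4) \<ge> -6 \<and>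
   (limb_load x - 4) * ((4 - limb_load y) * (4 - limb_load z) - 6) + 6 * (8 - limb_load y - limb_load z) + 29 \<ge> 0"

text \<open>
  The results on the reduced form, with the tree that provides the negative direction in the first
  place.
\<close>

lemma trees_triangle_planes:
  fixes x y z :: legs
  defines "G \<equiv> trees_triangle x y z"
  shows "small_legs y z \<Longrightarrow> \<not> negative_plane mu G"
    and "small_legs y z \<Longrightarrow> limb_long x \<ge> 1 \<Longrightarrow>
      nonpositive_plane mu G \<longleftrightarrow> limb_long x \<ge> 2 \<or> (4 - limb_load y) * (4 - limb_load z) = 6"
    and "limb_long x \<ge> 1 \<Longrightarrow> \<not> negative_plane mu G \<Longrightarrow> small_legs y z"
    and "limb_long x = 0 \<Longrightarrow> limb_long y = 0 \<Longrightarrow> limb_long z = 0 \<Longrightarrow> limb_load x \<ge> 5 \<Longrightarrow>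
      negative_plane mu G \<longleftrightarrow> \<not> heavy_legs x y z"
    and "limb_long x = 0 \<Longrightarrow> limb_long y = 0 \<Longrightarrow> limb_long z = 0 \<Longrightarrow> limb_load x \<ge> 5 \<Longrightarrow> heavy_legs x y z \<Longrightarrow>
      \<not> nonpositive_plane mu G"
proof -
  define u where "u i = [x, y, z] ! i" for i
  define l0 where "l0 i = fst (u i)" for i
  define l1 where "l1 i = fst (snd (u i))" for i
  define l2 where "l2 i = snd (snd (u i))" for i
  interpret L: leg_triangle l0 l1 l2 .
  have u: "u 0 = x" "u 1 = y" "u 2 = z" by (simp_all add: u_def)
  have ld: "L.load i = limb_load (u i)" for i
    by (cases "u i") (simp add: L.load_def limb_load_def l0_def l1_def)
  have lg: "l2 i = limb_long (u i)" for i by (cases "u i") (simp add: l2_def limb_long_def)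
  have "spider (L.legs i) = (case u i of (l0, l1, l2) \<Rightarrow> tree_T l0 l1 l2)" for i
    by (cases "u i") (simp add: L.legs_def l0_def l1_def l2_def tree_T_spider)
  then have G: "L.tgraph = G" by (simp add: L.tgraph_def G_def trees_triangle_def u[symmetric])
  have sp: "L.small_pair \<longleftrightarrow> small_legs y z"
    by (simp only: L.small_pair_def small_legs_def ld lg u)
  have hv: "L.heavy_ok \<longleftrightarrow> heavy_legs x y z"
    by (simp only: L.heavy_ok_def heavy_legs_def ld u)
  have l2: "l2 i = 0" if "limb_long x = 0" "limb_long y = 0" "limb_long z = 0" "i < 3" for i
    using that u unfolding less_3 lg by auto
  note * = L.small_pair_planes L.long_root_planes L.heavy_root_planes
  note * = *[unfolded G sp hv ld lg u]
  show "small_legs y z \<Longrightarrow> \<not> negative_plane mu G" by (rule *(1))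
  show "small_legs y z \<Longrightarrow> limb_long x \<ge> 1 \<Longrightarrow>
      nonpositive_plane mu G \<longleftrightarrow> limb_long x \<ge> 2 \<or> (4 - limb_load y) * (4 - limb_load z) = 6" by (rule *(2))
  show "limb_long x \<ge> 1 \<Longrightarrow> \<not> negative_plane mu G \<Longrightarrow> small_legs y z" by (rule *(3))
  show "limb_long x = 0 \<Longrightarrow> limb_long y = 0 \<Longrightarrow> limb_long z = 0 \<Longrightarrow> limb_load x \<ge> 5 \<Longrightarrow>
      negative_plane mu G \<longleftrightarrow> \<not> heavy_legs x y z" using *(4) l2 lg by metis
  show "limb_long x = 0 \<Longrightarrow> limb_long y = 0 \<Longrightarrow> limb_long z = 0 \<Longrightarrow> limb_load x \<ge> 5 \<Longrightarrow> heavy_legs x y z \<Longrightarrow>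
      \<not> nonpositive_plane mu G" using *(5) l2 lg by metis
qed

lemma small_legs_cases:
  assumes "small_legs y z" "limb_load y \<le> limb_load z"
  obtains "y = (0, 0, 0)" "z = (0, 0, 0)" | "y = (0, 0, 0)" "z = (1, 0, 0)" | "y = (0, 0, 0)" "z = (2, 0, 0)"
    | "y = (1, 0, 0)" "z = (1, 0, 0)" | "y = (1, 0, 0)" "z = (2, 0, 0)"
proof -
  obtain y0 y1 y2 where y: "y = (y0, y1, y2)" by (cases y)
  obtain z0 z1 z2 where z: "z = (z0, z1, z2)" by (cases z)
  have "y1 = 0" "z1 = 0" using assms by (auto simp: small_legs_def y z limb_load_def)
  then have 0: "y2 = 0" "z2 = 0" "y1 = 0" "z1 = 0" "y0 \<le> 3" "z0 \<le> 3" "y0 \<le> z0" "(4 - int y0) * (4 - int z0) \<ge> 6"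
    using assms by (auto simp: small_legs_def y z limb_load_def limb_long_def)
  have "y0 = 0 \<or> y0 = 1 \<or> y0 = 2 \<or> y0 = 3" "z0 = 0 \<or> z0 = 1 \<or> z0 = 2 \<or> z0 = 3" using 0 by auto
  then have "y0 = 0 \<and> z0 = 0 \<or> y0 = 0 \<and> z0 = 1 \<or> y0 = 0 \<and> z0 = 2 \<or> y0 = 1 \<and> z0 = 1 \<or> y0 = 1 \<and> z0 = 2"
    using 0(7,8) by (elim disjE) auto
  then show thesis using that 0 unfolding y z by fast
qed

text \<open>
  The parameters left by the inequality when the two smaller trees are stars with \<open>y0\<close> and \<open>z0\<close> leaves but do
  not form a small pair; the bounds on \<open>x0 + 4 * x1\<close> are the solutions of the inequality for these values.
\<close>

definition sporadic_legs :: "nat \<Rightarrow> nat \<Rightarrow> nat \<Rightarrow> nat \<Rightarrow> bool" where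
  "sporadic_legs y0 z0 x0 x1 \<longleftrightarrow>
    y0 = 0 \<and> z0 = 3 \<and> x0 + 4 * x1 \<le> 33 \<or> y0 = 1 \<and> z0 = 3 \<and> x0 + 4 * x1 \<le> 21 \<or>
     y0 = 2 \<and> z0 = 2 \<and> x0 + 4 * x1 \<le> 30 \<or> y0 = 2 \<and> z0 = 3 \<and> x0 + 4 * x1 \<le> 15 \<or>
     y0 = 3 \<and> z0 = 3 \<and> x0 + 4 * x1 \<le> 12 \<or> y0 = 6 \<and> z0 = 6 \<and> x0 = 6 \<and> x1 = 0"

text \<open>
  The first two conditions bound the loads of the smaller trees by 6. For each of the finitely many remaining
  pairs the third condition is linear in the load of the largest tree; if the larger load of the pair is 4, 5
  or 6, it bounds the largest load so strongly that only the graph with three loads equal to 6 reaches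
  21 vertices.
\<close>

lemma heavy_legs_cases:
  fixes x0 x1 y0 y1 z0 z1 :: nat
  assumes ok: "heavy_legs (x0, x1, 0) (y0, y1, 0) (z0, z1, 0)"
    and ord: "limb_load (y0, y1, 0) \<le> limb_load (z0, z1, 0)" "limb_load (z0, z1, 0) \<le> limb_load (x0, x1, 0)"
    and n: "3 + limb_order (x0, x1, 0) + limb_order (y0, y1, 0) + limb_order (z0, z1, 0) \<ge> 21"
  shows "small_legs (y0, y1, 0) (z0, z1, 0) \<or> y1 = 0 \<and> z1 = 0 \<and>
    sporadic_legs y0 z0 x0 x1"
proof -
  note sp = sporadic_legs_def
  define r s t where "r = int x0 + 4 * int x1" and "s = int y0 + 4 * int y1" and "t = int z0 + 4 * int z1"
  have h: "(4 - t) * (r - 4) \<ge> -6" "(r - 4) * ((4 - s) * (4 - t) - 6) + 6 * (8 - s - t) + 29 \<ge> 0"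
    using ok by (simp_all add: heavy_legs_def limb_load_def r_def s_def t_def)
  have o: "s \<le> t" "t \<le> r" "s \<ge> 0" using ord by (auto simp: limb_load_def r_def s_def t_def)
  have n': "3 + int x0 + 2 * int x1 + int y0 + 2 * int y1 + int z0 + 2 * int z1 \<ge> 21"
    using n by (simp add: limb_order_def)
  have "t \<le> 6"
  proof (rule ccontr)
    assume "\<not> t \<le> 6"
    then have "(t - 4) * (r - 4) \<ge> 3 * 3" using o by (intro mult_mono) auto
    then show False using h(1) by (simp add: algebra_simps)
  qed
  then have t: "t = 0 \<or> t = 1 \<or> t = 2 \<or> t = 3 \<or> t = 4 \<or> t = 5 \<or> t = 6" using o by linarith
  have small: "y1 = 0 \<and> int y0 = s" if "s \<le> 3" using that by (auto simp: s_def)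
  have small': "z1 = 0 \<and> int z0 = t" if "t \<le> 3" using that by (auto simp: t_def)
  consider "t \<le> 2" "(4 - s) * (4 - t) \<ge> 6" | "s = 2" "t = 2" | "t = 3" | "t = 4" | "t = 5" | "t = 6"
    using t o by fastforce
  then show ?thesis
  proof cases
    case 1
    then show ?thesis using o by (simp add: small_legs_def limb_long_def limb_load_def s_def t_def)
  next
    case 2
    then have "r \<le> 30" using h(2) by simp
    then show ?thesis using small small' 2 by (simp add: r_def sp)
  next
    case 3
    have "s = 0 \<or> s = 1 \<or> s = 2 \<or> s = 3" using o 3 by linarith
    then have "s = 0 \<and> r \<le> 33 \<or> s = 1 \<and> r \<le> 21 \<or> s = 2 \<and> r \<le> 15 \<or> s = 3 \<and> r \<le> 12"
      using h(2) 3 by (elim disjE) simp_all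
    then show ?thesis using small small' 3 unfolding r_def sp by (elim disjE) simp_all
  next
    case 4
    have "s = 0 \<or> s = 1 \<or> s = 2 \<or> s = 3 \<or> s = 4" using o 4 by linarith
    then have "r \<le> 12" "s = 0 \<or> r \<le> 11" "s \<le> 1 \<or> r \<le> 10" "s \<le> 2 \<or> r \<le> 9" "s \<le> 3 \<or> r \<le> 8"
      using h(2) 4 by auto
    then have False using n' 4 o unfolding r_def s_def t_def by linarith
    then show ?thesis ..
  next
    case 5
    have "s = 0 \<or> s = 1 \<or> s = 2 \<or> s = 3 \<or> s = 4 \<or> s = 5" using o 5 by linarith
    then have "r \<le> 8" "s \<le> 4 \<or> r \<le> 7"
      using h(2) 5 by auto
    then have False using n' 5 o unfolding r_def s_def t_def by linarith
    then show ?thesis ..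
  next
    case 6
    have "s = 0 \<or> s = 1 \<or> s = 2 \<or> s = 3 \<or> s = 4 \<or> s = 5 \<or> s = 6" using o 6 by linarith
    then have "r \<le> 6"
      using h(2) 6 o by auto
    then have "int x1 = 0 \<and> int y1 = 0 \<and> int z1 = 0 \<and> int x0 = 6 \<and> int y0 = 6 \<and> int z0 = 6"
      using n' 6 o unfolding r_def s_def t_def by linarith
    then show ?thesis by (simp add: sp)
  qed
qed

lemma unicyclic_trees_triangle:
  fixes U :: "'a pair_pre_digraph"
  assumes "unicyclic U" "unicyclic_girth U = 3" "card (pverts U) \<ge> 21" "\<not> negative_plane mu U"
  shows "\<exists>x y z. U \<simeq> trees_triangle x y z"
proof -
  obtain a b c par lev where R: "rooted_triangle U a b c par lev"
    by (rule unicyclic_girth_3_rooted[OF assms(1,2)])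
  interpret rooted_triangle U a b c par lev by (rule R)
  note small = branches_are_small[OF assms(3,4)]
  show ?thesis
    using isomorphic_tree_T_triangle[OF small] unfolding trees_triangle_def list.map .
qed

lemma second_eigenvalue_unicyclic:
  fixes U :: "'a pair_pre_digraph"
  assumes "unicyclic U" "unicyclic_girth U = 3"
  shows "nl_eigenvalue 2 U \<ge> 1 - mu \<longleftrightarrow> \<not> negative_plane mu U"
    and "nl_eigenvalue 2 U = 1 - mu \<longleftrightarrow> \<not> negative_plane mu U \<and> nonpositive_plane mu U"
proof -
  obtain a b c par lev where R: "rooted_triangle U a b c par lev"
    by (rule unicyclic_girth_3_rooted[OF assms(1,2)])
  interpret rooted_triangle U a b c par lev by (rule R)
  have "card {a, b, c} \<le> card (pverts U)" using tri fin by (rule card_mono[rotated])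
  moreover have "card {a, b, c} = 3" using dist by simp
  ultimately have card: "card (pverts U) \<ge> 2" by simp
  have less: "nl_eigenvalue 2 U < 1 - mu \<longleftrightarrow> negative_plane mu U"
    by (rule second_eigenvalue_less_iff[OF pair_graph no_isolated card])
  have le: "nl_eigenvalue 2 U \<le> 1 - mu \<longleftrightarrow> nonpositive_plane mu U"
    by (rule second_eigenvalue_le_iff[OF pair_graph no_isolated card])
  show "nl_eigenvalue 2 U \<ge> 1 - mu \<longleftrightarrow> \<not> negative_plane mu U"
    using less not_less by blast
  show "nl_eigenvalue 2 U = 1 - mu \<longleftrightarrow> \<not> negative_plane mu U \<and> nonpositive_plane mu U"
    using less le order_eq_iff not_less by metis
qed

lemma as_trees_triangle:
  "cycle_with_trees [star p, star q, tree_T l0 l1 l2] = trees_triangle (p, 0, 0) (q, 0, 0) (l0, l1, l2)"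
  "cycle_with_trees [star p, tree_T l0 l1 l2, K1] = trees_triangle (p, 0, 0) (l0, l1, l2) (0, 0, 0)"
  "cycle_with_trees [tree_T l0 l1 l2, K1, K1] = trees_triangle (l0, l1, l2) (0, 0, 0) (0, 0, 0)"
  "cycle_with_stars [p, q, r] = trees_triangle (p - 1, 0, 0) (q - 1, 0, 0) (r - 1, 0, 0)"
  by (simp_all add: trees_triangle_def star_tree_T K1_tree_T cycle_with_stars_def)

lemma isomorphic_permute:
  fixes U :: "'a pair_pre_digraph"
  assumes U: "pair_wf_digraph U"
  shows "U \<simeq> trees_triangle x y z \<longleftrightarrow> U \<simeq> trees_triangle y x z"
    and "U \<simeq> trees_triangle x y z \<longleftrightarrow> U \<simeq> trees_triangle x z y"
proof -
  have "U \<simeq> trees_triangle y x z" if "U \<simeq> trees_triangle x y z" for x y z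
    by (rule isomorphic_trans[OF U wf_trees_triangle wf_trees_triangle that trees_triangle_swap(1)])
  then show "U \<simeq> trees_triangle x y z \<longleftrightarrow> U \<simeq> trees_triangle y x z" by blast
  have "U \<simeq> trees_triangle x z y" if "U \<simeq> trees_triangle x y z" for x y z
    by (rule isomorphic_trans[OF U wf_trees_triangle wf_trees_triangle that trees_triangle_swap(2)])
  then show "U \<simeq> trees_triangle x y z \<longleftrightarrow> U \<simeq> trees_triangle x z y" by blast
qed

lemma limb_order_le_load: "limb_long x = 0 \<Longrightarrow> int (limb_order x) \<le> limb_load x"
  by (cases x) (simp add: limb_load_def limb_long_def limb_order_def)

text \<open>
  Order the trees with those having a child with two leaves on top and the others by load; then move the
  largest to the end and sort the other two.
\<close>

lemma largest_last:
  fixes U :: "'a pair_pre_digraph"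
  assumes U: "pair_wf_digraph U" and iso: "\<exists>x y z. U \<simeq> trees_triangle x y z"
  obtains x y z where "U \<simeq> trees_triangle y z x" "limb_load y \<le> limb_load z"
    "limb_long x \<ge> 1 \<or> limb_long x = 0 \<and> limb_long y = 0 \<and> limb_long z = 0 \<and> limb_load z \<le> limb_load x"
proof -
  note perm = isomorphic_permute[OF U]
  define rk where "rk x = (if limb_long x \<ge> 1 then (1 :: nat) else 0, limb_load x)" for x
  define le where "le x y \<longleftrightarrow> fst (rk x) < fst (rk y) \<or> fst (rk x) = fst (rk y) \<and> snd (rk x) \<le> snd (rk y)" for x y
  have tot: "le x y \<or> le y x" and trans: "le x y \<Longrightarrow> le y z \<Longrightarrow> le x z" for x y z
    by (auto simp: le_def)
  obtain x y z where xyz: "U \<simeq> trees_triangle y z x" using iso by blast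
  have "\<exists>x y z. U \<simeq> trees_triangle y z x \<and> le y x \<and> le z x"
  proof (cases "le y x")
    case True
    show ?thesis
    proof (cases "le z x")
      case True
      then show ?thesis using xyz \<open>le y x\<close> by blast
    next
      case False
      then have "le x z" "le y z" using tot trans \<open>le y x\<close> by blast+
      moreover have "U \<simeq> trees_triangle y x z" using xyz perm by blast
      ultimately show ?thesis by blast
    qed
  next
    case False
    then have xy: "le x y" using tot by blast
    show ?thesis
    proof (cases "le z y")
      case True
      moreover have "U \<simeq> trees_triangle x z y" using xyz perm by blast
      ultimately show ?thesis using xy by blast
    next
      case False
      then have "le y z" "le x z" using tot trans xy by blast+
      moreover have "U \<simeq> trees_triangle x y z" using xyz perm by blast
      ultimately show ?thesis by blast
    qed
  qed
  then obtain x y z where m: "U \<simeq> trees_triangle y z x" "le y x" "le z x" by blast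
  have "U \<simeq> trees_triangle z y x" using m(1) perm by blast
  then obtain y' z' where m': "U \<simeq> trees_triangle y' z' x" "le y' x" "le z' x" "limb_load y' \<le> limb_load z'"
    using m by (cases "limb_load y \<le> limb_load z") auto
  have "limb_long x \<ge> 1 \<or> limb_long x = 0 \<and> limb_long y' = 0 \<and> limb_long z' = 0 \<and> limb_load z' \<le> limb_load x"
    using m'(2,3) by (auto simp: le_def rk_def split: if_splits)
  then show thesis using that[OF m'(1,4)] by blast
qed

text \<open>
  If no tree has a child with two leaves, then the largest load is at least the average number of vertices
  off the root, which is at least 6 for \<open>n \<ge> 21\<close>; so the root of this tree has a negative diagonal entry.
\<close>

lemma no_negative_plane_cases:
  fixes U :: "'a pair_pre_digraph"
  assumes U: "pair_wf_digraph U" and iso: "\<exists>x y z. U \<simeq> trees_triangle x y z"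
    and n: "card (pverts U) \<ge> 21" and no: "\<not> negative_plane mu U"
  obtains x0 x1 x2 y z where "U \<simeq> trees_triangle y z (x0, x1, x2)"
      "card (pverts U) = 3 + limb_order y + limb_order z + limb_order (x0, x1, x2)"
      "small_legs y z" "limb_load y \<le> limb_load z" "x2 \<ge> 1 \<or> \<not> nonpositive_plane mu U"
  | x0 x1 y0 z0 where "U \<simeq> trees_triangle (y0, 0, 0) (z0, 0, 0) (x0, x1, 0)"
      "card (pverts U) = 3 + y0 + z0 + x0 + 2 * x1" "\<not> nonpositive_plane mu U"
      "sporadic_legs y0 z0 x0 x1"
proof -
  obtain x y z where m: "U \<simeq> trees_triangle y z x" "limb_load y \<le> limb_load z"
    and x: "limb_long x \<ge> 1 \<or> limb_long x = 0 \<and> limb_long y = 0 \<and> limb_long z = 0 \<and> limb_load z \<le> limb_load x"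
    by (rule largest_last[OF U iso])
  have m': "U \<simeq> trees_triangle x y z" using m(1) isomorphic_permute[OF U] by blast
  note planes = isomorphic_planes[OF U wf_trees_triangle m']
  have card: "card (pverts U) = 3 + limb_order y + limb_order z + limb_order x"
    unfolding planes(3) card_trees_triangle by simp
  have no': "\<not> negative_plane mu (trees_triangle x y z)" using no planes(1) by blast
  obtain x0 x1 x2 where xe: "x = (x0, x1, x2)" by (cases x)
  from x show thesis
  proof
    assume l: "limb_long x \<ge> 1"
    then have "small_legs y z" by (rule trees_triangle_planes(3)[OF _ no'])
    moreover have "x2 \<ge> 1" using l by (simp add: xe limb_long_def)
    ultimately show thesis using that(1)[of y z x0 x1 x2] m card unfolding xe by blast
  next
    assume l: "limb_long x = 0 \<and> limb_long y = 0 \<and> limb_long z = 0 \<and> limb_load z \<le> limb_load x"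
    have "int (limb_order x) \<le> limb_load x" "int (limb_order y) \<le> limb_load x" "int (limb_order z) \<le> limb_load x"
      using limb_order_le_load[of x] limb_order_le_load[of y] limb_order_le_load[of z] l m(2) by auto
    then have heavy: "limb_load x \<ge> 5" using n card by linarith
    have l': "limb_long x = 0" "limb_long y = 0" "limb_long z = 0" using l by simp_all
    have ok: "heavy_legs x y z" using trees_triangle_planes(4)[OF l' heavy] no' by blast
    have np: "\<not> nonpositive_plane mu U"
      using trees_triangle_planes(5)[OF l' heavy ok] planes(2) by blast
    obtain y0 y1 y2 where ye: "y = (y0, y1, y2)" by (cases y)
    obtain z0 z1 z2 where ze: "z = (z0, z1, z2)" by (cases z)
    have 0: "x2 = 0" "y2 = 0" "z2 = 0" using l by (simp_all add: xe ye ze limb_long_def)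
    have "small_legs y z \<or> y1 = 0 \<and> z1 = 0 \<and>
      sporadic_legs y0 z0 x0 x1"
      unfolding xe ye ze 0
    proof (rule heavy_legs_cases)
      show "heavy_legs (x0, x1, 0) (y0, y1, 0) (z0, z1, 0)" using ok unfolding xe ye ze 0 .
      show "limb_load (y0, y1, 0) \<le> limb_load (z0, z1, 0)" using m(2) unfolding ye ze 0 .
      show "limb_load (z0, z1, 0) \<le> limb_load (x0, x1, 0)" using l unfolding xe ze 0 by blast
      show "3 + limb_order (x0, x1, 0) + limb_order (y0, y1, 0) + limb_order (z0, z1, 0) \<ge> 21"
        using n card unfolding xe ye ze 0 by simp
    qed
    then show thesis
    proof
      assume "small_legs y z"
      then show thesis using that(1)[of y z x0 x1 x2] m card np unfolding xe by blast
    next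
      assume *: "y1 = 0 \<and> z1 = 0 \<and>
      sporadic_legs y0 z0 x0 x1"
      then have 1: "y1 = 0" "z1 = 0" by auto
      show thesis
      proof (rule that(2)[of y0 z0 x0 x1])
        show "U \<simeq> trees_triangle (y0, 0, 0) (z0, 0, 0) (x0, x1, 0)" using m(1) unfolding xe ye ze 0 1 .
        show "card (pverts U) = 3 + y0 + z0 + x0 + 2 * x1"
          using card unfolding xe ye ze 0 1 by (simp add: limb_order_def)
      qed (use np * in blast)+
    qed
  qed
qed

lemma small_legs_planes:
  fixes U :: "'a pair_pre_digraph"
  assumes U: "pair_wf_digraph U" and iso: "U \<simeq> trees_triangle y z x" and small: "small_legs y z"
  shows "\<not> negative_plane mu U"
    and "limb_long x \<ge> 1 \<Longrightarrow> nonpositive_plane mu U \<longleftrightarrow> limb_long x \<ge> 2 \<or> (4 - limb_load y) * (4 - limb_load z) = 6"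
proof -
  have m': "U \<simeq> trees_triangle x y z" using iso isomorphic_permute[OF U] by blast
  note planes = isomorphic_planes[OF U wf_trees_triangle m']
  show "\<not> negative_plane mu U"
    using trees_triangle_planes(1)[OF small] planes(1) by blast
  show "limb_long x \<ge> 1 \<Longrightarrow> nonpositive_plane mu U \<longleftrightarrow> limb_long x \<ge> 2 \<or> (4 - limb_load y) * (4 - limb_load z) = 6"
    using trees_triangle_planes(2)[OF small] planes(2) by blast
qed

lemma heavy_legs_no_negative_plane:
  fixes U :: "'a pair_pre_digraph"
  assumes U: "pair_wf_digraph U" and iso: "U \<simeq> trees_triangle (y0, 0, 0) (z0, 0, 0) (x0, x1, 0)"
    and heavy: "x0 + 4 * x1 \<ge> 5" and ok: "heavy_legs (x0, x1, 0) (y0, 0, 0) (z0, 0, 0)"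
  shows "\<not> negative_plane mu U"
proof -
  let ?x = "(x0, x1, 0) :: legs"
  have m': "U \<simeq> trees_triangle ?x (y0, 0, 0) (z0, 0, 0)" using iso isomorphic_permute[OF U] by blast
  have l: "limb_long (y0, 0, 0) = 0" "limb_long (z0, 0, 0) = 0" "limb_long ?x = 0" "limb_load ?x \<ge> 5"
    using heavy by (simp_all add: limb_long_def limb_load_def)
  show ?thesis
    using trees_triangle_planes(4)[OF l(3,1,2,4)] ok isomorphic_planes(1)[OF U wf_trees_triangle m'] by blast
qed

theorem theorem5p1:
  fixes U :: "'a pair_pre_digraph" and n :: nat
  assumes "n \<ge> 21"
    and "unicyclic U"
    and "card (pverts U) = n"
    and "unicyclic_girth U = 3"
  shows "(nl_eigenvalue 2 U \<ge> 1 - sqrt 6 / 3 \<longleftrightarrow>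
        (\<exists>l0 l1 l2. U \<simeq> cycle_with_trees [star 1, star 1, tree_T l0 l1 l2] \<and>
          l0 + 2 * l1 + 3 * l2 + 5 = n \<and> 21 \<le> n) \<or>
        (\<exists>l0 l1 l2. U \<simeq> cycle_with_trees [star 1, star 2, tree_T l0 l1 l2] \<and>
          l0 + 2 * l1 + 3 * l2 + 6 = n \<and> 21 \<le> n) \<or>
        (\<exists>l0 l1. U \<simeq> cycle_with_trees [star 1, star 3, tree_T l0 l1 0] \<and>
          21 \<le> n \<and> l0 + 2 * l1 + 7 = n \<and> n \<le> 28 \<and> l1 \<le> 3 \<and>
         (l1 = 3 \<and> 8 \<le> l0 \<and> l0 \<le> 9 \<or>
          l1 = 2 \<and> 10 \<le> l0 \<and> l0 \<le> 13 \<or>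
          l1 = 1 \<and> 12 \<le> l0 \<and> l0 \<le> 17 \<or>
          l1 = 0 \<and> 14 \<le> l0 \<and> l0 \<le> 21)) \<or>
        (\<exists>l0 l1. U \<simeq> cycle_with_trees [star 2, star 2, tree_T l0 l1 0] \<and>
          21 \<le> n \<and> l0 + 2 * l1 + 7 = n \<and> n \<le> 37 \<and> l1 \<le> 7 \<and>
         (l1 = 7 \<and> 0 \<le> l0 \<and> l0 \<le> 2 \<or>
          l1 = 6 \<and> 2 \<le> l0 \<and> l0 \<le> 6 \<or>
          l1 = 5 \<and> 4 \<le> l0 \<and> l0 \<le> 10 \<or>
          l1 = 4 \<and> 6 \<le> l0 \<and> l0 \<le> 14 \<or>
          l1 = 3 \<and> 8 \<le> l0 \<and> l0 \<le> 18 \<or>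
          l1 = 2 \<and> 10 \<le> l0 \<and> l0 \<le> 22 \<or>
          l1 = 1 \<and> 12 \<le> l0 \<and> l0 \<le> 26 \<or>
          l1 = 0 \<and> 14 \<le> l0 \<and> l0 \<le> 30)) \<or>
        U \<simeq> cycle_with_trees [star 2, star 3, tree_T 11 1 0] \<or>
        (\<exists>k. 14 \<le> k \<and> k \<le> 16 \<and> U \<simeq> cycle_with_stars [3, 4, k]) \<or>
        U \<simeq> cycle_with_stars [4, 4, 13] \<or>
        U \<simeq> cycle_with_stars [7, 7, 7] \<or>
        (\<exists>l0 l1 l2. U \<simeq> cycle_with_trees [star 1, tree_T l0 l1 l2, K1] \<and>
          l0 + 2 * l1 + 3 * l2 + 4 = n \<and> 21 \<le> n) \<or>
        (\<exists>l0 l1 l2. U \<simeq> cycle_with_trees [star 2, tree_T l0 l1 l2, K1] \<and>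
          l0 + 2 * l1 + 3 * l2 + 5 = n \<and> 21 \<le> n) \<or>
        (\<exists>l0 l1. U \<simeq> cycle_with_trees [star 3, tree_T l0 l1 0, K1] \<and>
          21 \<le> n \<and> l0 + 2 * l1 + 6 = n \<and> n \<le> 39 \<and> l1 \<le> 8 \<and>
         (l1 = 8 \<and> 0 \<le> l0 \<and> l0 \<le> 1 \<or>
          l1 = 7 \<and> 1 \<le> l0 \<and> l0 \<le> 5 \<or>
          l1 = 6 \<and> 3 \<le> l0 \<and> l0 \<le> 9 \<or>
          l1 = 5 \<and> 5 \<le> l0 \<and> l0 \<le> 13 \<or>
          l1 = 4 \<and> 7 \<le> l0 \<and> l0 \<le> 17 \<or>
          l1 = 3 \<and> 9 \<le> l0 \<and> l0 \<le> 21 \<or>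
          l1 = 2 \<and> 11 \<le> l0 \<and> l0 \<le> 25 \<or>
          l1 = 1 \<and> 13 \<le> l0 \<and> l0 \<le> 29 \<or>
          l1 = 0 \<and> 15 \<le> l0 \<and> l0 \<le> 33)) \<or>
        (\<exists>l0 l1 l2. U \<simeq> cycle_with_trees [tree_T l0 l1 l2, K1, K1] \<and>
          l0 + 2 * l1 + 3 * l2 + 3 = n \<and> 21 \<le> n)) \<and>
    (nl_eigenvalue 2 U = 1 - sqrt 6 / 3 \<longleftrightarrow>
        (\<exists>l0 l1 l2. l2 \<ge> 2 \<and> U \<simeq> cycle_with_trees [star 1, star 1, tree_T l0 l1 l2]) \<or>
        (\<exists>l0 l1 l2. l2 \<ge> 1 \<and> U \<simeq> cycle_with_trees [star 1, star 2, tree_T l0 l1 l2]) \<or>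
        (\<exists>l0 l1 l2. l2 \<ge> 2 \<and> U \<simeq> cycle_with_trees [star 1, tree_T l0 l1 l2, K1]) \<or>
        (\<exists>l0 l1 l2. l2 \<ge> 2 \<and> U \<simeq> cycle_with_trees [star 2, tree_T l0 l1 l2, K1]) \<or>
        (\<exists>l0 l1 l2. l2 \<ge> 2 \<and> U \<simeq> cycle_with_trees [tree_T l0 l1 l2, K1, K1]))"
proof -
  have uni: "unicyclic U" and girth: "unicyclic_girth U = 3" and n: "n \<ge> 21" "card (pverts U) = n"
    using assms by simp_all
  have U: "pair_wf_digraph U"
    using uni by (auto simp: unicyclic_def pair_graph_def pair_digraph_def pair_fin_digraph_def)
  note ev = second_eigenvalue_unicyclic[OF uni girth]
  have n21: "card (pverts U) \<ge> 21" using n by simp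
  have iso: "\<exists>x y z. U \<simeq> trees_triangle x y z" if "\<not> negative_plane mu U"
    by (rule unicyclic_trees_triangle[OF uni girth n21 that])
  have one: "U \<simeq> trees_triangle (p, 0, 0) l (0, 0, 0) \<longleftrightarrow> U \<simeq> trees_triangle (0, 0, 0) (p, 0, 0) l" for p l
    using isomorphic_permute[OF U] by blast
  have two: "U \<simeq> trees_triangle l (0, 0, 0) (0, 0, 0) \<longleftrightarrow> U \<simeq> trees_triangle (0, 0, 0) (0, 0, 0) l" for l
    using isomorphic_permute[OF U] by blast
  note T = as_trees_triangle one two
  have small: "small_legs (p, 0, 0) (q, 0, 0) \<longleftrightarrow> p \<le> 3 \<and> q \<le> 3 \<and> (4 - int p) * (4 - int q) \<ge> 6" for p q
    by (auto simp: small_legs_def limb_long_def limb_load_def)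
  have small_neg: "\<not> negative_plane mu U" if "U \<simeq> trees_triangle (p, 0, 0) (q, 0, 0) l"
    "p \<le> 3" "q \<le> 3" "(4 - int p) * (4 - int q) \<ge> 6" for p q l
    by (rule small_legs_planes(1)[OF U that(1)]) (use that small in blast)
  have heavy_neg: "\<not> negative_plane mu U" if "U \<simeq> trees_triangle (p, 0, 0) (q, 0, 0) (x0, x1, 0)"
    "x0 + 4 * x1 \<ge> 5" "heavy_legs (x0, x1, 0) (p, 0, 0) (q, 0, 0)" for p q x0 x1
    by (rule heavy_legs_no_negative_plane[OF U that])
  \<comment> \<open>The items of the two lists get names, so that the final propositional steps treat them as atoms.\<close>
  define D1 where "D1 \<longleftrightarrow> (\<exists>l0 l1 l2. U \<simeq> cycle_with_trees [star 1, star 1, tree_T l0 l1 l2] \<and> l0 + 2 * l1 + 3 * l2 + 5 = n \<and> 21 \<le> n)"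
  define D2 where "D2 \<longleftrightarrow> (\<exists>l0 l1 l2. U \<simeq> cycle_with_trees [star 1, star 2, tree_T l0 l1 l2] \<and> l0 + 2 * l1 + 3 * l2 + 6 = n \<and> 21 \<le> n)"
  define D3 where "D3 \<longleftrightarrow> (\<exists>l0 l1. U \<simeq> cycle_with_trees [star 1, star 3, tree_T l0 l1 0] \<and> 21 \<le> n \<and> l0 + 2 * l1 + 7 = n \<and> n \<le> 28 \<and> l1 \<le> 3 \<and> (l1 = 3 \<and> 8 \<le> l0 \<and> l0 \<le> 9 \<or> l1 = 2 \<and> 10 \<le> l0 \<and> l0 \<le> 13 \<or> l1 = 1 \<and> 12 \<le> l0 \<and> l0 \<le> 17 \<or> l1 = 0 \<and> 14 \<le> l0 \<and> l0 \<le> 21))"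
  define D4 where "D4 \<longleftrightarrow> (\<exists>l0 l1. U \<simeq> cycle_with_trees [star 2, star 2, tree_T l0 l1 0] \<and> 21 \<le> n \<and> l0 + 2 * l1 + 7 = n \<and> n \<le> 37 \<and> l1 \<le> 7 \<and> (l1 = 7 \<and> 0 \<le> l0 \<and> l0 \<le> 2 \<or> l1 = 6 \<and> 2 \<le> l0 \<and> l0 \<le> 6 \<or> l1 = 5 \<and> 4 \<le> l0 \<and> l0 \<le> 10 \<or> l1 = 4 \<and> 6 \<le> l0 \<and> l0 \<le> 14 \<or> l1 = 3 \<and> 8 \<le> l0 \<and> l0 \<le> 18 \<or> l1 = 2 \<and> 10 \<le> l0 \<and> l0 \<le> 22 \<or> l1 = 1 \<and> 12 \<le> l0 \<and> l0 \<le> 26 \<or> l1 = 0 \<and> 14 \<le> l0 \<and> l0 \<le> 30))"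
  define D5 where "D5 \<longleftrightarrow> (U \<simeq> cycle_with_trees [star 2, star 3, tree_T 11 1 0])"
  define D6 where "D6 \<longleftrightarrow> (\<exists>k. 14 \<le> k \<and> k \<le> 16 \<and> U \<simeq> cycle_with_stars [3, 4, k])"
  define D7 where "D7 \<longleftrightarrow> (U \<simeq> cycle_with_stars [4, 4, 13])"
  define D8 where "D8 \<longleftrightarrow> (U \<simeq> cycle_with_stars [7, 7, 7])"
  define D9 where "D9 \<longleftrightarrow> (\<exists>l0 l1 l2. U \<simeq> cycle_with_trees [star 1, tree_T l0 l1 l2, K1] \<and> l0 + 2 * l1 + 3 * l2 + 4 = n \<and> 21 \<le> n)"
  define D10 where "D10 \<longleftrightarrow> (\<exists>l0 l1 l2. U \<simeq> cycle_with_trees [star 2, tree_T l0 l1 l2, K1] \<and> l0 + 2 * l1 + 3 * l2 + 5 = n \<and> 21 \<le> n)"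
  define D11 where "D11 \<longleftrightarrow> (\<exists>l0 l1. U \<simeq> cycle_with_trees [star 3, tree_T l0 l1 0, K1] \<and> 21 \<le> n \<and> l0 + 2 * l1 + 6 = n \<and> n \<le> 39 \<and> l1 \<le> 8 \<and> (l1 = 8 \<and> 0 \<le> l0 \<and> l0 \<le> 1 \<or> l1 = 7 \<and> 1 \<le> l0 \<and> l0 \<le> 5 \<or> l1 = 6 \<and> 3 \<le> l0 \<and> l0 \<le> 9 \<or> l1 = 5 \<and> 5 \<le> l0 \<and> l0 \<le> 13 \<or> l1 = 4 \<and> 7 \<le> l0 \<and> l0 \<le> 17 \<or> l1 = 3 \<and> 9 \<le> l0 \<and> l0 \<le> 21 \<or> l1 = 2 \<and> 11 \<le> l0 \<and> l0 \<le> 25 \<or> l1 = 1 \<and> 13 \<le> l0 \<and> l0 \<le> 29 \<or> l1 = 0 \<and> 15 \<le> l0 \<and> l0 \<le> 33))"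
  define D12 where "D12 \<longleftrightarrow> (\<exists>l0 l1 l2. U \<simeq> cycle_with_trees [tree_T l0 l1 l2, K1, K1] \<and> l0 + 2 * l1 + 3 * l2 + 3 = n \<and> 21 \<le> n)"
  define E1 where "E1 \<longleftrightarrow> (\<exists>l0 l1 l2. l2 \<ge> 2 \<and> U \<simeq> cycle_with_trees [star 1, star 1, tree_T l0 l1 l2])"
  define E2 where "E2 \<longleftrightarrow> (\<exists>l0 l1 l2. l2 \<ge> 1 \<and> U \<simeq> cycle_with_trees [star 1, star 2, tree_T l0 l1 l2])"
  define E3 where "E3 \<longleftrightarrow> (\<exists>l0 l1 l2. l2 \<ge> 2 \<and> U \<simeq> cycle_with_trees [star 1, tree_T l0 l1 l2, K1])"
  define E4 where "E4 \<longleftrightarrow> (\<exists>l0 l1 l2. l2 \<ge> 2 \<and> U \<simeq> cycle_with_trees [star 2, tree_T l0 l1 l2, K1])"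
  define E5 where "E5 \<longleftrightarrow> (\<exists>l0 l1 l2. l2 \<ge> 2 \<and> U \<simeq> cycle_with_trees [tree_T l0 l1 l2, K1, K1])"
  have backward: "\<not> negative_plane mu U" if "D1 \<or> D2 \<or> D3 \<or> D4 \<or> D5 \<or> D6 \<or> D7 \<or> D8 \<or> D9 \<or> D10 \<or> D11 \<or> D12"
    using that
  proof (elim disjE)
    assume D1
    then show ?thesis unfolding D1_def T by (elim exE conjE, elim small_neg) simp_all
  next
    assume D2
    then show ?thesis unfolding D2_def T by (elim exE conjE, elim small_neg) simp_all
  next
    assume D3
    then obtain l0 l1 where "U \<simeq> trees_triangle (1, 0, 0) (3, 0, 0) (l0, l1, 0)" "14 \<le> l0 + 2 * l1" "l0 + 4 * l1 \<le> 21"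
      unfolding D3_def T by auto
    then show ?thesis by (elim heavy_neg) (auto simp: heavy_legs_def limb_load_def)
  next
    assume D4
    then obtain l0 l1 where "U \<simeq> trees_triangle (2, 0, 0) (2, 0, 0) (l0, l1, 0)" "14 \<le> l0 + 2 * l1" "l0 + 4 * l1 \<le> 30"
      unfolding D4_def T by auto
    then show ?thesis by (elim heavy_neg) (auto simp: heavy_legs_def limb_load_def)
  next
    assume D5
    then show ?thesis unfolding D5_def T by (elim heavy_neg) (auto simp: heavy_legs_def limb_load_def)
  next
    assume D6
    then obtain k where "U \<simeq> trees_triangle (2, 0, 0) (3, 0, 0) (k, 0, 0)" "13 \<le> k" "k \<le> 15"
      unfolding D6_def T by force
    then show ?thesis by (elim heavy_neg) (auto simp: heavy_legs_def limb_load_def)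
  next
    assume D7
    then have "U \<simeq> trees_triangle (3, 0, 0) (3, 0, 0) (12, 0, 0)" unfolding D7_def T by simp
    then show ?thesis by (elim heavy_neg) (auto simp: heavy_legs_def limb_load_def)
  next
    assume D8
    then have "U \<simeq> trees_triangle (6, 0, 0) (6, 0, 0) (6, 0, 0)" unfolding D8_def T by simp
    then show ?thesis by (elim heavy_neg) (auto simp: heavy_legs_def limb_load_def)
  next
    assume D9
    then show ?thesis unfolding D9_def T by (elim exE conjE, elim small_neg) simp_all
  next
    assume D10
    then show ?thesis unfolding D10_def T by (elim exE conjE, elim small_neg) simp_all
  next
    assume D11
    then obtain l0 l1 where "U \<simeq> trees_triangle (0, 0, 0) (3, 0, 0) (l0, l1, 0)" "15 \<le> l0 + 2 * l1" "l0 + 4 * l1 \<le> 33"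
      unfolding D11_def T by auto
    then show ?thesis by (elim heavy_neg) (auto simp: heavy_legs_def limb_load_def)
  next
    assume D12
    then show ?thesis unfolding D12_def T by (elim exE conjE, elim small_neg) simp_all
  qed
  have forward: "D1 \<or> D2 \<or> D3 \<or> D4 \<or> D5 \<or> D6 \<or> D7 \<or> D8 \<or> D9 \<or> D10 \<or> D11 \<or> D12" if no: "\<not> negative_plane mu U"
  proof (rule no_negative_plane_cases[OF U iso[OF no] n21 no])
    fix x0 x1 x2 y z
    assume i: "U \<simeq> trees_triangle y z (x0, x1, x2)"
      and c: "card (pverts U) = 3 + limb_order y + limb_order z + limb_order (x0, x1, x2)"
      and sm: "small_legs y z" "limb_load y \<le> limb_load z"
    from sm show ?thesis
    proof (cases rule: small_legs_cases)
      case 1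
      have D12 unfolding D12_def T using i c n unfolding 1
        by - (rule exI[of _ x0], rule exI[of _ x1], rule exI[of _ x2], simp add: limb_order_def)
      then show ?thesis by blast
    next
      case 2
      have D9 unfolding D9_def T using i c n unfolding 2
        by - (rule exI[of _ x0], rule exI[of _ x1], rule exI[of _ x2], simp add: limb_order_def)
      then show ?thesis by blast
    next
      case 3
      have D10 unfolding D10_def T using i c n unfolding 3
        by - (rule exI[of _ x0], rule exI[of _ x1], rule exI[of _ x2], simp add: limb_order_def)
      then show ?thesis by blast
    next
      case 4
      have D1 unfolding D1_def T using i c n unfolding 4
        by - (rule exI[of _ x0], rule exI[of _ x1], rule exI[of _ x2], simp add: limb_order_def)
      then show ?thesis by blast
    next
      case 5
      have D2 unfolding D2_def T using i c n unfolding 5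
        by - (rule exI[of _ x0], rule exI[of _ x1], rule exI[of _ x2], simp add: limb_order_def)
      then show ?thesis by blast
    qed
  next
    fix x0 x1 y0 z0
    assume i: "U \<simeq> trees_triangle (y0, 0, 0) (z0, 0, 0) (x0, x1, 0)"
      and c: "card (pverts U) = 3 + y0 + z0 + x0 + 2 * x1"
      and cs: "sporadic_legs y0 z0 x0 x1"
    from cs show ?thesis
      unfolding sporadic_legs_def
    proof (elim disjE conjE)
      assume yz: "y0 = 0" "z0 = 3" and b: "x0 + 4 * x1 \<le> 33"
      have n': "n = x0 + 2 * x1 + 6" using c n yz by simp
      have x1: "x1 \<le> 8" using b n n' by linarith
      then have "x1 = 0 \<or> x1 = 1 \<or> x1 = 2 \<or> x1 = 3 \<or> x1 = 4 \<or> x1 = 5 \<or> x1 = 6 \<or> x1 = 7 \<or> x1 = 8" by linarith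
      then have D11 unfolding D11_def T using i b n n' x1 unfolding yz
        by - (rule exI[of _ x0], rule exI[of _ x1], elim disjE; simp)
      then show ?thesis by blast
    next
      assume yz: "y0 = 1" "z0 = 3" and b: "x0 + 4 * x1 \<le> 21"
      have n': "n = x0 + 2 * x1 + 7" using c n yz by simp
      have x1: "x1 \<le> 3" using b n n' by linarith
      then have "x1 = 0 \<or> x1 = 1 \<or> x1 = 2 \<or> x1 = 3" by linarith
      then have D3 unfolding D3_def T using i b n n' x1 unfolding yz
        by - (rule exI[of _ x0], rule exI[of _ x1], elim disjE; simp)
      then show ?thesis by blast
    next
      assume yz: "y0 = 2" "z0 = 2" and b: "x0 + 4 * x1 \<le> 30"
      have n': "n = x0 + 2 * x1 + 7" using c n yz by simp
      have x1: "x1 \<le> 7" 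
        using b n n' by presburger
      then have "x1 = 0 \<or> x1 = 1 \<or> x1 = 2 \<or> x1 = 3 \<or> x1 = 4 \<or> x1 = 5 \<or> x1 = 6 \<or> x1 = 7" by linarith
      then have D4 unfolding D4_def T using i b n n' x1 unfolding yz
        by - (rule exI[of _ x0], rule exI[of _ x1], elim disjE; simp)
      then show ?thesis by blast
    next
      assume yz: "y0 = 2" "z0 = 3" and b: "x0 + 4 * x1 \<le> 15"
      have n': "n = x0 + 2 * x1 + 8" using c n yz by simp
      then have "x1 = 1 \<and> x0 = 11 \<or> x1 = 0 \<and> 13 \<le> x0 \<and> x0 \<le> 15" using b n by presburger
      then show ?thesis
      proof (elim disjE conjE)
        assume "x1 = 1" "x0 = 11"
        then have D5 unfolding D5_def T using i unfolding yz by simp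
        then show ?thesis by blast
      next
        assume "x1 = 0" "13 \<le> x0" "x0 \<le> 15"
        then have D6 unfolding D6_def T using i unfolding yz by - (rule exI[of _ "x0 + 1"], simp)
        then show ?thesis by blast
      qed
    next
      assume yz: "y0 = 3" "z0 = 3" and b: "x0 + 4 * x1 \<le> 12"
      have n': "n = x0 + 2 * x1 + 9" using c n yz by simp
      then have "x1 = 0 \<and> x0 = 12" using b n by presburger
      then have D7 unfolding D7_def T using i unfolding yz by simp
      then show ?thesis by blast
    next
      assume "y0 = 6" "z0 = 6" "x0 = 6" "x1 = 0"
      then have D8 unfolding D8_def T using i by simp
      then show ?thesis by blast
    qed
  qed
  have eq_backward: "\<not> negative_plane mu U \<and> nonpositive_plane mu U" if "E1 \<or> E2 \<or> E3 \<or> E4 \<or> E5"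
  proof -
    have sm: "\<not> negative_plane mu U \<and> nonpositive_plane mu U"
      if "U \<simeq> trees_triangle (p, 0, 0) (q, 0, 0) (l0, l1, l2)" "p \<le> 3" "q \<le> 3" "(4 - int p) * (4 - int q) \<ge> 6"
        "l2 \<ge> 1" "l2 \<ge> 2 \<or> (4 - int p) * (4 - int q) = 6" for p q l0 l1 l2
    proof -
      have "small_legs (p, 0, 0) (q, 0, 0)" using that small by blast
      from small_legs_planes[OF U that(1) this] show ?thesis
        using that(5,6) by (simp add: limb_long_def limb_load_def)
    qed
    from that show ?thesis
    proof (elim disjE)
      assume E1
      then show ?thesis unfolding E1_def T by (elim exE conjE, elim sm) simp_all
    next
      assume E2
      then show ?thesis unfolding E2_def T by (elim exE conjE, elim sm) simp_all
    next
      assume E3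
      then show ?thesis unfolding E3_def T by (elim exE conjE, elim sm) simp_all
    next
      assume E4
      then show ?thesis unfolding E4_def T by (elim exE conjE, elim sm) simp_all
    next
      assume E5
      then show ?thesis unfolding E5_def T by (elim exE conjE, elim sm) simp_all
    qed
  qed
  have eq_forward: "E1 \<or> E2 \<or> E3 \<or> E4 \<or> E5" if no: "\<not> negative_plane mu U" and np: "nonpositive_plane mu U"
  proof (rule no_negative_plane_cases[OF U iso[OF no] n21 no])
    fix x0 x1 x2 y z
    assume i: "U \<simeq> trees_triangle y z (x0, x1, x2)"
      and sm: "small_legs y z" "limb_load y \<le> limb_load z" and "x2 \<ge> 1 \<or> \<not> nonpositive_plane mu U"
    then have x2: "x2 \<ge> 1" using np by blast
    then have c: "x2 \<ge> 2 \<or> (4 - limb_load y) * (4 - limb_load z) = 6"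
      using small_legs_planes(2)[OF U i sm(1)] np by (simp add: limb_long_def)
    from sm show ?thesis
    proof (cases rule: small_legs_cases)
      case 1
      then have E5 unfolding E5_def T using i c by (auto simp: limb_load_def)
      then show ?thesis by blast
    next
      case 2
      then have E3 unfolding E3_def T using i c by (auto simp: limb_load_def)
      then show ?thesis by blast
    next
      case 3
      then have E4 unfolding E4_def T using i c by (auto simp: limb_load_def)
      then show ?thesis by blast
    next
      case 4
      then have E1 unfolding E1_def T using i c by (auto simp: limb_load_def)
      then show ?thesis by blast
    next
      case 5
      then have E2 unfolding E2_def T using i x2 by auto
      then show ?thesis by blast
    qed
  next
    assume "\<not> nonpositive_plane mu U"
    then show ?thesis using np by blast
  qed
  have "\<not> negative_plane mu U \<longleftrightarrow> D1 \<or> D2 \<or> D3 \<or> D4 \<or> D5 \<or> D6 \<or> D7 \<or> D8 \<or> D9 \<or> D10 \<or> D11 \<or> D12" using forward backward by satx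
  moreover have "\<not> negative_plane mu U \<and> nonpositive_plane mu U \<longleftrightarrow> E1 \<or> E2 \<or> E3 \<or> E4 \<or> E5"
    using eq_forward eq_backward by satx
  ultimately show ?thesis
    unfolding ev D1_def D2_def D3_def D4_def D5_def D6_def D7_def D8_def D9_def D10_def D11_def D12_def E1_def E2_def E3_def E4_def E5_def by (rule conjI)
qed

end
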